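(* Assume the standing setting and assumptions (F1)–(F7) listed in the context. Suppose the time-integrated variational problem: $C|_{\Gamma_{\rm in}}=g$ and, for $t\in[0,T]$ and all $v\in H^1_{0,\Gamma_{\rm in}}(\Omega)$, $$(\omega C,v)+((1-\omega)\rho_sq(C),v)+\Big(\int_0^t\mathbf u\cdot\nabla C\,dt',v\Big)+\Big(\int_0^tD\nabla C\,dt',\nabla v\Big)=\Big(\int_0^tf\,dt',v\Big)+(\omega C_0,v)+((1-\omega)\rho_sq(C_0),v),$$ has an exact solution $C\in H^1(0,T;H^{k+1}(\Omega))$, and let $C_h(t)\in X^h$, with $C_h|_{\Gamma_{\rm in}}=g_h$, solve the semi-discrete problem obtained by replacing $C$ by $C_h$ on the left-hand side (keeping $C_0$ on the right-hand side) and testing with all $v_h\in X^h_{0,\Gamma_{\rm in}}$. Then for all $1\le r\le k+1$ and each $T>0$, \begin{align*} &\omega\int_0^T\|C-C_h\|^2dt+\Big\|\int_0^TD^{1/2}\nabla(C-C_h)\,dt'\Big\|^2\\ &\le h^{2r-2}\int_0^T\|C\|_r^2\,dt\ \exp\Big(T+\frac{3T\|\mathbf u\|_\infty^2\|D^{-1/2}\|_\infty^2}{\omega}\Big)\\ &\qquad\times\Big(4\|D^{1/2}\|_\infty^2+3\omega+4\|\mathbf u\|_\infty^2\|D^{-1/2}\|_\infty^2+\frac{3(1-\omega)^2\rho_s^2\kappa_2^2}{\omega}\Big)K^2, \end{align*} where $K$ is the constant (independent of $h$) in the approximation property $\inf\{\|w-\hat w_h\|_1:\hat w_h\in X^h,\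 \hat w_h|_{\Gamma_{\rm in}}=g_h\}\le Kh^{r-1}\|w\|_r$ for $w\in H^r(\Omega)$ with $w|_{\Gamma_{\rm in}}=g$.
   Context: Setting. $\Omega\subset\mathbb R^d$, $d\in\{1,2,3\}$, is a bounded polyhedral domain with boundary $\Gamma$ and unit outward normal $\vec n$. $\mathbf u=\mathbf u(x)$ is a given velocity field with $\nabla\cdot\mathbf u=0$. $\Gamma$ is partitioned into $\Gamma_{\rm in}=\{\mathbf u\cdot\vec n<0\}$, $\Gamma_{\rm out}=\{\mathbf u\cdot\vec n>0\}$ and $\Gamma_{\rm n}=\Gamma\setminus(\Gamma_{\rm in}\cup\Gamma_{\rm out})$. The underlying problem is $\omega\partial_tC+(1-\omega)\rho_s\partial_tq(C)+\nabla\cdot(\mathbf uC)-\nabla\cdot(D\nabla C)=f$ in $\Omega$, $t>0$; $C=g$ on $\Gamma_{\rm in}$; $(D\nabla C)\cdot\vec n=0$ on $\Gamma_{\rm n}\cup\Gamma_{\rm out}$; $C(\cdot,0)=C_0\in L^2(\Omega)$, with $f\in L^2(0,T;L^2(\Omega))$, porosity $0\le\omega\le1$, density $\rho_s$, and $g=g(x)$ independent of time. Notation. $(\cdot,\cdot)$, $\|\cdot\|$ are the $L^2(\Omega)$ inner product and norm, $\|\cdot\|_r$ the $H^r(\Omega)$ norm, $\|\cdot\|_\infty$ the sup norm over $\Omega$. $H^1_{0,\Gamma_{\rm in}}(\Omega)=\{v\in H^1(\Omega):v|_{\Gamma_{\rm in}}=0\}$. $X^h\subset H^1(\Omega)$ is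 a finite-dimensional finite element space on a regular triangulation of $\Omega$ of mesh size $h$, $X^h_{0,\Gamma_{\rm in}}=\{v_h\in X^h:v_h|_{\Gamma_{\rm in}}=0\}$, $X^h_{\Gamma_{\rm in}}$ is the space of restrictions of $X^h$ to $\Gamma_{\rm in}$, and $g_h=\Pi_hg$ is the interpolant of $g$ in $X^h_{\Gamma_{\rm in}}$. For some $k\ge1$, $X^h$ satisfies $\inf_{w_h\in X^h}\|w-w_h\|_s\le Kh^{r-s}\|w\|_r$ for $s=0,1$, $1\le r\le k+1$ (e.g. piecewise polynomials of degree $\le k$), and the approximation property with boundary constraint displayed in the claim. Assumptions. (F1) $\omega,\rho_s$ are constants in time and space. (F2) $\mathbf u$ is nonzero and bounded in $L^\infty$. (F3) $D(x)=[d_{ij}]$ is symmetric positive definite, $\|D\|_\infty\le\beta_1$ and $|\partial d_{ij}/\partial x_i|\le\beta_2$ for all $i,j$. (F4) There is a unique solution $C\in L^\infty(0,T;L^2(\Omega))\cap L^2(0,T;H^1(\Omega))$. (F5) $q\in C^1$ is an explicit Lipschitz continuous function of $C$, $q(0)=0$, $q(C)>0$ for $C>0$, $q$ is strictly increasing, and $q'(C)\ge\kappa_1>0$ for all $C\ge0$. (F6) $q'$ is Lipschitz continuous and $q'(C)\le\kappa_2$. (F7) $q''$ is Lipschitz continuous and bounded. *)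

theory Defs
  imports "HOL-Analysis.Analysis"
begin

section \<open>Smooth functions and multi-indices\<close>

primrec dir_derivs :: "'a::euclidean_space list \<Rightarrow> ('a \<Rightarrow> real) \<Rightarrow> 'a \<Rightarrow> real" where
  "dir_derivs [] \<phi> = \<phi>"
| "dir_derivs (b # bs) \<phi> = (\<lambda>x. frechet_derivative (dir_derivs bs \<phi>) (at x) b)"

definition smooth :: "('a::euclidean_space \<Rightarrow> real) \<Rightarrow> bool" where
  "smooth \<phi> \<longleftrightarrow> (\<forall>bs x. dir_derivs bs \<phi> differentiable (at x))"

definition test_functions :: "'a::euclidean_space set \<Rightarrow> ('a \<Rightarrow> real) set" where
  "test_functions \<Omega> =
     {\<phi>. smooth \<phi> \<and> compact (closure {x. \<phi> x \<noteq> 0}) \<and> closure {x. \<phi> x \<noteq> 0} \<subseteq> \<Omega>}"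

definition grad :: "(real^'n \<Rightarrow> real) \<Rightarrow> real^'n \<Rightarrow> real^'n" where
  "grad \<phi> x = (\<chi> i. dir_derivs [axis i 1] \<phi> x)"

definition mi_order :: "('n::finite \<Rightarrow> nat) \<Rightarrow> nat" where
  "mi_order \<alpha> = (\<Sum>i\<in>UNIV. \<alpha> i)"

definition mi_unit :: "'n \<Rightarrow> 'n \<Rightarrow> nat" where
  "mi_unit i = (\<lambda>j. if j = i then 1 else 0)"

section \<open>The space L2 and Sobolev spaces\<close>

definition L2 :: "(real^'n) set \<Rightarrow> (real^'n \<Rightarrow> 'b::euclidean_space) set" where
  "L2 \<Omega> = {w. w \<in> borel_measurable (lebesgue_on \<Omega>) \<and>
              (\<integral>\<^sup>+x. ennreal ((norm (w x))\<^sup>2) \<partial>lebesgue_on \<Omega>) < \<infinity>}"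

definition l2_inner ::
    "(real^'n) set \<Rightarrow> (real^'n \<Rightarrow> 'b::euclidean_space) \<Rightarrow> (real^'n \<Rightarrow> 'b) \<Rightarrow> real" where
  "l2_inner \<Omega> v w = (\<integral>x. v x \<bullet> w x \<partial>lebesgue_on \<Omega>)"

definition l2_norm_sq :: "(real^'n) set \<Rightarrow> (real^'n \<Rightarrow> 'b::euclidean_space) \<Rightarrow> ennreal" where
  "l2_norm_sq \<Omega> w = (\<integral>\<^sup>+x. ennreal ((norm (w x))\<^sup>2) \<partial>lebesgue_on \<Omega>)"

(* The multi-index alpha is realised by any list of coordinate directions in which i occurs
   alpha i times; the order is irrelevant for smooth test functions. *)
definition is_weak_deriv ::
    "(real^'n) set \<Rightarrow> ('n \<Rightarrow> nat) \<Rightarrow> (real^'n \<Rightarrow> real) \<Rightarrow> (real^'n \<Rightarrow> real) \<Rightarrow> bool" where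
  "is_weak_deriv \<Omega> \<alpha> w g \<longleftrightarrow> w \<in> L2 \<Omega> \<and> g \<in> L2 \<Omega> \<and>
     (\<forall>\<phi>\<in>test_functions \<Omega>. \<forall>js. (\<forall>i. count_list js i = \<alpha> i) \<longrightarrow>
        l2_inner \<Omega> w (dir_derivs (map (\<lambda>i. axis i 1) js) \<phi>)
          = (- 1) ^ mi_order \<alpha> * l2_inner \<Omega> g \<phi>)"

definition wderiv ::
    "(real^'n) set \<Rightarrow> ('n \<Rightarrow> nat) \<Rightarrow> (real^'n \<Rightarrow> real) \<Rightarrow> real^'n \<Rightarrow> real" where
  "wderiv \<Omega> \<alpha> w = (SOME g. is_weak_deriv \<Omega> \<alpha> w g)"

definition wgrad :: "(real^'n) set \<Rightarrow> (real^'n \<Rightarrow> real) \<Rightarrow> real^'n \<Rightarrow> real^'n" where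
  "wgrad \<Omega> w x = (\<chi> i. wderiv \<Omega> (mi_unit i) w x)"

definition gagliardo_sq :: "(real^'n) set \<Rightarrow> real \<Rightarrow> (real^'n \<Rightarrow> real) \<Rightarrow> ennreal" where
  "gagliardo_sq \<Omega> \<sigma> w =
     (\<integral>\<^sup>+x. (\<integral>\<^sup>+y. ennreal ((w x - w y)\<^sup>2 / norm (x - y) powr (real CARD('n) + 2 * \<sigma>))
        \<partial>lebesgue_on \<Omega>) \<partial>lebesgue_on \<Omega>)"

(* Squared norm of H^r for real r >= 0. For integer r this is the usual sum over all weak
   derivatives of order at most r; for fractional r the Sobolev-Slobodeckij seminorm of the
   derivatives of order floor r is added. The value is infinity outside H^r. *)
definition sobolev_norm_sq :: "(real^'n) set \<Rightarrow> real \<Rightarrow> (real^'n \<Rightarrow> real) \<Rightarrow> ennreal" where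
  "sobolev_norm_sq \<Omega> r w =
     (let m = nat \<lfloor>r\<rfloor>; \<sigma> = r - real m in
      if \<forall>\<alpha>. mi_order \<alpha> \<le> m \<longrightarrow> (\<exists>g. is_weak_deriv \<Omega> \<alpha> w g)
      then (\<Sum>\<alpha> | mi_order \<alpha> \<le> m. l2_norm_sq \<Omega> (wderiv \<Omega> \<alpha> w))
         + (if \<sigma> > 0 then (\<Sum>\<alpha> | mi_order \<alpha> = m. gagliardo_sq \<Omega> \<sigma> (wderiv \<Omega> \<alpha> w)) else 0)
      else \<infinity>)"

definition sobolev_space :: "(real^'n) set \<Rightarrow> real \<Rightarrow> (real^'n \<Rightarrow> real) set" where
  "sobolev_space \<Omega> r = {w. sobolev_norm_sq \<Omega> r w < \<infinity>}"

definition sobolev_norm :: "(real^'n) set \<Rightarrow> real \<Rightarrow> (real^'n \<Rightarrow> real) \<Rightarrow> real" where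
  "sobolev_norm \<Omega> r w = sqrt (enn2real (sobolev_norm_sq \<Omega> r w))"

section \<open>Polyhedral domains, boundary measure and traces\<close>

(* Taking the interior of the closure excludes slits. *)
definition polyhedral_domain :: "(real^'n) set \<Rightarrow> bool" where
  "polyhedral_domain \<Omega> \<longleftrightarrow> open \<Omega> \<and> connected \<Omega> \<and> \<Omega> \<noteq> {} \<and> bounded \<Omega> \<and>
     interior (closure \<Omega>) = \<Omega> \<and>
     (\<exists>\<P>. finite \<P> \<and> (\<forall>P\<in>\<P>. polytope P) \<and> closure \<Omega> = \<Union>\<P>)"

(* The outward normal exists exactly at the boundary points near which the domain is a
   half-space, i.e. off the lower-dimensional edges and corners. *)
definition outward_normal :: "(real^'n) set \<Rightarrow> real^'n \<Rightarrow> real^'n \<Rightarrow> bool" where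
  "outward_normal \<Omega> x \<nu> \<longleftrightarrow> x \<in> frontier \<Omega> \<and> norm \<nu> = 1 \<and>
     (\<exists>\<epsilon>>0. \<Omega> \<inter> ball x \<epsilon> = {y \<in> ball x \<epsilon>. (y - x) \<bullet> \<nu> < 0})"

definition inflow_boundary :: "(real^'n) set \<Rightarrow> (real^'n \<Rightarrow> real^'n) \<Rightarrow> (real^'n) set" where
  "inflow_boundary \<Omega> u = {x \<in> frontier \<Omega>. \<exists>\<nu>. outward_normal \<Omega> x \<nu> \<and> u x \<bullet> \<nu> < 0}"

(* The case split makes the empty set weightless also for s = 0, where 0 ^ 0 = 1. *)
definition hausdorff_outer :: "nat \<Rightarrow> 'a::euclidean_space set \<Rightarrow> ennreal" where
  "hausdorff_outer s A =
     (SUP \<delta>\<in>{0<..}.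
        INF U\<in>{U :: nat \<Rightarrow> 'a set. A \<subseteq> (\<Union>i. U i) \<and> (\<forall>i. bounded (U i) \<and> diameter (U i) \<le> \<delta>)}.
          (\<Sum>i. ennreal (if U i = {} then 0
                         else unit_ball_vol (real s) * (diameter (U i) / 2) ^ s)))"

definition surface_measure :: "(real^'n) measure" where
  "surface_measure = measure_of UNIV (sets borel) (hausdorff_outer (CARD('n) - 1))"

(* The trace operator is the continuous extension of the restriction of smooth functions to
   the boundary, as a map from H^1 to L2 with respect to surface measure. *)
definition has_trace ::
    "(real^'n) set \<Rightarrow> (real^'n) set \<Rightarrow> (real^'n \<Rightarrow> real) \<Rightarrow> (real^'n \<Rightarrow> real) \<Rightarrow> bool" where
  "has_trace \<Omega> A w g \<longleftrightarrow> w \<in> sobolev_space \<Omega> 1 \<and>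
     g \<in> borel_measurable (restrict_space surface_measure A) \<and>
     (\<exists>\<phi> :: nat \<Rightarrow> real^'n \<Rightarrow> real. (\<forall>n. smooth (\<phi> n)) \<and>
        (\<lambda>n. sobolev_norm_sq \<Omega> 1 (\<lambda>x. w x - \<phi> n x)) \<longlonglongrightarrow> 0 \<and>
        (\<lambda>n. \<integral>\<^sup>+x. ennreal ((\<phi> n x - g x)\<^sup>2) \<partial>restrict_space surface_measure A) \<longlonglongrightarrow> 0)"

definition zero_trace_subspace ::
    "(real^'n) set \<Rightarrow> (real^'n) set \<Rightarrow> (real^'n \<Rightarrow> real) set \<Rightarrow> (real^'n \<Rightarrow> real) set" where
  "zero_trace_subspace \<Omega> A V = {v \<in> V. has_trace \<Omega> A v (\<lambda>_. 0)}"

section \<open>Functions of time with values in Sobolev spaces\<close>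

(* L2(0,T;L2) is represented by jointly measurable functions, so that Bochner integrals in
   time are computed pointwise in x. *)
definition L2_time ::
    "real \<Rightarrow> (real^'n) set \<Rightarrow> (real \<Rightarrow> real^'n \<Rightarrow> 'b::euclidean_space) set" where
  "L2_time T \<Omega> =
     {F. (\<lambda>z. F (fst z) (snd z)) \<in> borel_measurable (lebesgue_on {0..T} \<Otimes>\<^sub>M lebesgue_on \<Omega>) \<and>
         (\<integral>\<^sup>+z. ennreal ((norm (F (fst z) (snd z)))\<^sup>2)
            \<partial>(lebesgue_on {0..T} \<Otimes>\<^sub>M lebesgue_on \<Omega>)) < \<infinity>}"

definition L2_time_sobolev ::
    "real \<Rightarrow> (real^'n) set \<Rightarrow> nat \<Rightarrow> (real \<Rightarrow> real^'n \<Rightarrow> real) set" where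
  "L2_time_sobolev T \<Omega> m =
     {C \<in> L2_time T \<Omega>. \<forall>\<alpha>. mi_order \<alpha> \<le> m \<longrightarrow>
        (\<exists>G\<in>L2_time T \<Omega>. AE t in lebesgue_on {0..T}. is_weak_deriv \<Omega> \<alpha> (C t) (G t))}"

definition H1_time_sobolev ::
    "real \<Rightarrow> (real^'n) set \<Rightarrow> nat \<Rightarrow> (real \<Rightarrow> real^'n \<Rightarrow> real) set" where
  "H1_time_sobolev T \<Omega> m =
     {C \<in> L2_time_sobolev T \<Omega> m. \<exists>C'\<in>L2_time_sobolev T \<Omega> m.
        \<forall>\<theta>\<in>test_functions {0<..<T}. AE x in lebesgue_on \<Omega>.
          (\<integral>t. deriv \<theta> t * C t x \<partial>lebesgue_on {0..T})
            = - (\<integral>t. \<theta> t * C' t x \<partial>lebesgue_on {0..T})}"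

definition Linf_time_L2 :: "real \<Rightarrow> (real^'n) set \<Rightarrow> (real \<Rightarrow> real^'n \<Rightarrow> real) set" where
  "Linf_time_L2 T \<Omega> =
     {C. (\<lambda>z. C (fst z) (snd z)) \<in> borel_measurable (lebesgue_on {0..T} \<Otimes>\<^sub>M lebesgue_on \<Omega>) \<and>
         (\<exists>B::real. AE t in lebesgue_on {0..T}. l2_norm_sq \<Omega> (C t) \<le> ennreal B)}"

(* A jointly measurable representative of the weak spatial gradient. *)
definition space_grad ::
    "real \<Rightarrow> (real^'n) set \<Rightarrow> (real \<Rightarrow> real^'n \<Rightarrow> real) \<Rightarrow> real \<Rightarrow> real^'n \<Rightarrow> real^'n" where
  "space_grad T \<Omega> C =
     (SOME G. G \<in> L2_time T \<Omega> \<and>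
        (AE t in lebesgue_on {0..T}. \<forall>i. is_weak_deriv \<Omega> (mi_unit i) (C t) (\<lambda>x. G t x $ i)))"

definition time_integral ::
    "real \<Rightarrow> (real \<Rightarrow> real^'n \<Rightarrow> 'b::euclidean_space) \<Rightarrow> real^'n \<Rightarrow> 'b" where
  "time_integral t F x = (\<integral>s. F s x \<partial>lebesgue_on {0..t})"

section \<open>The time-integrated variational problem\<close>

definition variational_problem ::
    "(real^'n) set \<Rightarrow> real \<Rightarrow> real \<Rightarrow> real \<Rightarrow> (real \<Rightarrow> real) \<Rightarrow> (real^'n \<Rightarrow> real^'n) \<Rightarrow>
     (real^'n \<Rightarrow> real^'n^'n) \<Rightarrow> (real \<Rightarrow> real^'n \<Rightarrow> real) \<Rightarrow> (real^'n \<Rightarrow> real) \<Rightarrow>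
     (real^'n \<Rightarrow> real) set \<Rightarrow> (real \<Rightarrow> real^'n \<Rightarrow> real) \<Rightarrow> bool" where
  "variational_problem \<Omega> T \<omega> \<rho>\<^sub>s q u D f C\<^sub>0 V C \<longleftrightarrow>
     (\<forall>t\<in>{0..T}. \<forall>v\<in>V.
        l2_inner \<Omega> (\<lambda>x. \<omega> * C t x) v
      + l2_inner \<Omega> (\<lambda>x. (1 - \<omega>) * \<rho>\<^sub>s * q (C t x)) v
      + l2_inner \<Omega> (time_integral t (\<lambda>s x. u x \<bullet> space_grad T \<Omega> C s x)) v
      + l2_inner \<Omega> (time_integral t (\<lambda>s x. D x *v space_grad T \<Omega> C s x)) (wgrad \<Omega> v)
      = l2_inner \<Omega> (time_integral t f) v
      + l2_inner \<Omega> (\<lambda>x. \<omega> * C\<^sub>0 x) v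
      + l2_inner \<Omega> (\<lambda>x. (1 - \<omega>) * \<rho>\<^sub>s * q (C\<^sub>0 x)) v)"

definition exact_solution ::
    "(real^'n) set \<Rightarrow> real \<Rightarrow> real \<Rightarrow> real \<Rightarrow> (real \<Rightarrow> real) \<Rightarrow> (real^'n \<Rightarrow> real^'n) \<Rightarrow>
     (real^'n \<Rightarrow> real^'n^'n) \<Rightarrow> (real \<Rightarrow> real^'n \<Rightarrow> real) \<Rightarrow> (real^'n \<Rightarrow> real) \<Rightarrow>
     (real^'n \<Rightarrow> real) \<Rightarrow> (real \<Rightarrow> real^'n \<Rightarrow> real) \<Rightarrow> bool" where
  "exact_solution \<Omega> T \<omega> \<rho>\<^sub>s q u D f C\<^sub>0 g C \<longleftrightarrow>
     C \<in> L2_time_sobolev T \<Omega> 1 \<and>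
     (\<forall>t\<in>{0..T}. has_trace \<Omega> (inflow_boundary \<Omega> u) (C t) g) \<and>
     variational_problem \<Omega> T \<omega> \<rho>\<^sub>s q u D f C\<^sub>0
       (zero_trace_subspace \<Omega> (inflow_boundary \<Omega> u) (sobolev_space \<Omega> 1)) C"

definition semidiscrete_solution ::
    "(real^'n) set \<Rightarrow> real \<Rightarrow> real \<Rightarrow> real \<Rightarrow> (real \<Rightarrow> real) \<Rightarrow> (real^'n \<Rightarrow> real^'n) \<Rightarrow>
     (real^'n \<Rightarrow> real^'n^'n) \<Rightarrow> (real \<Rightarrow> real^'n \<Rightarrow> real) \<Rightarrow> (real^'n \<Rightarrow> real) \<Rightarrow>
     (real^'n \<Rightarrow> real) set \<Rightarrow> (real^'n \<Rightarrow> real) \<Rightarrow> (real \<Rightarrow> real^'n \<Rightarrow> real) \<Rightarrow> bool" where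
  "semidiscrete_solution \<Omega> T \<omega> \<rho>\<^sub>s q u D f C\<^sub>0 X g\<^sub>h C\<^sub>h \<longleftrightarrow>
     C\<^sub>h \<in> L2_time_sobolev T \<Omega> 1 \<and>
     (\<forall>t\<in>{0..T}. C\<^sub>h t \<in> X \<and> has_trace \<Omega> (inflow_boundary \<Omega> u) (C\<^sub>h t) g\<^sub>h) \<and>
     variational_problem \<Omega> T \<omega> \<rho>\<^sub>s q u D f C\<^sub>0
       (zero_trace_subspace \<Omega> (inflow_boundary \<Omega> u) X) C\<^sub>h"

section \<open>Finite element spaces\<close>

definition regular_mesh :: "(real^'n) set \<Rightarrow> (real^'n) set set \<Rightarrow> real \<Rightarrow> real \<Rightarrow> bool" where
  "regular_mesh \<Omega> \<T> \<theta> h \<longleftrightarrow> triangulation \<T> \<and> \<T> \<noteq> {} \<and> \<Union>\<T> = closure \<Omega> \<and>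
     (\<forall>S\<in>\<T>. int CARD('n) simplex S) \<and>
     h = Max (diameter ` \<T>) \<and>
     (\<forall>S\<in>\<T>. \<exists>x. \<exists>\<rho>>0. cball x \<rho> \<subseteq> S \<and> diameter S \<le> \<theta> * \<rho>)"

(* Finite-dimensional subspaces of H^1 that are smooth (e.g. polynomial) on every closed cell;
   the members are the continuous representatives. *)
definition finite_element_space ::
    "(real^'n) set \<Rightarrow> (real^'n) set set \<Rightarrow> (real^'n \<Rightarrow> real) set \<Rightarrow> bool" where
  "finite_element_space \<Omega> \<T> X \<longleftrightarrow>
     (\<exists>B. finite B \<and> X = {w. \<exists>c. w = (\<lambda>x. \<Sum>b\<in>B. c b * b x)}) \<and>
     X \<subseteq> sobolev_space \<Omega> 1 \<and>
     (\<forall>v\<in>X. \<forall>S\<in>\<T>. \<exists>p. smooth p \<and> (\<forall>x\<in>S. v x = p x))"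

(* An interpolation operator into the space of restrictions of X to A: its values are such
   restrictions, and it reproduces them. *)
definition boundary_interpolation ::
    "(real^'n) set \<Rightarrow> (real^'n \<Rightarrow> real) set \<Rightarrow>
     ((real^'n \<Rightarrow> real) \<Rightarrow> real^'n \<Rightarrow> real) \<Rightarrow> bool" where
  "boundary_interpolation A X I \<longleftrightarrow>
     (\<forall>\<gamma>. \<exists>w\<in>X. \<forall>x\<in>A. I \<gamma> x = w x) \<and>
     (\<forall>w\<in>X. \<forall>\<gamma>. (\<forall>x\<in>A. \<gamma> x = w x) \<longrightarrow> (\<forall>x\<in>A. I \<gamma> x = w x))"

definition approximation_property ::
    "(real^'n) set \<Rightarrow> (real^'n \<Rightarrow> real) set \<Rightarrow> real \<Rightarrow> real \<Rightarrow> real \<Rightarrow> bool" where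
  "approximation_property \<Omega> X h K r \<longleftrightarrow>
     (\<forall>s\<in>{0, 1}. \<forall>w\<in>sobolev_space \<Omega> r.
        (INF w\<^sub>h\<in>X. sobolev_norm \<Omega> s (\<lambda>x. w x - w\<^sub>h x))
          \<le> K * h powr (r - s) * sobolev_norm \<Omega> r w)"

definition constrained_approximation_property ::
    "(real^'n) set \<Rightarrow> (real^'n) set \<Rightarrow> (real^'n \<Rightarrow> real) set \<Rightarrow> (real^'n \<Rightarrow> real) \<Rightarrow>
     (real^'n \<Rightarrow> real) \<Rightarrow> real \<Rightarrow> real \<Rightarrow> real \<Rightarrow> bool" where
  "constrained_approximation_property \<Omega> A X g g\<^sub>h h K r \<longleftrightarrow>
     (\<forall>w\<in>sobolev_space \<Omega> r. has_trace \<Omega> A w g \<longrightarrow>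
        (INF w\<^sub>h\<in>{w\<^sub>h \<in> X. has_trace \<Omega> A w\<^sub>h g\<^sub>h}. sobolev_norm \<Omega> 1 (\<lambda>x. w x - w\<^sub>h x))
          \<le> K * h powr (r - 1) * sobolev_norm \<Omega> r w)"

section \<open>Coefficients\<close>

definition sup_norm :: "'a set \<Rightarrow> ('a \<Rightarrow> 'b::real_normed_vector) \<Rightarrow> real" where
  "sup_norm \<Omega> w = (SUP x\<in>\<Omega>. norm (w x))"

(* Matrices are measured in the operator norm induced by the Euclidean norm; the norm of the
   vector space of matrices in the library is the Frobenius norm. *)
definition mat_sup_norm :: "'a set \<Rightarrow> ('a \<Rightarrow> real^'n^'n) \<Rightarrow> real" where
  "mat_sup_norm \<Omega> M = (SUP x\<in>\<Omega>. onorm ((*v) (M x)))"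

definition sym_pos_def :: "real^'n^'n \<Rightarrow> bool" where
  "sym_pos_def A \<longleftrightarrow> transpose A = A \<and> (\<forall>\<xi>. \<xi> \<noteq> 0 \<longrightarrow> \<xi> \<bullet> (A *v \<xi>) > 0)"

definition pos_sqrt :: "real^'n^'n \<Rightarrow> real^'n^'n" where
  "pos_sqrt A = (THE S. sym_pos_def S \<and> S ** S = A)"

definition divergence_free :: "(real^'n) set \<Rightarrow> (real^'n \<Rightarrow> real^'n) \<Rightarrow> bool" where
  "divergence_free \<Omega> u \<longleftrightarrow> (\<forall>\<phi>\<in>test_functions \<Omega>. l2_inner \<Omega> u (grad \<phi>) = 0)"

definition admissible_velocity :: "(real^'n) set \<Rightarrow> (real^'n \<Rightarrow> real^'n) \<Rightarrow> bool" where
  "admissible_velocity \<Omega> u \<longleftrightarrow>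
     u \<in> borel_measurable (lebesgue_on \<Omega>) \<and>
     u \<in> borel_measurable (restrict_space borel (frontier \<Omega>)) \<and>
     bounded (u ` \<Omega>) \<and>
     \<not> (AE x in lebesgue_on \<Omega>. u x = 0) \<and>
     divergence_free \<Omega> u"

definition admissible_diffusion ::
    "(real^'n) set \<Rightarrow> (real^'n \<Rightarrow> real^'n^'n) \<Rightarrow> real \<Rightarrow> real \<Rightarrow> bool" where
  "admissible_diffusion \<Omega> D \<beta>\<^sub>1 \<beta>\<^sub>2 \<longleftrightarrow>
     D \<in> borel_measurable (lebesgue_on \<Omega>) \<and>
     (\<forall>x\<in>\<Omega>. sym_pos_def (D x) \<and> onorm ((*v) (D x)) \<le> \<beta>\<^sub>1) \<and>
     (\<forall>i j. \<exists>d. is_weak_deriv \<Omega> (mi_unit i) (\<lambda>x. D x $ i $ j) d \<and>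
                (AE x in lebesgue_on \<Omega>. \<bar>d x\<bar> \<le> \<beta>\<^sub>2))"

definition admissible_isotherm :: "(real \<Rightarrow> real) \<Rightarrow> real \<Rightarrow> real \<Rightarrow> bool" where
  "admissible_isotherm q \<kappa>\<^sub>1 \<kappa>\<^sub>2 \<longleftrightarrow>
     (\<forall>c. q differentiable (at c)) \<and> continuous_on UNIV (deriv q) \<and>
     (\<exists>L. L-lipschitz_on UNIV q) \<and>
     q 0 = 0 \<and> (\<forall>c>0. q c > 0) \<and> strict_mono q \<and>
     \<kappa>\<^sub>1 > 0 \<and> (\<forall>c\<ge>0. deriv q c \<ge> \<kappa>\<^sub>1) \<and>
     (\<exists>L. L-lipschitz_on UNIV (deriv q)) \<and> (\<forall>c. deriv q c \<le> \<kappa>\<^sub>2) \<and>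
     (\<forall>c. deriv q differentiable (at c)) \<and>
     (\<exists>L. L-lipschitz_on UNIV (deriv (deriv q))) \<and> bounded (range (deriv (deriv q)))"

end

theory Submission
  imports Defs
begin

text \<open>With \<open>e = C - C\<^sub>h\<close>, subtracting the two variational problems and testing with
  \<open>w - C\<^sub>h = e - (C - w)\<close>, where \<open>w\<close> lies in the finite element space and has trace \<open>g\<^sub>h\<close>, removes
  all data. Monotonicity of the isotherm discards the adsorption term, and
  \<open>2 (\<integral>\<^sub>0\<^sup>t D \<nabla>e, \<nabla>e) = d/dt \<parallel>\<integral>\<^sub>0\<^sup>t D\<^bsup>1/2\<^esup> \<nabla>e\<parallel>\<^sup>2\<close>, so that Young's inequality and Gronwall's lemma bound the error by
  \<open>\<integral> \<parallel>C - w\<parallel>\<^sub>1\<^sup>2\<close>; then one takes the infimum over \<open>w\<close> at each time. The gradients of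
  \<open>C\<close>, \<open>C\<^sub>h\<close> and \<open>e\<close> are chosen independently of one another, which makes uniqueness of weak derivatives, and
  hence a supply of smooth bump functions, indispensable.\<close>

section \<open>Bump functions and the fundamental lemma\<close>

text \<open>Testing the time-integrated equation at a fixed time pairs the accumulated flux
  \<open>D V\<close>, where \<open>V\<close> is the time integral of the gradient of
  \<open>e\<close>, with the current gradient of the test function. This is why a total derivative
  appears in place of a coercive term, why the isotherm is never differentiated in time, and why
  \<open>w\<close> may be chosen anew at each time without any regularity in \<open>t\<close>.
  Prescribing the trace \<open>g\<^sub>h\<close> for \<open>w\<close> keeps
  \<open>w - C\<^sub>h\<close> in the discrete test space although \<open>C\<close> has trace
  \<open>g\<close>. The constants come from Young's inequality: three products with
  \<open>e\<close>, each of weight \<open>\<omega> / 6\<close>, consume half of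
  \<open>\<omega> * e\<^sup>2\<close>; two products with the length of \<open>V\<close> in the
  metric \<open>D\<close>, each of weight 1/8, contribute 1/2 to the Gronwall rate after doubling,
  where the claim has 1. Convection enters through the inverse root of \<open>D\<close>. Null sets
  are the recurring obstacle: in the energy estimate the exceptional times must not depend on
  \<open>w\<close>, and in the statements on time integrals the exceptional points must not depend
  on \<open>t\<close>.\<close>

text \<open>The factors \<open>t ^ k\<close> make the family closed, up to linear combinations, under differentiation.\<close>

definition flat :: "nat \<Rightarrow> real \<Rightarrow> real" where
  "flat k t = (if t > 0 then exp (- 1 / t) / t ^ k else 0)"

text \<open>After the substitution \<open>s = 1 / t\<close> this says that the exponential beats
  every power at infinity.\<close>

lemma flat_tendsto_0: "((flat k) \<longlongrightarrow> 0) (at_right 0)"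
proof -
  have "((\<lambda>t::real. inverse t ^ k / exp (inverse t)) \<longlongrightarrow> 0) (at_right 0)"
    by (rule filterlim_compose[OF tendsto_power_div_exp_0 filterlim_inverse_at_top_right])
  moreover have "\<forall>\<^sub>F t in at_right 0. inverse t ^ k / exp (inverse t) = flat k t"
    unfolding eventually_at_right_field
    by (intro exI[of _ 1]) (auto simp: flat_def exp_minus field_simps)
  ultimately show ?thesis by (rule Lim_transform_eventually)
qed

text \<open>The only delicate point is 0. There the right difference quotient of
  \<open>flat k\<close> is exactly \<open>flat (k + 1)\<close>, which tends to 0 by
  \<open>flat_tendsto_0\<close>.\<close>

lemma flat_deriv: "(flat k has_real_derivative (flat (k + 2) t - real k * flat (k + 1) t)) (at t)"
proof (cases "t = 0")
  case False
  show ?thesis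
  proof (cases "t > 0")
    case True
    have "((\<lambda>t. exp (- 1 / t) / t ^ k) has_real_derivative (flat (k + 2) t - real k * flat (k + 1) t)) (at t)"
      using True
      apply (cases k)
       apply (auto intro!: derivative_eq_intros simp: flat_def power2_eq_square)
      subgoal for m by (cases m) (auto simp: field_simps power2_eq_square)
      done
    then show ?thesis
      by (rule DERIV_cong_ev[OF refl _ refl, THEN iffD1, rotated])
        (use True in \<open>auto simp: flat_def eventually_at_topological
          intro!: eventually_nhds_in_open[of "{0<..}", THEN eventually_mono]\<close>)
  next
    case F: False
    with False have "t < 0" by simp
    have "((\<lambda>t. 0) has_real_derivative (flat (k + 2) t - real k * flat (k + 1) t)) (at t)"
      using \<open>t < 0\<close> by (simp add: flat_def)
    then show ?thesis
      by (rule DERIV_cong_ev[OF refl _ refl, THEN iffD1, rotated])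
        (use \<open>t < 0\<close> in \<open>auto simp: flat_def
          intro!: eventually_nhds_in_open[of "{..<0}", THEN eventually_mono]\<close>)
  qed
next
  case True
  have "((\<lambda>h. (flat k (0 + h) - flat k 0) / h) \<longlongrightarrow> 0) (at 0)"
  proof (rule filterlim_split_at)
    show "((\<lambda>h. (flat k (0 + h) - flat k 0) / h) \<longlongrightarrow> 0) (at_left 0)"
      by (rule Lim_transform_eventually[of "\<lambda>_. 0"])
        (auto simp: flat_def eventually_at_left_field intro!: exI[of _ "-1"])
    show "((\<lambda>h. (flat k (0 + h) - flat k 0) / h) \<longlongrightarrow> 0) (at_right 0)"
      by (rule Lim_transform_eventually[OF flat_tendsto_0[of "k + 1"]])
        (auto simp: flat_def eventually_at_right_field intro!: exI[of _ 1])
  qed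
  then show ?thesis using True by (simp add: has_field_derivative_iff flat_def)
qed

text \<open>Smoothness concerns all iterated directional derivatives, so a class stable under
  differentiation is required. This is the algebra generated by the constants and the functions
  \<open>flat k\<close> of an affine form; \<open>flat_deriv\<close> keeps derivatives inside
  it.\<close>

inductive flat_combination :: "('a::euclidean_space \<Rightarrow> real) \<Rightarrow> bool" where
  const: "flat_combination (\<lambda>_. c)"
| flat: "flat_combination (\<lambda>x. flat k (b \<bullet> x + c))"
| add: "flat_combination f \<Longrightarrow> flat_combination g \<Longrightarrow> flat_combination (\<lambda>x. f x + g x)"
| mult: "flat_combination f \<Longrightarrow> flat_combination g \<Longrightarrow> flat_combination (\<lambda>x. f x * g x)"

lemma flat_combination_derivative:
  "flat_combination f \<Longrightarrow>
    \<exists>f'. (\<forall>x. (f has_derivative f' x) (at x)) \<and> (\<forall>b. flat_combination (\<lambda>x. f' x b))"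
proof (induction rule: flat_combination.induct)
  case (const c)
  show ?case by (rule exI[of _ "\<lambda>x b. 0"]) (auto intro: flat_combination.const)
next
  case (flat k b c)
  let ?d = "\<lambda>x v. (flat (k + 2) (b \<bullet> x + c) + (- real k) * flat (k + 1) (b \<bullet> x + c)) * (b \<bullet> v)"
  have "((\<lambda>x. flat k (b \<bullet> x + c)) has_derivative ?d x) (at x)" for x
  proof -
    have "((\<lambda>x. b \<bullet> x + c) has_derivative (\<lambda>v. b \<bullet> v)) (at x)"
      by (auto intro!: derivative_eq_intros)
    from has_derivative_compose[OF this flat_deriv[unfolded has_field_derivative_def]]
    show ?thesis by simp
  qed
  moreover have "flat_combination (\<lambda>x. ?d x v)" for v
    by (intro flat_combination.intros)
  ultimately show ?case by (intro exI[of _ ?d]) auto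
next
  case (add f g)
  then obtain f' g' where
    "\<And>x. (f has_derivative f' x) (at x)" "\<And>b. flat_combination (\<lambda>x. f' x b)"
    "\<And>x. (g has_derivative g' x) (at x)" "\<And>b. flat_combination (\<lambda>x. g' x b)" by metis
  then show ?case
    by (intro exI[of _ "\<lambda>x b. f' x b + g' x b"])
      (auto intro: flat_combination.add has_derivative_add)
next
  case (mult f g)
  then obtain f' g' where
    "\<And>x. (f has_derivative f' x) (at x)" "\<And>b. flat_combination (\<lambda>x. f' x b)"
    "\<And>x. (g has_derivative g' x) (at x)" "\<And>b. flat_combination (\<lambda>x. g' x b)" by metis
  with mult.hyps show ?case
    by (intro exI[of _ "\<lambda>x b. f x * g' x b + f' x b * g x"])
      (auto intro!: flat_combination.add has_derivative_mult intro: flat_combination.mult)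
qed

lemma flat_combination_dir_derivs:
  assumes "flat_combination f" shows "flat_combination (dir_derivs bs f)"
proof (induction bs)
  case (Cons b bs)
  from flat_combination_derivative[OF Cons] obtain f' where
    f': "\<And>x. (dir_derivs bs f has_derivative f' x) (at x)" "flat_combination (\<lambda>x. f' x b)"
    by blast
  have "dir_derivs (b # bs) f = (\<lambda>x. f' x b)"
    using frechet_derivative_at[OF f'(1)] by simp
  with f'(2) show ?case by simp
qed (use assms in simp)

lemma flat_combination_smooth: "flat_combination f \<Longrightarrow> smooth f"
  unfolding smooth_def
  using flat_combination_dir_derivs flat_combination_derivative differentiableI by blast

lemma flat_combination_prod:
  "finite A \<Longrightarrow> (\<And>i. i \<in> A \<Longrightarrow> flat_combination (f i)) \<Longrightarrow> flat_combination (\<lambda>x. \<Prod>i\<in>A. f i x)"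
  by (induction A rule: finite_induct) (auto intro: flat_combination.intros)

text \<open>One factor per face of the box, vanishing as soon as the coordinate reaches that face.
  The factor \<open>Suc n\<close> steepens the profile, so that the bumps tend pointwise to the
  indicator of the open box while staying below 1.\<close>

definition box_bump :: "'a::euclidean_space \<Rightarrow> 'a \<Rightarrow> nat \<Rightarrow> 'a \<Rightarrow> real" where
  "box_bump a b n x =
     (\<Prod>i\<in>Basis. flat 0 (real (Suc n) * (x \<bullet> i - a \<bullet> i)) * flat 0 (real (Suc n) * (b \<bullet> i - x \<bullet> i)))"

lemma box_bump_smooth: "smooth (box_bump a b n)"
proof -
  have "flat_combination (\<lambda>x. flat 0 (real (Suc n) * (x \<bullet> i - a \<bullet> i)) * flat 0 (real (Suc n) * (b \<bullet> i - x \<bullet> i)))" for i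
  proof -
    have eq: "real (Suc n) * (x \<bullet> i - a \<bullet> i) = (real (Suc n) *\<^sub>R i) \<bullet> x + (- real (Suc n) * (a \<bullet> i))"
      "real (Suc n) * (b \<bullet> i - x \<bullet> i) = (- real (Suc n) *\<^sub>R i) \<bullet> x + real (Suc n) * (b \<bullet> i)" for x
      by (simp_all add: algebra_simps inner_commute)
    show ?thesis unfolding eq by (intro flat_combination.intros)
  qed
  then have "flat_combination (box_bump a b n)"
    unfolding box_bump_def by (intro flat_combination_prod) auto
  then show ?thesis by (rule flat_combination_smooth)
qed

lemma flat_0_bounds: "0 \<le> flat 0 t" "flat 0 t \<le> 1"
  by (auto simp: flat_def)

lemma box_bump_eq_0: "x \<notin> box a b \<Longrightarrow> box_bump a b n x = 0"
  by (force simp: box_bump_def mem_box flat_def not_less zero_less_mult_iff)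

lemma box_bump_bounds: "0 \<le> box_bump a b n x" "box_bump a b n x \<le> 1"
  unfolding box_bump_def
  by (auto intro!: prod_nonneg prod_le_1 mult_le_one simp: flat_0_bounds)

lemma box_bump_tendsto: "(\<lambda>n. box_bump a b n x) \<longlonglongrightarrow> indicator (box a b) x"
proof (cases "x \<in> box a b")
  case True
  have *: "(\<lambda>n. flat 0 (real (Suc n) * s)) \<longlonglongrightarrow> 1" if "s > 0" for s
  proof -
    have "(\<lambda>n. exp (- (1 / s) * inverse (real (Suc n)))) \<longlonglongrightarrow> exp (- (1 / s) * 0)"
      by (intro tendsto_intros LIMSEQ_inverse_real_of_nat)
    moreover have "flat 0 (real (Suc n) * s) = exp (- (1 / s) * inverse (real (Suc n)))" for n
      using that by (auto simp: flat_def field_simps zero_less_mult_iff simp del: of_nat_Suc)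
    ultimately show ?thesis by simp
  qed
  have "(\<lambda>n. box_bump a b n x) \<longlonglongrightarrow> (\<Prod>i\<in>(Basis::'a set). 1 * 1)"
    unfolding box_bump_def using True by (intro tendsto_prod tendsto_mult *) (auto simp: mem_box)
  with True show ?thesis by simp
qed (simp add: box_bump_eq_0)

text \<open>The support may fill the whole closed box, hence an assumption on
  \<open>cbox a b\<close> and not on \<open>box a b\<close>.\<close>

lemma box_bump_test_function:
  assumes "cbox a b \<subseteq> \<Omega>" shows "box_bump a b n \<in> test_functions \<Omega>"
proof -
  have "closure {x. box_bump a b n x \<noteq> 0} \<subseteq> cbox a b"
    using box_bump_eq_0[of _ a b n] box_subset_cbox[of a b]
    by (intro closure_minimal) (auto intro: closed_cbox)
  moreover from this have "compact (closure {x. box_bump a b n x \<noteq> 0})"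
    by (meson bounded_cbox bounded_subset closed_closure compact_eq_bounded_closed)
  ultimately show ?thesis using assms by (auto simp: test_functions_def box_bump_smooth)
qed

section \<open>Derivatives of smooth functions and of test functions\<close>

lemma smooth_dir_derivs_continuous: "smooth \<phi> \<Longrightarrow> continuous_on UNIV (dir_derivs bs \<phi>)"
  unfolding smooth_def
  by (meson differentiable_at_imp_differentiable_on differentiable_imp_continuous_on)

text \<open>The induction has to run over the whole open complement of the support: the next
  derivative at \<open>x\<close> sees the values near \<open>x\<close>.\<close>

lemma dir_derivs_zero_outside:
  "x \<notin> closure {x. \<phi> x \<noteq> 0} \<Longrightarrow> dir_derivs bs \<phi> x = 0"
proof (induction bs arbitrary: x)
  case Nil
  then show ?case using closure_subset[of "{x. \<phi> x \<noteq> 0}"] by auto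
next
  case (Cons b bs)
  let ?U = "- closure {x. \<phi> x \<noteq> 0}"
  have "((\<lambda>_. 0) has_derivative (\<lambda>_. 0)) (at x)" by simp
  then have "(dir_derivs bs \<phi> has_derivative (\<lambda>_. 0)) (at x)"
    by (rule has_derivative_transform_within_open[of _ _ _ _ ?U]) (use Cons in auto)
  from fun_cong[OF frechet_derivative_at[OF this], of b] show ?case by simp
qed

lemma test_function_dir_derivs_bounded:
  assumes "\<phi> \<in> test_functions \<Omega>"
  obtains B where "\<And>x. \<bar>dir_derivs bs \<phi> x\<bar> \<le> B"
proof -
  let ?S = "closure {x. \<phi> x \<noteq> 0}"
  have "compact (dir_derivs bs \<phi> ` ?S)"
    using assms by (intro compact_continuous_image continuous_on_subset[OF smooth_dir_derivs_continuous])
      (auto simp: test_functions_def)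
  then obtain B where B: "\<And>x. x \<in> ?S \<Longrightarrow> \<bar>dir_derivs bs \<phi> x\<bar> \<le> B"
    by (force dest!: compact_imp_bounded simp: bounded_iff)
  \<comment> \<open>If the support is empty, \<open>B\<close> is arbitrary and may be negative,
    while the derivatives are 0.\<close>
  have "\<bar>dir_derivs bs \<phi> x\<bar> \<le> max B 0" for x
    using B[of x] dir_derivs_zero_outside[of x \<phi> bs] by (cases "x \<in> ?S") auto
  then show ?thesis by (rule that)
qed

lemma dir_derivs_diff:
  assumes "smooth \<phi>" "smooth \<psi>"
  shows "dir_derivs bs (\<lambda>x. \<phi> x - \<psi> x) = (\<lambda>x. dir_derivs bs \<phi> x - dir_derivs bs \<psi> x)"
proof (induction bs)
  case (Cons b bs)
  have "frechet_derivative (dir_derivs bs (\<lambda>x. \<phi> x - \<psi> x)) (at x) =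
     (\<lambda>v. frechet_derivative (dir_derivs bs \<phi>) (at x) v - frechet_derivative (dir_derivs bs \<psi>) (at x) v)" for x
    unfolding Cons
    using assms by (intro frechet_derivative_at[symmetric] has_derivative_diff)
       (auto simp: smooth_def frechet_derivative_works[symmetric])
  then show ?case by simp
qed simp

lemma smooth_diff: "smooth \<phi> \<Longrightarrow> smooth \<psi> \<Longrightarrow> smooth (\<lambda>x. \<phi> x - \<psi> x)"
  by (subst smooth_def) (auto simp: dir_derivs_diff smooth_def[of \<phi>] smooth_def[of \<psi>])

text \<open>By Lebesgue's differentiation theorem.\<close>

lemma AE_eq_0_if_box_integrals_0:
  fixes w :: "'a::euclidean_space \<Rightarrow> real"
  assumes "open \<Omega>" and w: "integrable (lebesgue_on \<Omega>) w"
    and 0: "\<And>a b. cbox a b \<subseteq> \<Omega> \<Longrightarrow> (\<integral>x. w x * indicator (box a b) x \<partial>lebesgue_on \<Omega>) = 0"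
  shows "AE x in lebesgue_on \<Omega>. w x = 0"
proof -
  have \<Omega>: "\<Omega> \<in> sets lebesgue" using \<open>open \<Omega>\<close> by auto
  \<comment> \<open>Extension by zero, because the differentiation theorem is applied on the whole
    space.\<close>
  define w0 where "w0 x = indicator \<Omega> x *\<^sub>R w x" for x
  have w0: "integrable lebesgue w0"
    using w \<Omega> by (simp add: w0_def[abs_def] integrable_restrict_space)
  then have "w0 integrable_on UNIV"
    by (simp add: integrable_on_lebesgue)
  then have "w0 integrable_on cbox a b" for a b
    using integrable_on_subcbox by blast
  then obtain N where N: "negligible N"
    "\<And>x e. x \<notin> N \<Longrightarrow> 0 < e \<Longrightarrow> \<exists>d>0. \<forall>h. 0 < h \<and> h < d \<longrightarrow>
       norm (integral (cbox x (x + h *\<^sub>R One)) w0 /\<^sub>R h ^ DIM('a) - w0 x) < e"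
    by (rule integrable_ccontinuous_explicit[of w0]) blast
  have zero: "integral (cbox a b) w0 = 0" if "cbox a b \<subseteq> \<Omega>" for a b
  proof -
    have "integral (cbox a b) w0 = integral (box a b) w0"
      by (simp add: integral_open_interval)
    also have "\<dots> = (\<integral>x. w0 x \<partial>lebesgue_on (box a b))"
      by (rule lebesgue_integral_eq_integral[symmetric])
        (use w0 in \<open>auto intro!: integrable_restrict_space[THEN iffD2] integrable_mult_indicator\<close>)
    also have "\<dots> = (\<integral>x. indicator (box a b) x *\<^sub>R w0 x \<partial>lebesgue)"
      by (simp add: integral_restrict_space)
    also have "\<dots> = (\<integral>x. indicator \<Omega> x *\<^sub>R (w x * indicator (box a b) x) \<partial>lebesgue)"
      by (intro Bochner_Integration.integral_cong) (auto simp: w0_def)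
    also have "\<dots> = (\<integral>x. w x * indicator (box a b) x \<partial>lebesgue_on \<Omega>)"
      using \<Omega> by (simp add: integral_restrict_space)
    finally show ?thesis using 0[OF that] by simp
  qed
  have "w x = 0" if x: "x \<in> \<Omega>" "x \<notin> N" for x
  proof (rule ccontr)
    assume "w x \<noteq> 0"
    with N(2)[OF x(2), of "\<bar>w x\<bar>"] x(1) obtain d where d: "d > 0"
      "\<And>h. 0 < h \<Longrightarrow> h < d \<Longrightarrow>
         norm (integral (cbox x (x + h *\<^sub>R One)) w0 /\<^sub>R h ^ DIM('a) - w0 x) < \<bar>w x\<bar>" by auto
    obtain \<epsilon> where \<epsilon>: "\<epsilon> > 0" "cball x \<epsilon> \<subseteq> \<Omega>"
      using \<open>open \<Omega>\<close> x(1) open_contains_cball by blast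
    \<comment> \<open>Half of \<open>d\<close> makes \<open>h < d\<close> strict. Division by the
      dimension keeps the cube inside the ball, since the bound of the norm by the sum of
      coordinates collects one \<open>h\<close> per coordinate.\<close>
    define h where "h = min (d / 2) (\<epsilon> / real DIM('a))"
    have h: "h > 0" "h < d" "real DIM('a) * h \<le> \<epsilon>"
      using d(1) \<epsilon>(1) by (auto simp: h_def min_def field_simps)
    have "cbox x (x + h *\<^sub>R One) \<subseteq> cball x \<epsilon>"
    proof
      fix y assume y: "y \<in> cbox x (x + h *\<^sub>R One)"
      have "norm (y - x) \<le> (\<Sum>i\<in>Basis. \<bar>(y - x) \<bullet> i\<bar>)" by (rule norm_le_l1)
      also have "\<dots> \<le> (\<Sum>i\<in>(Basis::'a set). h)"
        using y by (intro sum_mono) (force simp: mem_box inner_simps)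
      also have "\<dots> \<le> \<epsilon>" using h by simp
      finally show "y \<in> cball x \<epsilon>" by (simp add: dist_norm norm_minus_commute)
    qed
    then have "integral (cbox x (x + h *\<^sub>R One)) w0 = 0" using \<epsilon>(2) by (intro zero) auto
    \<comment> \<open>The average over the cube vanishes, so the estimate with tolerance
      \<open>\<bar>w x\<bar>\<close> reads \<open>\<bar>w x\<bar> < \<bar>w x\<bar>\<close>.\<close>
    with d(2)[OF h(1,2)] x(1) show False by (simp add: w0_def)
  qed
  moreover have "N \<in> null_sets lebesgue" using N(1) by (simp add: negligible_iff_null_sets)
  ultimately show ?thesis
    using \<Omega> by (auto simp: AE_restrict_space_iff intro!: AE_I'[of N])
qed

text \<open>The bumps lie between 0 and 1 and tend to the indicator of a box, so dominated
  convergence with majorant \<open>\<bar>w\<bar>\<close> carries the orthogonality over to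
  boxes.\<close>

theorem fundamental_lemma:
  fixes w :: "'a::euclidean_space \<Rightarrow> real"
  assumes "open \<Omega>" and w: "integrable (lebesgue_on \<Omega>) w"
    and 0: "\<And>\<phi>. \<phi> \<in> test_functions \<Omega> \<Longrightarrow> (\<integral>x. w x * \<phi> x \<partial>lebesgue_on \<Omega>) = 0"
  shows "AE x in lebesgue_on \<Omega>. w x = 0"
proof (rule AE_eq_0_if_box_integrals_0[OF assms(1,2)])
  fix a b assume ab: "cbox a b \<subseteq> \<Omega>"
  have meas: "box_bump a b n \<in> borel_measurable (lebesgue_on \<Omega>)" for n
    using smooth_dir_derivs_continuous[OF box_bump_smooth, of "[]" a b n] assms(1)
    by (intro continuous_imp_measurable_on_sets_lebesgue) (auto intro: continuous_on_subset)
  have "(\<lambda>n. \<integral>x. w x * box_bump a b n x \<partial>lebesgue_on \<Omega>)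
      \<longlonglongrightarrow> (\<integral>x. w x * indicator (box a b) x \<partial>lebesgue_on \<Omega>)"
  proof (rule integral_dominated_convergence[where w = "\<lambda>x. \<bar>w x\<bar>"])
    show "(\<lambda>x. w x * indicator (box a b) x) \<in> borel_measurable (lebesgue_on \<Omega>)"
      using w assms(1) by (intro borel_measurable_times borel_measurable_indicator')
         (auto simp: sets_restrict_space_iff Int_def[symmetric] lmeasurable_open)
    show "(\<lambda>x. w x * box_bump a b n x) \<in> borel_measurable (lebesgue_on \<Omega>)" for n
      using w meas by (intro borel_measurable_times) auto
    show "AE x in lebesgue_on \<Omega>. (\<lambda>n. w x * box_bump a b n x) \<longlonglongrightarrow> w x * indicator (box a b) x"
      by (intro AE_I2 tendsto_intros box_bump_tendsto)
    show "AE x in lebesgue_on \<Omega>. norm (w x * box_bump a b n x) \<le> \<bar>w x\<bar>" for n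
      by (intro AE_I2) (simp add: abs_mult box_bump_bounds mult_left_le)
  qed (use w in auto)
  moreover have "(\<integral>x. w x * box_bump a b n x \<partial>lebesgue_on \<Omega>) = 0" for n
    by (rule 0[OF box_bump_test_function[OF ab]])
  ultimately show "(\<integral>x. w x * indicator (box a b) x \<partial>lebesgue_on \<Omega>) = 0"
    by (simp add: LIMSEQ_const_iff)
qed

section \<open>Square roots of positive definite matrices\<close>

text \<open>Serves as the first-order condition at a maximiser: near \<open>t = 0\<close> the linear
  term decides the sign, so it has to vanish.\<close>

lemma quadratic_nonpos_imp_linear_coeff_0:
  fixes a b :: real
  assumes "\<And>t. 2 * t * a + t\<^sup>2 * b \<le> 0"
  shows "a = 0"
proof (rule ccontr)
  assume "a \<noteq> 0"
  \<comment> \<open>It has the sign of \<open>a\<close> and is small enough for the linear term to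
    beat the quadratic one; adding 1 avoids a zero denominator.\<close>
  define t where "t = a / (\<bar>b\<bar> + 1)"
  have a: "a = t * (\<bar>b\<bar> + 1)" by (simp add: t_def)
  have "2 * t * a + t\<^sup>2 * b = t\<^sup>2 * (2 * (\<bar>b\<bar> + 1) + b)"
    unfolding a by (simp add: algebra_simps power2_eq_square)
  moreover have "t\<^sup>2 * (2 * (\<bar>b\<bar> + 1) + b) > 0"
    using \<open>a \<noteq> 0\<close> a by (intro mult_pos_pos) (auto simp: abs_if)
  ultimately show False using assms[of t] by simp
qed

lemma symmetric_inner_commute:
  fixes A :: "real^'n^'n" assumes "transpose A = A"
  shows "x \<bullet> (A *v y) = y \<bullet> (A *v x)"
  using dot_lmul_matrix[of x A y] assms
  by (metis inner_commute transpose_matrix_vector)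

text \<open>Maximise the Rayleigh quotient over the unit sphere of \<open>V\<close>, which is
  compact. Invariance of \<open>V\<close> keeps the defect \<open>A *v v - l *\<^sub>R v\<close> in
  \<open>V\<close>, so it is an admissible direction of variation.\<close>

lemma symmetric_invariant_subspace_eigenvector:
  fixes A :: "real^'n^'n"
  assumes sym: "transpose A = A" and V: "subspace V" "\<And>x. x \<in> V \<Longrightarrow> A *v x \<in> V" "V \<noteq> {0}"
  obtains v l where "v \<in> V" "norm v = 1" "A *v v = l *\<^sub>R v"
proof -
  obtain z where z: "z \<in> V" "z \<noteq> 0" using V subspace_0 by blast
  let ?K = "V \<inter> sphere 0 1"
  have "z /\<^sub>R norm z \<in> ?K" using z V(1) by (auto intro: subspace_mul)
  moreover have "compact ?K" using V(1) by (intro closed_Int_compact closed_subspace) auto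
  moreover have "continuous_on ?K (\<lambda>x. x \<bullet> (A *v x))"
    by (intro continuous_intros)
  ultimately obtain v where v: "v \<in> ?K" "\<And>x. x \<in> ?K \<Longrightarrow> x \<bullet> (A *v x) \<le> v \<bullet> (A *v v)"
    using continuous_attains_sup[of ?K "\<lambda>x. x \<bullet> (A *v x)"] by blast
  define l where "l = v \<bullet> (A *v v)"
  have le: "x \<bullet> (A *v x) \<le> l * (x \<bullet> x)" if "x \<in> V" for x
  proof (cases "x = 0")
    case False
    have "(x /\<^sub>R norm x) \<bullet> (A *v (x /\<^sub>R norm x)) \<le> l"
      unfolding l_def using that False V(1) by (intro v(2)) (auto intro: subspace_mul)
    then have "(x \<bullet> (A *v x)) / (norm x)\<^sup>2 \<le> l"
      by (simp add: matrix_vector_mult_scaleR power2_eq_square field_simps)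
    with False show ?thesis by (simp add: field_simps power2_norm_eq_inner)
  qed simp
  \<comment> \<open>Perturbing the maximiser in the direction of its eigenvalue defect shows that the defect vanishes.\<close>
  define w where "w = A *v v - l *\<^sub>R v"
  have vv: "v \<bullet> v = 1" using v(1) by (simp add: norm_eq_1)
  have wV: "w \<in> V" using v(1) V by (auto simp: w_def intro: subspace_diff subspace_mul)
  have "2 * t * (w \<bullet> w) + t\<^sup>2 * (w \<bullet> (A *v w) - l * (w \<bullet> w)) \<le> 0" for t
  proof -
    have expand: "(v + t *\<^sub>R w) \<bullet> (A *v (v + t *\<^sub>R w))
        = l + 2 * t * (w \<bullet> (A *v v)) + t\<^sup>2 * (w \<bullet> (A *v w))"
      using symmetric_inner_commute[OF sym, of v w]
      by (simp add: matrix_vector_right_distrib matrix_vector_mult_scaleR inner_simps l_def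
          power2_eq_square algebra_simps)
    have wAv: "w \<bullet> (A *v v) = w \<bullet> w + l * (w \<bullet> v)" by (simp add: w_def inner_simps algebra_simps)
    have expand': "(v + t *\<^sub>R w) \<bullet> (v + t *\<^sub>R w) = 1 + 2 * t * (w \<bullet> v) + t\<^sup>2 * (w \<bullet> w)"
      using vv by (simp add: inner_simps inner_commute power2_eq_square algebra_simps)
    have "(v + t *\<^sub>R w) \<bullet> (A *v (v + t *\<^sub>R w)) \<le> l * ((v + t *\<^sub>R w) \<bullet> (v + t *\<^sub>R w))"
      using v(1) wV V(1) by (intro le) (auto intro: subspace_add subspace_mul)
    then show ?thesis unfolding expand expand' wAv by (simp add: algebra_simps)
  qed
  then have "w = 0" using quadratic_nonpos_imp_linear_coeff_0[of "w \<bullet> w" "w \<bullet> (A *v w) - l * (w \<bullet> w)"] by simp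
  then show ?thesis using that[of v l] v(1) by (simp add: w_def)
qed

text \<open>Induction on the dimension: split off one eigenvector. By symmetry its orthogonal
  complement within \<open>V\<close> is again invariant, which is why the statement is about
  invariant subspaces and not just the whole space.\<close>

lemma symmetric_invariant_subspace_eigenbasis:
  fixes A :: "real^'n^'n"
  assumes sym: "transpose A = A" and V: "subspace V" "\<And>x. x \<in> V \<Longrightarrow> A *v x \<in> V"
  shows "\<exists>B l. finite B \<and> pairwise orthogonal B \<and> (\<forall>b\<in>B. norm b = 1 \<and> A *v b = l b *\<^sub>R b) \<and> span B = V"
  using V
proof (induction "dim V" arbitrary: V rule: less_induct)
  case less
  show ?case
  proof (cases "V = {0}")
    case True
    then show ?thesis by (intro exI[of _ "{}"]) auto
  next
    case False
    from symmetric_invariant_subspace_eigenvector[OF sym less.prems False]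
    obtain v m where v: "v \<in> V" "norm v = 1" "A *v v = m *\<^sub>R v" by blast
    let ?W = "{x \<in> V. x \<bullet> v = 0}"
    have W: "subspace ?W" using less.prems(1) by (auto simp: subspace_def inner_simps)
    have inv: "A *v x \<in> ?W" if "x \<in> ?W" for x
      using that less.prems(2) v(3) symmetric_inner_commute[OF sym, of v x]
      by (auto simp: inner_commute)
    have "v \<notin> ?W" using v(2) by (auto simp: norm_eq_1)
    then have "?W \<subset> V" using v(1) by blast
    then have "dim ?W < dim V"
      using W less.prems(1) by (intro dim_psubset) (simp add: span_eq_iff[THEN iffD2])
    from less.hyps[OF this W inv] obtain B l where B: "finite B" "pairwise orthogonal B"
      "\<And>b. b \<in> B \<Longrightarrow> norm b = 1 \<and> A *v b = l b *\<^sub>R b" "span B = ?W" by blast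
    have BW: "B \<subseteq> ?W" using B(4) span_superset by blast
    with \<open>v \<notin> ?W\<close> have "v \<notin> B" by blast
    have "span (insert v B) = V"
    proof
      show "span (insert v B) \<subseteq> V" using BW v(1) less.prems(1) by (intro span_minimal) auto
      show "V \<subseteq> span (insert v B)"
      proof
        fix x assume "x \<in> V"
        have "x - (x \<bullet> v) *\<^sub>R v \<in> ?W"
          using \<open>x \<in> V\<close> v less.prems(1)
          by (auto simp: inner_simps norm_eq_1 intro: subspace_diff subspace_mul)
        then have "x - (x \<bullet> v) *\<^sub>R v \<in> span B" using B(4) by simp
        then show "x \<in> span (insert v B)" by (auto simp: span_insert)
      qed
    qed
    moreover have "pairwise orthogonal (insert v B)"
      using B(2) BW by (intro pairwise_orthogonal_insert) (auto simp: orthogonal_def inner_commute)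
    moreover have "\<forall>b\<in>insert v B. norm b = 1 \<and> A *v b = (l(v := m)) b *\<^sub>R b"
      using v B(3) \<open>v \<notin> B\<close> by auto
    ultimately show ?thesis using B(1) by blast
  qed
qed

lemma symmetric_eigenbasis:
  fixes A :: "real^'n^'n"
  assumes "transpose A = A"
  obtains B l where "finite B" "pairwise orthogonal B" "\<And>b. b \<in> B \<Longrightarrow> norm b = 1"
    "\<And>b. b \<in> B \<Longrightarrow> A *v b = l b *\<^sub>R b" "span B = UNIV"
  using symmetric_invariant_subspace_eigenbasis[OF assms, of UNIV] by auto

lemma matrix_eqI_span:
  fixes A B :: "real^'n^'n"
  assumes "span E = UNIV" "\<And>b. b \<in> E \<Longrightarrow> A *v b = B *v b"
  shows "A = B"
proof -
  have "A *v x = B *v x" for x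
    by (rule linear_eq_on_span[of "(*v) A" "(*v) B" E]) (use assms in auto)
  then show ?thesis by (simp add: matrix_eq)
qed

text \<open>Existence and uniqueness together give the \<open>THE\<close> in \<open>pos_sqrt\<close>
  a meaning. Existence takes roots of the eigenvalues in an orthonormal eigenbasis of
  \<open>A\<close>; a competing root is compared on the same basis and so is never diagonalised
  itself.\<close>

lemma sym_pos_def_sqrt_exists:
  assumes A: "sym_pos_def A"
  shows "\<exists>!S. sym_pos_def S \<and> S ** S = A"
proof -
  obtain B l where B: "finite B" "pairwise orthogonal B" "\<And>b. b \<in> B \<Longrightarrow> norm b = 1"
    "\<And>b. b \<in> B \<Longrightarrow> A *v b = l b *\<^sub>R b" "span B = UNIV"
    using symmetric_eigenbasis[of A] A unfolding sym_pos_def_def by metis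
  have l_pos: "l b > 0" if "b \<in> B" for b
  proof -
    have "b \<bullet> b = 1" "b \<noteq> 0" using B(3)[OF that] by (auto simp: norm_eq_1)
    then show ?thesis using A B(4)[OF that] unfolding sym_pos_def_def by force
  qed
  define F where "F x = (\<Sum>b\<in>B. (sqrt (l b) * (b \<bullet> x)) *\<^sub>R b)" for x
  have "linear F"
    unfolding F_def
    by (intro linearI) (simp_all add: inner_simps algebra_simps sum.distrib scaleR_sum_right)
  define S where "S = matrix F"
  have S: "S *v x = F x" for x using \<open>linear F\<close> by (simp add: S_def matrix_works)
  have Sb: "S *v b = sqrt (l b) *\<^sub>R b" if "b \<in> B" for b
  proof -
    have "F b = (\<Sum>c\<in>B. if c = b then sqrt (l b) *\<^sub>R b else 0)"
      unfolding F_def using B(2) B(3)[OF that] that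
      by (intro sum.cong refl) (auto simp: pairwise_def orthogonal_def norm_eq_1)
    with that B(1) show ?thesis by (simp add: S)
  qed
  have "transpose S = S"
  proof -
    have "x \<bullet> (S *v y) = y \<bullet> (S *v x)" for x y
      by (simp add: S F_def inner_sum_right inner_commute mult_ac)
    then have "x \<bullet> (transpose S *v y) = x \<bullet> (S *v y)" for x y
      by (metis dot_lmul_matrix inner_commute transpose_matrix_vector)
    then have "transpose S *v y = S *v y" for y
      by (metis vector_eq_rdot inner_commute)
    then show ?thesis by (simp add: matrix_eq)
  qed
  moreover have "x \<bullet> (S *v x) > 0" if "x \<noteq> 0" for x
  proof -
    have eq: "x \<bullet> (S *v x) = (\<Sum>b\<in>B. sqrt (l b) * (b \<bullet> x)\<^sup>2)"
      by (simp add: S F_def inner_sum_right inner_commute power2_eq_square mult_ac)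
    \<comment> \<open>A vector orthogonal to all of \<open>B\<close> is orthogonal to its span,
      which is everything, and hence to itself.\<close>
    have "\<exists>b\<in>B. b \<bullet> x \<noteq> 0"
    proof (rule ccontr)
      assume "\<not> (\<exists>b\<in>B. b \<bullet> x \<noteq> 0)"
      then have "orthogonal x x"
        using orthogonal_to_span[of x B x] B(5) by (auto simp: orthogonal_def inner_commute)
      with that show False by (simp add: orthogonal_def)
    qed
    then obtain b where "b \<in> B" "b \<bullet> x \<noteq> 0" by blast
    then show ?thesis unfolding eq
      using B(1) l_pos by (intro sum_pos2[of B b]) (auto simp: less_imp_le)
  qed
  ultimately have "sym_pos_def S" by (simp add: sym_pos_def_def)
  moreover have "S ** S = A"
    by (rule matrix_eqI_span[OF B(5)])
      (use l_pos in \<open>auto simp: matrix_vector_mul_assoc[symmetric] Sb matrix_vector_mult_scaleR B(4) less_imp_le\<close>)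
  moreover have "R = S" if R: "sym_pos_def R" "R ** R = A" for R
  proof (rule matrix_eqI_span[OF B(5)])
    fix b assume b: "b \<in> B"
    \<comment> \<open>\<open>(R + \<surd>l) (R - \<surd>l) b = 0\<close>, and \<open>R + \<surd>l\<close> is positive definite.\<close>
    define w where "w = R *v b - sqrt (l b) *\<^sub>R b"
    have "R *v w = - sqrt (l b) *\<^sub>R w"
      using R(2) B(4)[OF b] l_pos[OF b]
      by (simp add: w_def matrix_vector_mult_diff_distrib matrix_vector_mul_assoc
          matrix_vector_mult_scaleR algebra_simps)
    then have "w \<bullet> (R *v w) = - sqrt (l b) * (w \<bullet> w)" by simp
    moreover have "sqrt (l b) * (w \<bullet> w) \<ge> 0" using l_pos[OF b] by (simp add: less_imp_le)
    ultimately have "w = 0" using R(1) unfolding sym_pos_def_def by force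
    then show "R *v b = S *v b" using Sb[OF b] by (simp add: w_def)
  qed
  ultimately show ?thesis by blast
qed

lemma pos_sqrt_works:
  assumes "sym_pos_def A"
  shows "sym_pos_def (pos_sqrt A)" "pos_sqrt A ** pos_sqrt A = A"
  using theI'[OF sym_pos_def_sqrt_exists[OF assms]] by (auto simp: pos_sqrt_def)

lemma pos_sqrt_inner:
  assumes "sym_pos_def A"
  shows "(pos_sqrt A *v x) \<bullet> (pos_sqrt A *v y) = x \<bullet> (A *v y)"
proof -
  have "(pos_sqrt A *v x) \<bullet> (pos_sqrt A *v y) = x \<bullet> (pos_sqrt A *v (pos_sqrt A *v y))"
    using symmetric_inner_commute[of "pos_sqrt A" "pos_sqrt A *v y" x] pos_sqrt_works(1)[OF assms]
    by (simp add: sym_pos_def_def inner_commute)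
  then show ?thesis using pos_sqrt_works(2)[OF assms] by (simp add: matrix_vector_mul_assoc)
qed

lemma norm_pos_sqrt:
  assumes "sym_pos_def A" shows "(norm (pos_sqrt A *v x))\<^sup>2 = x \<bullet> (A *v x)"
  by (simp add: power2_norm_eq_inner pos_sqrt_inner[OF assms])

text \<open>\<open>matrix_inv\<close> is a choice and only meaningful for an invertible matrix;
  positive definiteness makes the kernel of the root trivial.\<close>

lemma matrix_inv_pos_sqrt:
  assumes "sym_pos_def A" shows "matrix_inv (pos_sqrt A) *v (pos_sqrt A *v x) = x"
proof -
  have "inj ((*v) (pos_sqrt A))"
  proof (rule injI)
    fix x y assume "pos_sqrt A *v x = pos_sqrt A *v y"
    then have "(x - y) \<bullet> (pos_sqrt A *v (x - y)) = 0" by (simp add: matrix_vector_mult_diff_distrib)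
    then show "x = y" using pos_sqrt_works(1)[OF assms] unfolding sym_pos_def_def
      by (metis less_irrefl right_minus_eq)
  qed
  then have "invertible (pos_sqrt A)"
    by (simp add: invertible_left_inverse matrix_left_invertible_injective)
  then have "matrix_inv (pos_sqrt A) ** pos_sqrt A = mat 1"
    unfolding invertible_def matrix_inv_def by (rule someI2_ex) blast
  then show ?thesis by (simp add: matrix_vector_mul_assoc)
qed

section \<open>Square integrable functions, weak derivatives and traces\<close>

lemma norm_diff_square_le: "(norm (a - b))\<^sup>2 \<le> 2 * (norm a)\<^sup>2 + 2 * (norm b)\<^sup>2"
  for a b :: "'b::real_inner"
proof -
  have "(norm (a + b))\<^sup>2 \<ge> 0" by simp
  then show ?thesis by (simp add: power2_norm_eq_inner inner_simps inner_commute)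
qed

lemma abs_inner_le_squares: "\<bar>a \<bullet> b\<bar> \<le> (norm a)\<^sup>2 + (norm b)\<^sup>2"
  for a b :: "'b::real_inner"
proof -
  have "2 * (norm a * norm b) \<le> (norm a)\<^sup>2 + (norm b)\<^sup>2"
    using sum_squares_bound[of "norm a" "norm b"] by (simp add: mult.assoc)
  moreover have "\<bar>a \<bullet> b\<bar> \<le> norm a * norm b" by (rule Cauchy_Schwarz_ineq2)
  moreover have "0 \<le> norm a * norm b" by simp
  ultimately show ?thesis by linarith
qed

lemma L2_iff:
  "w \<in> L2 \<Omega> \<longleftrightarrow> w \<in> borel_measurable (lebesgue_on \<Omega>) \<and>
     integrable (lebesgue_on \<Omega>) (\<lambda>x. (norm (w x))\<^sup>2)"
  by (auto simp: L2_def integrable_iff_bounded)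

lemma L2_measurable: "w \<in> L2 \<Omega> \<Longrightarrow> w \<in> borel_measurable (lebesgue_on \<Omega>)"
  by (simp add: L2_iff)

lemma l2_norm_sq_eq: "w \<in> L2 \<Omega> \<Longrightarrow> l2_norm_sq \<Omega> w = ennreal (\<integral>x. (norm (w x))\<^sup>2 \<partial>lebesgue_on \<Omega>)"
  unfolding l2_norm_sq_def by (intro nn_integral_eq_integral) (auto simp: L2_iff)

lemma L2_dominated:
  assumes "w \<in> borel_measurable (lebesgue_on \<Omega>)" "v \<in> L2 \<Omega>"
    and "AE x in lebesgue_on \<Omega>. norm (w x) \<le> c * norm (v x)"
  shows "w \<in> L2 \<Omega>"
  unfolding L2_iff
proof
  show "integrable (lebesgue_on \<Omega>) (\<lambda>x. (norm (w x))\<^sup>2)"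
  proof (rule Bochner_Integration.integrable_bound)
    show "integrable (lebesgue_on \<Omega>) (\<lambda>x. c\<^sup>2 * (norm (v x))\<^sup>2)"
      using assms(2) by (simp add: L2_iff)
    show "AE x in lebesgue_on \<Omega>. norm ((norm (w x))\<^sup>2) \<le> norm (c\<^sup>2 * (norm (v x))\<^sup>2)"
      using assms(3)
      by eventually_elim (use power_mono[of "norm (w _)" "c * norm (v _)" 2] in \<open>auto simp: power_mult_distrib\<close>)
  qed (use assms(1) in measurable)
qed (rule assms(1))

lemma L2_diff: assumes "v \<in> L2 \<Omega>" "w \<in> L2 \<Omega>" shows "(\<lambda>x. v x - w x) \<in> L2 \<Omega>"
  unfolding L2_iff
proof
  show m: "(\<lambda>x. v x - w x) \<in> borel_measurable (lebesgue_on \<Omega>)"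
    using assms by (auto simp: L2_iff intro: borel_measurable_diff)
  show "integrable (lebesgue_on \<Omega>) (\<lambda>x. (norm (v x - w x))\<^sup>2)"
    by (rule Bochner_Integration.integrable_bound[of _ "\<lambda>x. 2 * (norm (v x))\<^sup>2 + 2 * (norm (w x))\<^sup>2"])
      (use assms m in \<open>auto simp: L2_iff norm_diff_square_le\<close>)
qed

lemma L2_scale: "w \<in> L2 \<Omega> \<Longrightarrow> (\<lambda>x. c * w x) \<in> L2 \<Omega>" for c :: real
  by (rule L2_dominated[of _ _ w "\<bar>c\<bar>"]) (auto simp: L2_iff abs_mult)

lemma L2_inner_integrable:
  assumes "v \<in> L2 \<Omega>" "w \<in> L2 \<Omega>" shows "integrable (lebesgue_on \<Omega>) (\<lambda>x. v x \<bullet> w x)"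
  by (rule Bochner_Integration.integrable_bound[of _ "\<lambda>x. (norm (v x))\<^sup>2 + (norm (w x))\<^sup>2"])
    (use assms in \<open>auto simp: L2_iff abs_inner_le_squares\<close>)

lemma L2_mult_integrable:
  "v \<in> L2 \<Omega> \<Longrightarrow> w \<in> L2 \<Omega> \<Longrightarrow> integrable (lebesgue_on \<Omega>) (\<lambda>x. v x * w x)"
  for v w :: "_ \<Rightarrow> real"
  using L2_inner_integrable[of v \<Omega> w] by simp

lemma L2_bounded:
  assumes "\<Omega> \<in> lmeasurable" "w \<in> borel_measurable (lebesgue_on \<Omega>)" "\<And>x. norm (w x) \<le> B"
  shows "w \<in> L2 \<Omega>"
proof -
  interpret finite_measure "lebesgue_on \<Omega>" using assms(1) by (rule finite_measure_lebesgue_on)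
  have "(norm (w x))\<^sup>2 \<le> B\<^sup>2" for x using assms(3)[of x] by (intro power_mono) auto
  then show ?thesis
    using assms(2) by (auto simp: L2_iff intro!: integrable_const_bound[where B = "B\<^sup>2"])
qed

lemma L2_integrable:
  fixes w :: "real^'n \<Rightarrow> real"
  assumes "\<Omega> \<in> lmeasurable" "w \<in> L2 \<Omega>" shows "integrable (lebesgue_on \<Omega>) w"
  using L2_mult_integrable[OF assms(2) L2_bounded[OF assms(1), of "\<lambda>_. 1" 1]] by simp

section \<open>Weak derivatives and their uniqueness\<close>

lemma test_function_dir_derivs_L2:
  assumes "open \<Omega>" "bounded \<Omega>" "\<phi> \<in> test_functions \<Omega>"
  shows "dir_derivs bs \<phi> \<in> L2 \<Omega>"
proof -
  have "\<Omega> \<in> lmeasurable" using assms(1,2) by (rule lmeasurable_open[rotated])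
  moreover have "dir_derivs bs \<phi> \<in> borel_measurable (lebesgue_on \<Omega>)"
    using smooth_dir_derivs_continuous[of \<phi> bs] assms
    by (intro continuous_imp_measurable_on_sets_lebesgue)
       (auto intro: continuous_on_subset simp: test_functions_def)
  moreover obtain B where "\<And>x. \<bar>dir_derivs bs \<phi> x\<bar> \<le> B"
    using test_function_dir_derivs_bounded[OF assms(3)] by blast
  ultimately show ?thesis by (intro L2_bounded[of _ _ B]) auto
qed

text \<open>\<open>is_weak_deriv\<close> quantifies over the lists that realise a multi-index. If
  there were none, its integral condition would be vacuous and uniqueness would fail.\<close>

lemma ex_list_count:
  fixes \<alpha> :: "'n::finite \<Rightarrow> nat"
  obtains js where "\<And>i. count_list js i = \<alpha> i"
proof -
  obtain js where js: "mset js = Abs_multiset \<alpha>" using ex_mset by blast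
  have "count (mset js) = \<alpha>" unfolding js by simp
  then have "count_list js i = \<alpha> i" for i
    by (metis count_mset)
  then show ?thesis by (rule that)
qed

lemma is_weak_deriv_diff:
  fixes v w :: "real^'n \<Rightarrow> real"
  assumes \<Omega>: "open \<Omega>" "bounded \<Omega>"
    and v: "is_weak_deriv \<Omega> \<alpha> v v'" and w: "is_weak_deriv \<Omega> \<alpha> w w'"
  shows "is_weak_deriv \<Omega> \<alpha> (\<lambda>x. v x - w x) (\<lambda>x. v' x - w' x)"
  unfolding is_weak_deriv_def
proof (intro conjI ballI allI impI)
  show "(\<lambda>x. v x - w x) \<in> L2 \<Omega>" "(\<lambda>x. v' x - w' x) \<in> L2 \<Omega>"
    using v w by (auto simp: is_weak_deriv_def L2_diff)
  fix \<phi> js assume \<phi>: "\<phi> \<in> test_functions \<Omega>" and js: "\<forall>i. count_list js i = \<alpha> i"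
  have *: "l2_inner \<Omega> (\<lambda>x. a x - b x) \<psi> = l2_inner \<Omega> a \<psi> - l2_inner \<Omega> b \<psi>"
    if "a \<in> L2 \<Omega>" "b \<in> L2 \<Omega>" "\<psi> \<in> L2 \<Omega>" for a b \<psi> :: "real^'n \<Rightarrow> real"
    using that by (simp add: l2_inner_def left_diff_distrib L2_mult_integrable)
  have L2: "dir_derivs bs \<phi> \<in> L2 \<Omega>" for bs
    by (rule test_function_dir_derivs_L2[OF \<Omega> \<phi>])
  from L2[of "[]"] have "\<phi> \<in> L2 \<Omega>" by simp
  then show "l2_inner \<Omega> (\<lambda>x. v x - w x) (dir_derivs (map (\<lambda>i. axis i 1) js) \<phi>)
      = (- 1) ^ mi_order \<alpha> * l2_inner \<Omega> (\<lambda>x. v' x - w' x) \<phi>"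
    using v w \<phi> js L2 by (simp add: is_weak_deriv_def * right_diff_distrib)
qed

text \<open>The difference of two candidates is a weak derivative of the zero function, hence
  orthogonal to all test functions. Boundedness of \<open>\<Omega>\<close> makes it integrable, as
  \<open>fundamental_lemma\<close> demands.\<close>

lemma is_weak_deriv_unique:
  assumes \<Omega>: "open \<Omega>" "bounded \<Omega>"
    and v: "is_weak_deriv \<Omega> \<alpha> v v'" and w: "is_weak_deriv \<Omega> \<alpha> v w'"
  shows "AE x in lebesgue_on \<Omega>. v' x = w' x"
proof -
  let ?d = "\<lambda>x. v' x - w' x"
  from is_weak_deriv_diff[OF \<Omega> v w] have d: "is_weak_deriv \<Omega> \<alpha> (\<lambda>x. 0) ?d" by simp
  obtain js where js: "\<And>i. count_list js i = \<alpha> i" using ex_list_count[of \<alpha>] by blast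
  have "\<Omega> \<in> lmeasurable" using \<Omega> by (rule lmeasurable_open[rotated])
  then have "integrable (lebesgue_on \<Omega>) ?d"
    using d by (auto simp: is_weak_deriv_def intro: L2_integrable)
  moreover have "(\<integral>x. ?d x * \<phi> x \<partial>lebesgue_on \<Omega>) = 0" if "\<phi> \<in> test_functions \<Omega>" for \<phi>
  proof -
    have "l2_inner \<Omega> (\<lambda>x. 0) (dir_derivs (map (\<lambda>i. axis i 1) js) \<phi>)
        = (- 1) ^ mi_order \<alpha> * l2_inner \<Omega> ?d \<phi>"
      using d that js unfolding is_weak_deriv_def by blast
    then show ?thesis by (simp add: l2_inner_def)
  qed
  ultimately have "AE x in lebesgue_on \<Omega>. ?d x = 0"
    by (rule fundamental_lemma[OF \<Omega>(1)])
  then show ?thesis by simp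
qed

lemma is_weak_deriv_wderiv: "is_weak_deriv \<Omega> \<alpha> w g \<Longrightarrow> is_weak_deriv \<Omega> \<alpha> w (wderiv \<Omega> \<alpha> w)"
  unfolding wderiv_def by (rule someI[of "is_weak_deriv \<Omega> \<alpha> w"])

lemma is_weak_deriv_0: "w \<in> L2 \<Omega> \<Longrightarrow> is_weak_deriv \<Omega> (\<lambda>_. 0) w w"
proof -
  have "js = []" if "\<forall>i. count_list js i = 0" for js :: "'a list"
    using that by (cases js) (auto split: if_splits)
  then show "w \<in> L2 \<Omega> \<Longrightarrow> is_weak_deriv \<Omega> (\<lambda>_. 0) w w"
    by (fastforce simp: is_weak_deriv_def mi_order_def)
qed

section \<open>The Sobolev space of order one\<close>

lemma mi_order_eq_0_iff: "mi_order \<alpha> = 0 \<longleftrightarrow> \<alpha> = (\<lambda>_. 0)"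
  by (auto simp: mi_order_def)

lemma mi_order_le_1: "{\<alpha> :: 'n::finite \<Rightarrow> nat. mi_order \<alpha> \<le> 1} = insert (\<lambda>_. 0) (range mi_unit)"
proof (intro equalityI subsetI)
  fix \<alpha> :: "'n \<Rightarrow> nat" assume "\<alpha> \<in> {\<alpha>. mi_order \<alpha> \<le> 1}"
  then consider "mi_order \<alpha> = 0" | "mi_order \<alpha> = 1" by force
  then show "\<alpha> \<in> insert (\<lambda>_. 0) (range mi_unit)"
  proof cases
    case 2
    then obtain i where "\<alpha> i = 1" "\<forall>j. j \<noteq> i \<longrightarrow> \<alpha> j = 0"
      unfolding mi_order_def by (subst (asm) sum_eq_1_iff) auto
    then have "\<alpha> = mi_unit i" by (auto simp: mi_unit_def)
    then show ?thesis by simp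
  qed (simp add: mi_order_eq_0_iff)
qed (auto simp: mi_order_def mi_unit_def)

lemma inj_mi_unit: "inj mi_unit"
  by (rule injI) (metis mi_unit_def zero_neq_one)

text \<open>At order 1 the fractional part is 0, so no Gagliardo term survives, and the indices of
  order at most 1 are the zero index and the units.\<close>

lemma sobolev_norm_sq_1:
  fixes w :: "real^'n \<Rightarrow> real"
  shows "sobolev_norm_sq \<Omega> 1 w =
     (if \<forall>\<alpha>. mi_order \<alpha> \<le> 1 \<longrightarrow> (\<exists>g. is_weak_deriv \<Omega> \<alpha> w g)
      then l2_norm_sq \<Omega> (wderiv \<Omega> (\<lambda>_. 0) w) + (\<Sum>i\<in>UNIV. l2_norm_sq \<Omega> (wderiv \<Omega> (mi_unit i) w))
      else \<infinity>)"
proof -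
  have "(\<lambda>_. 0) \<notin> range (mi_unit :: 'n \<Rightarrow> _)" by (auto simp: mi_unit_def dest!: fun_cong split: if_splits)
  then have "(\<Sum>\<alpha> | mi_order \<alpha> \<le> 1. f \<alpha>) = f (\<lambda>_. 0) + (\<Sum>i\<in>UNIV. f (mi_unit i))"
    for f :: "('n \<Rightarrow> nat) \<Rightarrow> ennreal"
    by (simp add: mi_order_le_1[unfolded One_nat_def] sum.reindex[OF inj_mi_unit])
  then show ?thesis
    by (simp add: sobolev_norm_sq_def split del: if_split cong: if_cong)
qed

text \<open>Finiteness comes for free: \<open>is_weak_deriv\<close> already demands square
  integrability of the derivative, and only finitely many indices are summed.\<close>

lemma sobolev_space_1_iff:
  "w \<in> sobolev_space \<Omega> 1 \<longleftrightarrow> (\<forall>\<alpha>. mi_order \<alpha> \<le> 1 \<longrightarrow> (\<exists>g. is_weak_deriv \<Omega> \<alpha> w g))"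
proof -
  have "l2_norm_sq \<Omega> (wderiv \<Omega> \<alpha> w) < \<infinity>" if "is_weak_deriv \<Omega> \<alpha> w g" for \<alpha> g
    using is_weak_deriv_wderiv[OF that] by (auto simp: is_weak_deriv_def l2_norm_sq_eq)
  then have fin: "l2_norm_sq \<Omega> (wderiv \<Omega> \<alpha> w) < \<infinity>"
    if "\<forall>\<alpha>. mi_order \<alpha> \<le> 1 \<longrightarrow> (\<exists>g. is_weak_deriv \<Omega> \<alpha> w g)"
      "\<alpha> \<in> insert (\<lambda>_. 0) (range mi_unit)" for \<alpha>
    using that unfolding mi_order_le_1[symmetric] by blast
  show ?thesis
  proof (cases "\<forall>\<alpha>. mi_order \<alpha> \<le> 1 \<longrightarrow> (\<exists>g. is_weak_deriv \<Omega> \<alpha> w g)")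
    case True
    have "l2_norm_sq \<Omega> (wderiv \<Omega> (\<lambda>_. 0) w) < top" "\<And>i. l2_norm_sq \<Omega> (wderiv \<Omega> (mi_unit i) w) < top"
      using fin[OF True] by auto
    then have "sobolev_norm_sq \<Omega> 1 w < top"
      unfolding sobolev_norm_sq_1 if_P[OF True] by (simp add: ennreal_add_less_top)
    with True show ?thesis unfolding sobolev_space_def by simp
  next
    case False
    then have "w \<notin> sobolev_space \<Omega> 1"
      unfolding sobolev_space_def mem_Collect_eq sobolev_norm_sq_1 if_not_P[OF False] by simp
    with False show ?thesis by blast
  qed
qed

lemma sobolev_1_L2:
  assumes "w \<in> sobolev_space \<Omega> 1" shows "w \<in> L2 \<Omega>"
proof -
  have "mi_order (\<lambda>_::'a. 0) \<le> 1" by (simp add: mi_order_def)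
  with assms obtain g where "is_weak_deriv \<Omega> (\<lambda>_. 0) w g" unfolding sobolev_space_1_iff by blast
  then show ?thesis by (simp add: is_weak_deriv_def)
qed

lemma sobolev_1_wderiv:
  assumes "w \<in> sobolev_space \<Omega> 1" "mi_order \<alpha> \<le> 1"
  shows "is_weak_deriv \<Omega> \<alpha> w (wderiv \<Omega> \<alpha> w)"
  using assms by (meson sobolev_space_1_iff is_weak_deriv_wderiv)

lemma sobolev_1_wgrad:
  assumes "w \<in> sobolev_space \<Omega> 1"
  shows "is_weak_deriv \<Omega> (mi_unit i) w (\<lambda>x. wgrad \<Omega> w x $ i)"
  using sobolev_1_wderiv[OF assms, of "mi_unit i"] mi_order_le_1 by (auto simp: wgrad_def)

lemma l2_norm_sq_cong_AE:
  "AE x in lebesgue_on \<Omega>. v x = w x \<Longrightarrow> l2_norm_sq \<Omega> v = l2_norm_sq \<Omega> w"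
  unfolding l2_norm_sq_def by (rule nn_integral_cong_AE) auto

lemma l2_norm_sq_diff_le:
  assumes "v \<in> borel_measurable (lebesgue_on \<Omega>)" "w \<in> borel_measurable (lebesgue_on \<Omega>)"
  shows "l2_norm_sq \<Omega> (\<lambda>x. v x - w x) \<le> 2 * l2_norm_sq \<Omega> v + 2 * l2_norm_sq \<Omega> w"
proof -
  have "l2_norm_sq \<Omega> (\<lambda>x. v x - w x)
      \<le> (\<integral>\<^sup>+x. 2 * ennreal ((norm (v x))\<^sup>2) + 2 * ennreal ((norm (w x))\<^sup>2) \<partial>lebesgue_on \<Omega>)"
    unfolding l2_norm_sq_def
  proof (rule nn_integral_mono)
    fix x
    have "ennreal ((norm (v x - w x))\<^sup>2) \<le> ennreal (2 * (norm (v x))\<^sup>2 + 2 * (norm (w x))\<^sup>2)"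
      by (intro ennreal_leI norm_diff_square_le)
    then show "ennreal ((norm (v x - w x))\<^sup>2) \<le> 2 * ennreal ((norm (v x))\<^sup>2) + 2 * ennreal ((norm (w x))\<^sup>2)"
      by (simp add: ennreal_plus ennreal_mult)
  qed
  also have "\<dots> = 2 * l2_norm_sq \<Omega> v + 2 * l2_norm_sq \<Omega> w"
    using assms unfolding l2_norm_sq_def
    by (subst nn_integral_add) (auto simp: nn_integral_cmult)
  finally show ?thesis .
qed

lemma wderiv_diff_AE:
  assumes \<Omega>: "open \<Omega>" "bounded \<Omega>"
    and "is_weak_deriv \<Omega> \<alpha> v (wderiv \<Omega> \<alpha> v)" "is_weak_deriv \<Omega> \<alpha> w (wderiv \<Omega> \<alpha> w)"
  shows "AE x in lebesgue_on \<Omega>. wderiv \<Omega> \<alpha> (\<lambda>x. v x - w x) x = wderiv \<Omega> \<alpha> v x - wderiv \<Omega> \<alpha> w x"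
  using is_weak_deriv_diff[OF assms] is_weak_deriv_unique[OF \<Omega>] is_weak_deriv_wderiv by blast

lemma sobolev_1_diff:
  assumes \<Omega>: "open \<Omega>" "bounded \<Omega>" and "v \<in> sobolev_space \<Omega> 1" "w \<in> sobolev_space \<Omega> 1"
  shows "(\<lambda>x. v x - w x) \<in> sobolev_space \<Omega> 1"
  using assms(3,4) is_weak_deriv_diff[OF \<Omega>] unfolding sobolev_space_1_iff by blast

text \<open>A substitute for the triangle inequality that also covers infinite values. The factor 2
  is harmless, as it is applied to sequences tending to 0 in \<open>has_trace_diff\<close>.\<close>

lemma sobolev_norm_sq_1_diff_le:
  assumes \<Omega>: "open \<Omega>" "bounded \<Omega>"
  shows "sobolev_norm_sq \<Omega> 1 (\<lambda>x. v x - w x) \<le> 2 * sobolev_norm_sq \<Omega> 1 v + 2 * sobolev_norm_sq \<Omega> 1 w"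
proof (cases "v \<in> sobolev_space \<Omega> 1 \<and> w \<in> sobolev_space \<Omega> 1")
  case True
  have eq: "sobolev_norm_sq \<Omega> 1 z =
      l2_norm_sq \<Omega> (wderiv \<Omega> (\<lambda>_. 0) z) + (\<Sum>i\<in>UNIV. l2_norm_sq \<Omega> (wderiv \<Omega> (mi_unit i) z))"
    if "z \<in> sobolev_space \<Omega> 1" for z
    using that by (simp add: sobolev_norm_sq_1 sobolev_space_1_iff)
  have *: "l2_norm_sq \<Omega> (wderiv \<Omega> \<alpha> (\<lambda>x. v x - w x))
      \<le> 2 * l2_norm_sq \<Omega> (wderiv \<Omega> \<alpha> v) + 2 * l2_norm_sq \<Omega> (wderiv \<Omega> \<alpha> w)" if "mi_order \<alpha> \<le> 1" for \<alpha>
  proof -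
    have wd: "is_weak_deriv \<Omega> \<alpha> v (wderiv \<Omega> \<alpha> v)" "is_weak_deriv \<Omega> \<alpha> w (wderiv \<Omega> \<alpha> w)"
      using True that by (auto intro: sobolev_1_wderiv)
    have "l2_norm_sq \<Omega> (wderiv \<Omega> \<alpha> (\<lambda>x. v x - w x)) = l2_norm_sq \<Omega> (\<lambda>x. wderiv \<Omega> \<alpha> v x - wderiv \<Omega> \<alpha> w x)"
      by (rule l2_norm_sq_cong_AE[OF wderiv_diff_AE[OF \<Omega> wd]])
    also have "\<dots> \<le> 2 * l2_norm_sq \<Omega> (wderiv \<Omega> \<alpha> v) + 2 * l2_norm_sq \<Omega> (wderiv \<Omega> \<alpha> w)"
      using wd by (intro l2_norm_sq_diff_le) (auto simp: is_weak_deriv_def L2_iff)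
    finally show ?thesis .
  qed
  have le1: "mi_order (\<lambda>_::'a. 0) \<le> 1" "mi_order (mi_unit i) \<le> 1" for i :: 'a
    using mi_order_le_1 by blast+
  have "sobolev_norm_sq \<Omega> 1 (\<lambda>x. v x - w x) \<le>
      (2 * l2_norm_sq \<Omega> (wderiv \<Omega> (\<lambda>_. 0) v) + 2 * l2_norm_sq \<Omega> (wderiv \<Omega> (\<lambda>_. 0) w))
      + (\<Sum>i\<in>UNIV. 2 * l2_norm_sq \<Omega> (wderiv \<Omega> (mi_unit i) v) + 2 * l2_norm_sq \<Omega> (wderiv \<Omega> (mi_unit i) w))"
    using True sobolev_1_diff[OF \<Omega>] by (subst eq) (auto intro!: add_mono sum_mono * le1)
  also have "\<dots> = 2 * sobolev_norm_sq \<Omega> 1 v + 2 * sobolev_norm_sq \<Omega> 1 w"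
    using True by (simp add: eq sum.distrib sum_distrib_left distrib_left ac_simps)
  finally show ?thesis .
next
  case False
  then have "sobolev_norm_sq \<Omega> 1 v = \<infinity> \<or> sobolev_norm_sq \<Omega> 1 w = \<infinity>"
    by (auto simp: sobolev_space_def not_less top_unique)
  then show ?thesis by (auto simp: ennreal_mult_top)
qed

lemma norm_wgrad_square: "(norm (wgrad \<Omega> w x))\<^sup>2 = (\<Sum>i\<in>UNIV. (wderiv \<Omega> (mi_unit i) w x)\<^sup>2)"
  unfolding power2_norm_eq_inner inner_vec_def by (simp add: wgrad_def power2_eq_square)

lemma sobolev_norm_1_square:
  assumes \<Omega>: "open \<Omega>" "bounded \<Omega>" and w: "w \<in> sobolev_space \<Omega> 1"
  shows "(sobolev_norm \<Omega> 1 w)\<^sup>2 =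
    (\<integral>x. (w x)\<^sup>2 \<partial>lebesgue_on \<Omega>) + (\<integral>x. (norm (wgrad \<Omega> w x))\<^sup>2 \<partial>lebesgue_on \<Omega>)"
proof -
  have L2: "wderiv \<Omega> (mi_unit i) w \<in> L2 \<Omega>" for i
    using sobolev_1_wgrad[OF w, of i] by (simp add: wgrad_def is_weak_deriv_def)
  \<comment> \<open>Even the derivative of order 0 in the Sobolev norm is a choice, so it agrees
    with \<open>w\<close> only almost everywhere.\<close>
  have "is_weak_deriv \<Omega> (\<lambda>_. 0) w w" by (rule is_weak_deriv_0[OF sobolev_1_L2[OF w]])
  then have "AE x in lebesgue_on \<Omega>. wderiv \<Omega> (\<lambda>_. 0) w x = w x"
    using is_weak_deriv_unique[OF \<Omega>] is_weak_deriv_wderiv by blast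
  then have "l2_norm_sq \<Omega> (wderiv \<Omega> (\<lambda>_. 0) w) = l2_norm_sq \<Omega> w" by (rule l2_norm_sq_cong_AE)
  then have "sobolev_norm_sq \<Omega> 1 w = ennreal ((\<integral>x. (w x)\<^sup>2 \<partial>lebesgue_on \<Omega>)
      + (\<Sum>i\<in>UNIV. \<integral>x. (wderiv \<Omega> (mi_unit i) w x)\<^sup>2 \<partial>lebesgue_on \<Omega>))"
    using w unfolding sobolev_space_1_iff
    by (simp add: sobolev_norm_sq_1 l2_norm_sq_eq[OF L2] l2_norm_sq_eq[OF sobolev_1_L2[OF w]]
        sum_nonneg ennreal_plus)
  also have "(\<Sum>i\<in>UNIV. \<integral>x. (wderiv \<Omega> (mi_unit i) w x)\<^sup>2 \<partial>lebesgue_on \<Omega>)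
      = (\<integral>x. (\<Sum>i\<in>UNIV. (wderiv \<Omega> (mi_unit i) w x)\<^sup>2) \<partial>lebesgue_on \<Omega>)"
    using L2 by (intro Bochner_Integration.integral_sum[symmetric]) (auto simp: L2_iff)
  also have "\<dots> = (\<integral>x. (norm (wgrad \<Omega> w x))\<^sup>2 \<partial>lebesgue_on \<Omega>)"
    by (simp add: norm_wgrad_square)
  finally show ?thesis by (simp add: sobolev_norm_def del: ennreal_plus)
qed

lemma wgrad_L2:
  assumes "w \<in> sobolev_space \<Omega> 1" shows "wgrad \<Omega> w \<in> L2 \<Omega>"
proof -
  have L2: "wderiv \<Omega> (mi_unit i) w \<in> L2 \<Omega>" for i
    using sobolev_1_wgrad[OF assms, of i] by (simp add: wgrad_def is_weak_deriv_def)
  have "wgrad \<Omega> w = (\<lambda>x. \<Sum>i\<in>UNIV. wderiv \<Omega> (mi_unit i) w x *\<^sub>R axis i 1)"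
    by (auto simp: wgrad_def vec_eq_iff axis_def if_distrib sum.delta' cong: if_cong)
  then have "wgrad \<Omega> w \<in> borel_measurable (lebesgue_on \<Omega>)"
    using L2 by (auto simp: L2_iff intro!: borel_measurable_sum borel_measurable_scaleR)
  moreover have "(norm (wgrad \<Omega> w x))\<^sup>2 = (\<Sum>i\<in>UNIV. (wderiv \<Omega> (mi_unit i) w x)\<^sup>2)" for x
    by (rule norm_wgrad_square)
  ultimately show ?thesis using L2 by (auto simp: L2_iff)
qed

text \<open>Subtract the two approximating sequences. Both convergences survive because squared
  norms of differences are at most twice the sum of the squared norms.\<close>

lemma has_trace_diff:
  fixes v w :: "real^'n \<Rightarrow> real"
  assumes \<Omega>: "open \<Omega>" "bounded \<Omega>" and v: "has_trace \<Omega> A v a" and w: "has_trace \<Omega> A w b"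
  shows "has_trace \<Omega> A (\<lambda>x. v x - w x) (\<lambda>x. a x - b x)"
proof -
  let ?M = "restrict_space surface_measure A"
  from v obtain \<phi> where \<phi>: "\<And>n. smooth (\<phi> n)"
    "(\<lambda>n. sobolev_norm_sq \<Omega> 1 (\<lambda>x. v x - \<phi> n x)) \<longlonglongrightarrow> 0"
    "(\<lambda>n. \<integral>\<^sup>+x. ennreal ((\<phi> n x - a x)\<^sup>2) \<partial>?M) \<longlonglongrightarrow> 0"
    unfolding has_trace_def by blast
  from w obtain \<psi> where \<psi>: "\<And>n. smooth (\<psi> n)"
    "(\<lambda>n. sobolev_norm_sq \<Omega> 1 (\<lambda>x. w x - \<psi> n x)) \<longlonglongrightarrow> 0"
    "(\<lambda>n. \<integral>\<^sup>+x. ennreal ((\<psi> n x - b x)\<^sup>2) \<partial>?M) \<longlonglongrightarrow> 0"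
    unfolding has_trace_def by blast
  have ab: "a \<in> borel_measurable ?M" "b \<in> borel_measurable ?M"
    using v w by (auto simp: has_trace_def)
  \<comment> \<open>\<open>measure_of\<close> yields the Borel sigma-algebra whatever set function
    it is given; this is all that the measurability of smooth functions depends on.\<close>
  have sets: "sets (surface_measure :: (real^'n) measure) = sets borel"
    unfolding surface_measure_def by (simp add: sets.sigma_sets_eq[of borel, simplified])
  have smooth_meas: "f \<in> borel_measurable ?M" if "smooth f" for f :: "real^'n \<Rightarrow> real"
  proof -
    have "f \<in> borel_measurable surface_measure"
      using smooth_dir_derivs_continuous[OF that, of "[]"] measurable_cong_sets[OF sets refl]
      by (auto intro: borel_measurable_continuous_onI)
    then show ?thesis by (rule measurable_restrict_space1)
  qed
  have lim: "f \<longlonglongrightarrow> 0" if "\<And>n. f n \<le> 2 * c n + 2 * d n" "c \<longlonglongrightarrow> 0" "d \<longlonglongrightarrow> 0"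
    for f c d :: "nat \<Rightarrow> ennreal"
  proof (rule tendsto_sandwich[of "\<lambda>_. 0"])
    have "(\<lambda>n. 2 * c n + 2 * d n) \<longlonglongrightarrow> 2 * 0 + 2 * 0"
      using that(2,3) by (intro tendsto_add ennreal_tendsto_cmult) auto
    then show "(\<lambda>n. 2 * c n + 2 * d n) \<longlonglongrightarrow> 0" by simp
  qed (use that(1) in auto)
  have "(\<lambda>n. sobolev_norm_sq \<Omega> 1 (\<lambda>x. (v x - w x) - (\<phi> n x - \<psi> n x))) \<longlonglongrightarrow> 0"
  proof (rule lim[OF _ \<phi>(2) \<psi>(2)])
    fix n
    have "(\<lambda>x. (v x - w x) - (\<phi> n x - \<psi> n x)) = (\<lambda>x. (v x - \<phi> n x) - (w x - \<psi> n x))" by auto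
    then show "sobolev_norm_sq \<Omega> 1 (\<lambda>x. (v x - w x) - (\<phi> n x - \<psi> n x))
      \<le> 2 * sobolev_norm_sq \<Omega> 1 (\<lambda>x. v x - \<phi> n x) + 2 * sobolev_norm_sq \<Omega> 1 (\<lambda>x. w x - \<psi> n x)"
      using sobolev_norm_sq_1_diff_le[OF \<Omega>, of "\<lambda>x. v x - \<phi> n x" "\<lambda>x. w x - \<psi> n x"]
      by (simp only:)
  qed
  moreover have "(\<lambda>n. \<integral>\<^sup>+x. ennreal (((\<phi> n x - \<psi> n x) - (a x - b x))\<^sup>2) \<partial>?M) \<longlonglongrightarrow> 0"
  proof (rule lim[OF _ \<phi>(3) \<psi>(3)])
    fix n
    have "(\<integral>\<^sup>+x. ennreal (((\<phi> n x - \<psi> n x) - (a x - b x))\<^sup>2) \<partial>?M)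
        \<le> (\<integral>\<^sup>+x. 2 * ennreal ((\<phi> n x - a x)\<^sup>2) + 2 * ennreal ((\<psi> n x - b x)\<^sup>2) \<partial>?M)"
    proof (rule nn_integral_mono)
      fix x
      have "((\<phi> n x - \<psi> n x) - (a x - b x))\<^sup>2 \<le> 2 * (\<phi> n x - a x)\<^sup>2 + 2 * (\<psi> n x - b x)\<^sup>2"
        using norm_diff_square_le[of "\<phi> n x - a x" "\<psi> n x - b x"] by (simp add: algebra_simps)
      then have "ennreal (((\<phi> n x - \<psi> n x) - (a x - b x))\<^sup>2)
          \<le> ennreal (2 * (\<phi> n x - a x)\<^sup>2 + 2 * (\<psi> n x - b x)\<^sup>2)" by (rule ennreal_leI)
      then show "ennreal (((\<phi> n x - \<psi> n x) - (a x - b x))\<^sup>2)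
          \<le> 2 * ennreal ((\<phi> n x - a x)\<^sup>2) + 2 * ennreal ((\<psi> n x - b x)\<^sup>2)"
        by (simp add: ennreal_plus ennreal_mult)
    qed
    also have "\<dots> = 2 * (\<integral>\<^sup>+x. ennreal ((\<phi> n x - a x)\<^sup>2) \<partial>?M) + 2 * (\<integral>\<^sup>+x. ennreal ((\<psi> n x - b x)\<^sup>2) \<partial>?M)"
      using ab smooth_meas[OF \<phi>(1)] smooth_meas[OF \<psi>(1)]
      by (subst nn_integral_add) (auto simp: nn_integral_cmult)
    finally show "(\<integral>\<^sup>+x. ennreal (((\<phi> n x - \<psi> n x) - (a x - b x))\<^sup>2) \<partial>?M) \<le> \<dots>" .
  qed
  moreover have "(\<lambda>x. v x - w x) \<in> sobolev_space \<Omega> 1"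
    using v w sobolev_1_diff[OF \<Omega>] by (auto simp: has_trace_def)
  ultimately show ?thesis
    unfolding has_trace_def using ab \<phi>(1) \<psi>(1)
    by (intro conjI exI[of _ "\<lambda>n x. \<phi> n x - \<psi> n x"]) (auto intro: smooth_diff)
qed

section \<open>Time integrals\<close>

lemma integrable_lebesgue_on_initial:
  fixes f :: "real \<Rightarrow> 'b::euclidean_space"
  assumes "integrable (lebesgue_on {0..T}) f" "t \<le> T"
  shows "integrable (lebesgue_on {0..t}) f"
proof -
  have "set_integrable lebesgue {0..T} f"
    using assms(1) by (simp add: integrable_restrict_space set_integrable_def)
  then have "set_integrable lebesgue {0..t} f"
    by (rule set_integrable_subset) (use assms(2) in auto)
  then show ?thesis by (simp add: integrable_restrict_space set_integrable_def)
qed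

text \<open>Trades the moving interval for a cut-off integrand over a fixed measure, so that
  measurability in \<open>t\<close> and Fubini can be argued on a product space.\<close>

lemma integral_lebesgue_on_initial:
  fixes f :: "real \<Rightarrow> 'b::euclidean_space"
  assumes "t \<le> T"
  shows "(\<integral>s. (if s \<le> t then f s else 0) \<partial>lebesgue_on {0..T}) = (\<integral>s. f s \<partial>lebesgue_on {0..t})"
proof -
  have "indicator {0..T} s *\<^sub>R (if s \<le> t then f s else 0) = indicator {0..t} s *\<^sub>R f s" for s
    using assms by (auto simp: indicator_def)
  then show ?thesis by (simp add: integral_restrict_space)
qed

lemma continuous_on_matrix_vector_mult_Pair:
  "continuous_on UNIV (\<lambda>p :: (real^'n^'m) \<times> (real^'n). fst p *v snd p)"
  unfolding matrix_vector_mult_def by (intro continuous_intros)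

lemma borel_measurable_matrix_vector_mult:
  fixes A :: "'a \<Rightarrow> real^'n^'m"
  assumes "A \<in> borel_measurable M" "g \<in> borel_measurable M"
  shows "(\<lambda>x. A x *v g x) \<in> borel_measurable M"
  using assms by (rule borel_measurable_continuous_Pair) (rule continuous_on_matrix_vector_mult_Pair)

text \<open>Formally \<open>W \<bullet> (A *v W)\<close> has the derivative
  \<open>2 * (W \<bullet> (A *v g))\<close>, with \<open>W\<close> the primitive of
  \<open>g\<close>. As \<open>g\<close> is only integrable, Fubini on the square takes the place of
  the product rule.\<close>

lemma quadratic_form_integral:
  fixes g :: "real \<Rightarrow> real^'n" and A :: "real^'n^'n"
  assumes sym: "transpose A = A" and g: "integrable (lebesgue_on {0..t}) g"
  shows "(\<integral>s. g s \<partial>lebesgue_on {0..t}) \<bullet> (A *v (\<integral>s. g s \<partial>lebesgue_on {0..t}))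
    = 2 * (\<integral>s. (\<integral>r. g r \<partial>lebesgue_on {0..s}) \<bullet> (A *v g s) \<partial>lebesgue_on {0..t})"
proof -
  let ?\<mu> = "lebesgue_on {0..t}"
  interpret finite_measure ?\<mu> by (rule finite_measure_lebesgue_on) simp
  interpret P: pair_sigma_finite ?\<mu> ?\<mu> ..
  have gm[measurable]: "g \<in> borel_measurable ?\<mu>" using g by simp
  have idm[measurable]: "(\<lambda>s. s) \<in> borel_measurable ?\<mu>"
    using id_borel_measurable_lebesgue_on[of "{0..t}"] by (simp add: id_def)
  \<comment> \<open>The integrand on the square is symmetric, so each of the two triangles carries half of it.\<close>
  define W where "W s = (\<integral>r. g r \<partial>lebesgue_on {0..s})" for s
  define H where "H s r = g s \<bullet> (A *v g r)" for s r
  define H1 where "H1 s r = (if s \<le> r then H s r else 0)" for s r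
  define H2 where "H2 s r = (if r < s then H s r else 0)" for s r
  have Agm: "(\<lambda>r. A *v g r) \<in> borel_measurable ?\<mu>"
    by (intro borel_measurable_matrix_vector_mult) auto
  have Hm[measurable]: "case_prod H \<in> borel_measurable (?\<mu> \<Otimes>\<^sub>M ?\<mu>)"
    unfolding H_def case_prod_beta
    using measurable_compose[OF measurable_snd Agm] by (intro borel_measurable_inner) auto
  have bound: "norm (H s r) \<le> onorm ((*v) A) * (norm (g s) * norm (g r))" for s r
  proof -
    have "norm (H s r) \<le> norm (g s) * norm (A *v g r)" unfolding H_def
      using Cauchy_Schwarz_ineq2 by simp
    also have "\<dots> \<le> norm (g s) * (onorm ((*v) A) * norm (g r))"
      by (intro mult_left_mono onorm) auto
    finally show ?thesis by (simp add: mult_ac)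
  qed
  have "integrable (?\<mu> \<Otimes>\<^sub>M ?\<mu>) (\<lambda>z. norm (g (fst z)) * norm (g (snd z)))"
    by (rule P.Fubini_integrable) (use g in auto)
  then have dom: "integrable (?\<mu> \<Otimes>\<^sub>M ?\<mu>) (\<lambda>z. onorm ((*v) A) * (norm (g (fst z)) * norm (g (snd z))))"
    by simp
  have int: "integrable (?\<mu> \<Otimes>\<^sub>M ?\<mu>) (case_prod K)"
    if [measurable]: "case_prod K \<in> borel_measurable (?\<mu> \<Otimes>\<^sub>M ?\<mu>)"
      and "\<And>s r. norm (K s r) \<le> norm (H s r)" for K :: "real \<Rightarrow> real \<Rightarrow> real"
    by (rule Bochner_Integration.integrable_bound[OF dom])
      (use that bound order_trans[OF that(2) bound] in \<open>auto intro!: AE_I2 intro: order_trans[OF _ abs_ge_self]\<close>)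
  have iH: "integrable (?\<mu> \<Otimes>\<^sub>M ?\<mu>) (case_prod H)" by (rule int) auto
  have iH1: "integrable (?\<mu> \<Otimes>\<^sub>M ?\<mu>) (case_prod H1)"
    by (rule int) (unfold H1_def case_prod_beta, use Hm in \<open>auto simp: case_prod_beta\<close>)
  have iH2: "integrable (?\<mu> \<Otimes>\<^sub>M ?\<mu>) (case_prod H2)"
    by (rule int) (unfold H2_def case_prod_beta, use Hm in \<open>auto simp: case_prod_beta\<close>)
  have lin: "bounded_linear (\<lambda>v. w \<bullet> (A *v v))" for w
    by (intro bounded_linear_inner_right_comp matrix_vector_mul_bounded_linear)
  have int_inner: "(\<integral>r. w \<bullet> (A *v g r) \<partial>lebesgue_on {0..s}) = w \<bullet> (A *v W s)" if "s \<le> t" for w s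
    unfolding W_def using integral_bounded_linear[OF lin integrable_lebesgue_on_initial[OF g that]] by simp
  have "W t \<bullet> (A *v W t) = (\<integral>s. (\<integral>r. H s r \<partial>?\<mu>) \<partial>?\<mu>)"
    using int_inner[OF order.refl] symmetric_inner_commute[OF sym] by (simp add: H_def)
  also have "\<dots> = integral\<^sup>L (?\<mu> \<Otimes>\<^sub>M ?\<mu>) (case_prod H)" by (rule P.integral_fst[OF iH])
  also have "case_prod H = (\<lambda>z. case_prod H1 z + case_prod H2 z)"
    by (auto simp: H1_def H2_def)
  also have "integral\<^sup>L (?\<mu> \<Otimes>\<^sub>M ?\<mu>) \<dots> = (\<integral>r. (\<integral>s. H1 s r \<partial>?\<mu>) \<partial>?\<mu>) + (\<integral>s. (\<integral>r. H2 s r \<partial>?\<mu>) \<partial>?\<mu>)"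
    using iH1 iH2 by (simp add: P.integral_fst P.integral_snd)
  also have "(\<integral>r. (\<integral>s. H1 s r \<partial>?\<mu>) \<partial>?\<mu>) = (\<integral>s. W s \<bullet> (A *v g s) \<partial>?\<mu>)"
  proof (intro Bochner_Integration.integral_cong refl)
    fix r assume "r \<in> space ?\<mu>"
    then have "(\<integral>s. H1 s r \<partial>?\<mu>) = (\<integral>s. H s r \<partial>lebesgue_on {0..r})"
      unfolding H1_def by (intro integral_lebesgue_on_initial) simp
    also have "\<dots> = (\<integral>s. g r \<bullet> (A *v g s) \<partial>lebesgue_on {0..r})"
      unfolding H_def by (intro Bochner_Integration.integral_cong refl symmetric_inner_commute[OF sym])
    also have "\<dots> = g r \<bullet> (A *v W r)" using \<open>r \<in> space ?\<mu>\<close> by (intro int_inner) simp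
    also have "\<dots> = W r \<bullet> (A *v g r)" by (rule symmetric_inner_commute[OF sym])
    finally show "(\<integral>s. H1 s r \<partial>?\<mu>) = W r \<bullet> (A *v g r)" .
  qed
  also have "(\<integral>s. (\<integral>r. H2 s r \<partial>?\<mu>) \<partial>?\<mu>) = (\<integral>s. W s \<bullet> (A *v g s) \<partial>?\<mu>)"
  proof (intro Bochner_Integration.integral_cong refl)
    fix s assume s: "s \<in> space ?\<mu>"
    \<comment> \<open>The diagonal was assigned to \<open>H1\<close>. Adding it to \<open>H2\<close>
      changes each section on a null set only and makes the inner integral one over
      \<open>{0..s}\<close>.\<close>
    have "AE r in lebesgue. r \<noteq> s" by (rule AE_I'[of "{s}"]) auto
    then have "AE r in ?\<mu>. r \<noteq> s" by (auto simp: AE_restrict_space_iff)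
    then have "(\<integral>r. H2 s r \<partial>?\<mu>) = (\<integral>r. (if r \<le> s then H s r else 0) \<partial>?\<mu>)"
    proof (intro integral_cong_AE)
      show "H2 s \<in> borel_measurable ?\<mu>"
        using measurable_Pair2[OF borel_measurable_integrable[OF iH2] s] by simp
      show "(\<lambda>r. if r \<le> s then H s r else 0) \<in> borel_measurable ?\<mu>"
        proof -
        have [measurable]: "H s \<in> borel_measurable ?\<mu>" using measurable_Pair2[OF Hm s] by simp
        show ?thesis by measurable
      qed
    qed (auto simp: H2_def elim: eventually_mono)
    also have "\<dots> = (\<integral>r. H s r \<partial>lebesgue_on {0..s})"
      using s by (intro integral_lebesgue_on_initial) simp
    also have "\<dots> = g s \<bullet> (A *v W s)"
      unfolding H_def using s by (intro int_inner) simp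
    also have "\<dots> = W s \<bullet> (A *v g s)" by (rule symmetric_inner_commute[OF sym])
    finally show "(\<integral>r. H2 s r \<partial>?\<mu>) = W s \<bullet> (A *v g s)" .
  qed
  finally show ?thesis by (simp add: W_def)
qed

text \<open>Cauchy-Schwarz against the constant 1, obtained by integrating the square of
  \<open>m * norm (g s) - a\<close>, that is, from the nonnegativity of a variance. The case
  \<open>m = 0\<close> is separate, as the factor \<open>m\<close> must be cancelled.\<close>

lemma norm_integral_square_le:
  fixes g :: "'a \<Rightarrow> 'b::euclidean_space"
  assumes "finite_measure M" "g \<in> borel_measurable M" "integrable M (\<lambda>s. (norm (g s))\<^sup>2)"
  shows "(\<integral>s. norm (g s) \<partial>M)\<^sup>2 \<le> measure M (space M) * (\<integral>s. (norm (g s))\<^sup>2 \<partial>M)"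
    and "integrable M g"
proof -
  interpret finite_measure M by fact
  \<comment> \<open>On a finite measure this makes every square integrable function
    integrable.\<close>
  have bound: "norm (g s) \<le> norm (1 + (norm (g s))\<^sup>2)" for s
    using sum_squares_bound[of 1 "norm (g s)"] zero_le_power2[of "norm (g s)"]
    unfolding one_power2 real_norm_def by linarith
  have "integrable M (\<lambda>s. 1 + (norm (g s))\<^sup>2)"
    using assms(3) by (intro Bochner_Integration.integrable_add) auto
  then show g: "integrable M g"
    by (rule Bochner_Integration.integrable_bound) (use assms(2) bound in blast)+
  define m where "m = measure M (space M)"
  define a where "a = (\<integral>s. norm (g s) \<partial>M)"
  show "a\<^sup>2 \<le> m * (\<integral>s. (norm (g s))\<^sup>2 \<partial>M)"
  proof -
    have "0 \<le> (\<integral>s. (m * norm (g s) - a)\<^sup>2 \<partial>M)" by simp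
    also have "\<dots> = (\<integral>s. m\<^sup>2 * (norm (g s))\<^sup>2 - 2 * m * a * norm (g s) + a\<^sup>2 \<partial>M)"
      by (simp add: power2_diff power_mult_distrib algebra_simps)
    also have "\<dots> = m\<^sup>2 * (\<integral>s. (norm (g s))\<^sup>2 \<partial>M) - 2 * m * a * a + m * a\<^sup>2"
      using g assms(3) by (simp add: m_def a_def)
    also have "\<dots> = m * (m * (\<integral>s. (norm (g s))\<^sup>2 \<partial>M) - a\<^sup>2)"
      by (simp add: algebra_simps power2_eq_square)
    finally have *: "0 \<le> m * (m * (\<integral>s. (norm (g s))\<^sup>2 \<partial>M) - a\<^sup>2)" .
    show ?thesis
    proof (cases "m = 0")
      case True
      then have "emeasure M (space M) = 0" by (simp add: m_def emeasure_eq_measure)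
      then have "a = 0" unfolding a_def
        by (intro integral_eq_zero_AE AE_I[of _ _ "space M"]) auto
      then show ?thesis using True by simp
    next
      case False
      then have "m > 0" by (simp add: m_def zero_less_measure_iff measure_nonneg order_less_le)
      with * show ?thesis by (simp add: zero_le_mult_iff)
    qed
  qed
qed

lemma is_weak_deriv_vec_unique:
  assumes \<Omega>: "open \<Omega>" "bounded \<Omega>"
    and "\<And>i. is_weak_deriv \<Omega> (mi_unit i) w (\<lambda>x. F x $ i)" "\<And>i. is_weak_deriv \<Omega> (mi_unit i) w (\<lambda>x. G x $ i)"
  shows "AE x in lebesgue_on \<Omega>. F x = G x"
proof -
  have "AE x in lebesgue_on \<Omega>. \<forall>i\<in>UNIV. F x $ i = G x $ i"
    using is_weak_deriv_unique[OF \<Omega> assms(3,4)] by (intro eventually_ball_finite) auto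
  then show ?thesis by (auto simp: vec_eq_iff elim: eventually_mono)
qed

lemma L2_matrix_mult:
  fixes F :: "real^'n \<Rightarrow> real^'k" and A :: "real^'n \<Rightarrow> real^'k^'m"
  assumes "F \<in> L2 \<Omega>" "A \<in> borel_measurable (lebesgue_on \<Omega>)" "\<And>x. x \<in> \<Omega> \<Longrightarrow> onorm ((*v) (A x)) \<le> B"
  shows "(\<lambda>x. A x *v F x) \<in> L2 \<Omega>"
proof (rule L2_dominated[OF _ assms(1)])
  show "(\<lambda>x. A x *v F x) \<in> borel_measurable (lebesgue_on \<Omega>)"
    using assms(2) L2_measurable[OF assms(1)] by (rule borel_measurable_matrix_vector_mult)
  have "norm (A x *v F x) \<le> B * norm (F x)" if "x \<in> \<Omega>" for x
    using onorm[of "(*v) (A x)" "F x"] mult_right_mono[OF assms(3)[OF that] norm_ge_zero[of "F x"]] by simp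
  then show "AE x in lebesgue_on \<Omega>. norm (A x *v F x) \<le> B * norm (F x)" by (intro AE_I2) simp
qed

lemma L2_inner:
  assumes "F \<in> L2 \<Omega>" "u \<in> borel_measurable (lebesgue_on \<Omega>)" "\<And>x. x \<in> \<Omega> \<Longrightarrow> norm (u x) \<le> B"
  shows "(\<lambda>x. u x \<bullet> F x) \<in> L2 \<Omega>"
proof (rule L2_dominated[OF _ assms(1)])
  show "(\<lambda>x. u x \<bullet> F x) \<in> borel_measurable (lebesgue_on \<Omega>)"
    using assms(2) L2_measurable[OF assms(1)] by (rule borel_measurable_inner)
  have "norm (u x \<bullet> F x) \<le> B * norm (F x)" if "x \<in> \<Omega>" for x
    using Cauchy_Schwarz_ineq2[of "u x" "F x"] mult_right_mono[OF assms(3)[OF that] norm_ge_zero[of "F x"]] by simp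
  then show "AE x in lebesgue_on \<Omega>. norm (u x \<bullet> F x) \<le> B * norm (F x)" by (intro AE_I2) simp
qed

text \<open>Subtracts the two variational problems term by term. \<open>H\<close> stands for a
  quantity built from the error itself, which matches the difference only almost everywhere.\<close>

lemma l2_inner_diff:
  assumes "F \<in> L2 \<Omega>" "G \<in> L2 \<Omega>" "H \<in> L2 \<Omega>" "v \<in> L2 \<Omega>" and eq: "AE x in lebesgue_on \<Omega>. H x = F x - G x"
  shows "l2_inner \<Omega> F v - l2_inner \<Omega> G v = (\<integral>x. H x \<bullet> v x \<partial>lebesgue_on \<Omega>)"
proof -
  have "l2_inner \<Omega> F v - l2_inner \<Omega> G v = (\<integral>x. F x \<bullet> v x - G x \<bullet> v x \<partial>lebesgue_on \<Omega>)"
    unfolding l2_inner_def using assms by (intro Bochner_Integration.integral_diff[symmetric] L2_inner_integrable)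
  also have "\<dots> = (\<integral>x. H x \<bullet> v x \<partial>lebesgue_on \<Omega>)"
  proof (rule integral_cong_AE)
    show "AE x in lebesgue_on \<Omega>. F x \<bullet> v x - G x \<bullet> v x = H x \<bullet> v x"
      using eq by eventually_elim (simp add: inner_diff_left)
  qed (use assms in \<open>auto intro!: borel_measurable_integrable L2_inner_integrable\<close>)
  finally show ?thesis .
qed

section \<open>Functions on the space-time cylinder\<close>

locale time_cylinder =
  fixes T :: real and \<Omega> :: "(real^'n) set"
  assumes T_pos: "T > 0" and \<Omega>_lmeasurable: "\<Omega> \<in> lmeasurable"
begin

abbreviation "I \<equiv> lebesgue_on {0..T}"
abbreviation "M \<equiv> lebesgue_on \<Omega>"

sublocale I: finite_measure I by (rule finite_measure_lebesgue_on) simp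
sublocale M: finite_measure M by (rule finite_measure_lebesgue_on[OF \<Omega>_lmeasurable])
sublocale IM: pair_sigma_finite I M ..

lemma time_measurable: "(\<lambda>s. s) \<in> borel_measurable I"
  using id_borel_measurable_lebesgue_on[of "{0..T}"] by (simp add: id_def)

lemma L2_time_iff:
  "F \<in> L2_time T \<Omega> \<longleftrightarrow> (\<lambda>z. F (fst z) (snd z)) \<in> borel_measurable (I \<Otimes>\<^sub>M M) \<and>
     integrable (I \<Otimes>\<^sub>M M) (\<lambda>z. (norm (F (fst z) (snd z)))\<^sup>2)"
  by (auto simp: L2_time_def integrable_iff_bounded)

lemma L2_time_integrable:
  "F \<in> L2_time T \<Omega> \<Longrightarrow> integrable (I \<Otimes>\<^sub>M M) (case_prod (\<lambda>t x. (norm (F t x))\<^sup>2))"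
  unfolding case_prod_beta' by (simp add: L2_time_iff)

lemma L2_time_measurable:
  "F \<in> L2_time T \<Omega> \<Longrightarrow> (\<lambda>z. F (fst z) (snd z)) \<in> borel_measurable (I \<Otimes>\<^sub>M M)"
  by (simp add: L2_time_iff)

lemma L2_time_dominated:
  assumes "F \<in> L2_time T \<Omega>" "(\<lambda>z. G (fst z) (snd z)) \<in> borel_measurable (I \<Otimes>\<^sub>M M)"
    and "\<And>t x. x \<in> \<Omega> \<Longrightarrow> norm (G t x) \<le> c * norm (F t x)"
  shows "G \<in> L2_time T \<Omega>"
  unfolding L2_time_iff
proof
  show "integrable (I \<Otimes>\<^sub>M M) (\<lambda>z. (norm (G (fst z) (snd z)))\<^sup>2)"
  proof (rule Bochner_Integration.integrable_bound)
    show "integrable (I \<Otimes>\<^sub>M M) (\<lambda>z. c\<^sup>2 * (norm (F (fst z) (snd z)))\<^sup>2)"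
      using assms(1) by (simp add: L2_time_iff)
    have "(norm (G t x))\<^sup>2 \<le> c\<^sup>2 * (norm (F t x))\<^sup>2" if "x \<in> \<Omega>" for t x
      using power_mono[OF assms(3)[OF that], of t 2] by (simp add: power_mult_distrib)
    then show "AE z in I \<Otimes>\<^sub>M M. norm ((norm (G (fst z) (snd z)))\<^sup>2)
        \<le> norm (c\<^sup>2 * (norm (F (fst z) (snd z)))\<^sup>2)"
      by (intro AE_I2) (auto simp: space_pair_measure)
  qed (use assms(2) in measurable)
qed (rule assms(2))

lemma L2_time_diff:
  assumes "F \<in> L2_time T \<Omega>" "G \<in> L2_time T \<Omega>" shows "(\<lambda>t x. F t x - G t x) \<in> L2_time T \<Omega>"
  unfolding L2_time_iff
proof
  show m: "(\<lambda>z. F (fst z) (snd z) - G (fst z) (snd z)) \<in> borel_measurable (I \<Otimes>\<^sub>M M)"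
    using assms by (intro borel_measurable_diff) (auto simp: L2_time_iff)
  show "integrable (I \<Otimes>\<^sub>M M) (\<lambda>z. (norm (F (fst z) (snd z) - G (fst z) (snd z)))\<^sup>2)"
    by (rule Bochner_Integration.integrable_bound
        [of _ "\<lambda>z. 2 * (norm (F (fst z) (snd z)))\<^sup>2 + 2 * (norm (G (fst z) (snd z)))\<^sup>2"])
      (use assms m in \<open>auto simp: L2_time_iff norm_diff_square_le\<close>)
qed

lemma L2_time_matrix_mult:
  fixes F :: "real \<Rightarrow> real^'n \<Rightarrow> real^'k" and A :: "real^'n \<Rightarrow> real^'k^'m"
  assumes "F \<in> L2_time T \<Omega>" "A \<in> borel_measurable M" "\<And>x. x \<in> \<Omega> \<Longrightarrow> onorm ((*v) (A x)) \<le> B"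
  shows "(\<lambda>t x. A x *v F t x) \<in> L2_time T \<Omega>"
proof (rule L2_time_dominated[OF assms(1)])
  show "(\<lambda>z. A (snd z) *v F (fst z) (snd z)) \<in> borel_measurable (I \<Otimes>\<^sub>M M)"
    by (intro borel_measurable_matrix_vector_mult measurable_compose[OF measurable_snd assms(2)]
        L2_time_measurable[OF assms(1)])
  show "norm (A x *v F t x) \<le> B * norm (F t x)" if "x \<in> \<Omega>" for t x
    using onorm[of "(*v) (A x)" "F t x"] mult_right_mono[OF assms(3)[OF that] norm_ge_zero[of "F t x"]]
    by simp
qed

lemma L2_time_inner:
  assumes "F \<in> L2_time T \<Omega>" "u \<in> borel_measurable M" "\<And>x. x \<in> \<Omega> \<Longrightarrow> norm (u x) \<le> B"
  shows "(\<lambda>t x. u x \<bullet> F t x) \<in> L2_time T \<Omega>"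
proof (rule L2_time_dominated[OF assms(1)])
  show "(\<lambda>z. u (snd z) \<bullet> F (fst z) (snd z)) \<in> borel_measurable (I \<Otimes>\<^sub>M M)"
    by (intro borel_measurable_inner measurable_compose[OF measurable_snd assms(2)]
        L2_time_measurable[OF assms(1)])
  show "norm (u x \<bullet> F t x) \<le> B * norm (F t x)" if "x \<in> \<Omega>" for t x
    using Cauchy_Schwarz_ineq2[of "u x" "F t x"] mult_right_mono[OF assms(3)[OF that] norm_ge_zero[of "F t x"]]
    by simp
qed

lemma L2_time_inner_integrable:
  assumes "F \<in> L2_time T \<Omega>" "H \<in> L2_time T \<Omega>"
  shows "integrable (I \<Otimes>\<^sub>M M) (case_prod (\<lambda>t x. F t x \<bullet> H t x))"
    and "integrable I (\<lambda>t. \<integral>x. F t x \<bullet> H t x \<partial>M)"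
proof -
  have "(\<lambda>z. F (fst z) (snd z) \<bullet> H (fst z) (snd z)) \<in> borel_measurable (I \<Otimes>\<^sub>M M)"
    using assms by (intro borel_measurable_inner L2_time_measurable)
  then show int: "integrable (I \<Otimes>\<^sub>M M) (case_prod (\<lambda>t x. F t x \<bullet> H t x))"
    unfolding case_prod_beta'
    by (rule Bochner_Integration.integrable_bound[rotated,
          of _ _ "\<lambda>z. (norm (F (fst z) (snd z)))\<^sup>2 + (norm (H (fst z) (snd z)))\<^sup>2"])
      (use assms in \<open>auto simp: L2_time_iff abs_inner_le_squares\<close>)
  show "integrable I (\<lambda>t. \<integral>x. F t x \<bullet> H t x \<partial>M)" by (rule IM.integrable_fst[OF int])
qed

lemma L2_time_slice:
  assumes "F \<in> L2_time T \<Omega>" shows "AE t in I. F t \<in> L2 \<Omega>"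
proof -
  have "AE t in I. integrable M (\<lambda>x. (norm (F t x))\<^sup>2)"
    using IM.AE_integrable_fst'[of "\<lambda>z. (norm (F (fst z) (snd z)))\<^sup>2"] assms by (simp add: L2_time_iff)
  then show ?thesis
    by (rule AE_mp) (use measurable_Pair2[OF L2_time_measurable[OF assms]] in \<open>auto simp: L2_iff\<close>)
qed

text \<open>Fubini yields one null set of points \<open>x\<close>; outside it the time section is
  square integrable on a bounded interval, hence integrable. This single null set then serves all
  times.\<close>

lemma L2_time_integrable_sections:
  assumes "F \<in> L2_time T \<Omega>"
  shows "AE x in M. integrable I (\<lambda>s. (norm (F s x))\<^sup>2) \<and> integrable I (\<lambda>s. F s x)"
proof -
  have "AE x in M. integrable I (\<lambda>s. (norm (F s x))\<^sup>2)"
    by (rule IM.AE_integrable_snd[OF L2_time_integrable[OF assms]])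
  moreover have "(\<lambda>s. F s x) \<in> borel_measurable I" if "x \<in> \<Omega>" for x
    using measurable_Pair1[OF L2_time_measurable[OF assms]] that by simp
  ultimately show ?thesis
    using AE_space
  proof (elim eventually_elim2)
    fix x assume "integrable I (\<lambda>s. (norm (F s x))\<^sup>2)" "x \<in> space M"
      and "\<And>x. x \<in> \<Omega> \<Longrightarrow> (\<lambda>s. F s x) \<in> borel_measurable I"
    then show "integrable I (\<lambda>s. (norm (F s x))\<^sup>2) \<and> integrable I (\<lambda>s. F s x)"
      using norm_integral_square_le(2)[OF I.finite_measure_axioms, of "\<lambda>s. F s x"] by simp
  qed
qed

text \<open>With the cut-off \<open>s \<le> t\<close> inside the integrand, \<open>t\<close> becomes
  a parameter of an integral over a fixed measure, and measurability of parameter integrals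
  applies.\<close>

lemma time_integral_measurable:
  assumes F: "(\<lambda>z. F (fst z) (snd z)) \<in> borel_measurable (I \<Otimes>\<^sub>M M)"
  shows "(\<lambda>z. time_integral (fst z) F (snd z)) \<in> borel_measurable (I \<Otimes>\<^sub>M M)"
proof -
  note time_measurable[measurable]
  have "(\<lambda>w. (snd w, snd (fst w))) \<in> measurable ((I \<Otimes>\<^sub>M M) \<Otimes>\<^sub>M I) (I \<Otimes>\<^sub>M M)" by measurable
  from measurable_compose[OF this F]
  have F'[measurable]: "(\<lambda>w. F (snd w) (snd (fst w))) \<in> borel_measurable ((I \<Otimes>\<^sub>M M) \<Otimes>\<^sub>M I)" by simp
  have [measurable]: "(\<lambda>w. snd w) \<in> borel_measurable ((I \<Otimes>\<^sub>M M) \<Otimes>\<^sub>M I)"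
    "(\<lambda>w. fst (fst w)) \<in> borel_measurable ((I \<Otimes>\<^sub>M M) \<Otimes>\<^sub>M I)"
    by (auto intro: measurable_compose[OF _ time_measurable])
  have "(\<lambda>(z, s). if s \<le> fst z then F s (snd z) else 0) \<in> borel_measurable ((I \<Otimes>\<^sub>M M) \<Otimes>\<^sub>M I)"
    unfolding case_prod_beta by measurable
  then have "(\<lambda>z. \<integral>s. (if s \<le> fst z then F s (snd z) else 0) \<partial>I) \<in> borel_measurable (I \<Otimes>\<^sub>M M)"
    by (rule I.borel_measurable_lebesgue_integral)
  then show ?thesis
    by (rule measurable_cong[THEN iffD1, rotated])
      (auto simp: time_integral_def space_pair_measure integral_lebesgue_on_initial)
qed

text \<open>Cauchy-Schwarz in time. The majorant is free of \<open>t\<close>, so it dominates at a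
  fixed time as well as on the whole cylinder.\<close>

lemma time_integral_square_le:
  assumes F: "F \<in> L2_time T \<Omega>"
  shows "AE x in M. \<forall>t\<in>{0..T}. (norm (time_integral t F x))\<^sup>2 \<le> T * (\<integral>s. (norm (F s x))\<^sup>2 \<partial>I)"
  using L2_time_integrable_sections[OF F]
proof eventually_elim
  case (elim x)
  show ?case
  proof
    fix t assume t: "t \<in> {0..T}"
    have "norm (time_integral t F x) \<le> (\<integral>s. norm (F s x) \<partial>lebesgue_on {0..t})"
      unfolding time_integral_def by (rule integral_norm_bound)
    also have "\<dots> = (\<integral>s. (if s \<le> t then norm (F s x) else 0) \<partial>I)"
      using t by (simp add: integral_lebesgue_on_initial)
    also have "\<dots> \<le> (\<integral>s. norm (F s x) \<partial>I)"
      using elim by (intro Bochner_Integration.integral_mono_AE') auto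
    finally have "(norm (time_integral t F x))\<^sup>2 \<le> (\<integral>s. norm (F s x) \<partial>I)\<^sup>2"
      by (intro power_mono) auto
    also have "\<dots> \<le> measure I (space I) * (\<integral>s. (norm (F s x))\<^sup>2 \<partial>I)"
      using elim by (intro norm_integral_square_le(1)[OF I.finite_measure_axioms]) auto
    also have "measure I (space I) = T" using T_pos by (simp add: measure_restrict_space)
    finally show "(norm (time_integral t F x))\<^sup>2 \<le> T * (\<integral>s. (norm (F s x))\<^sup>2 \<partial>I)" .
  qed
qed

lemma integrable_time_sq_sections:
  assumes "F \<in> L2_time T \<Omega>"
  shows "integrable M (\<lambda>x. \<integral>s. (norm (F s x))\<^sup>2 \<partial>I)" "integrable I (\<lambda>t. \<integral>x. (norm (F t x))\<^sup>2 \<partial>M)"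
  by (rule IM.integrable_snd[OF L2_time_integrable[OF assms]] IM.integrable_fst[OF L2_time_integrable[OF assms]])+

lemma time_integral_L2:
  assumes F: "F \<in> L2_time T \<Omega>" and t: "t \<in> {0..T}"
  shows "time_integral t F \<in> L2 \<Omega>"
  unfolding L2_iff
proof
  show m: "time_integral t F \<in> borel_measurable M"
    using measurable_Pair2[OF time_integral_measurable[OF L2_time_measurable[OF F]], of t] t by simp
  show "integrable M (\<lambda>x. (norm (time_integral t F x))\<^sup>2)"
    by (rule Bochner_Integration.integrable_bound[OF integrable_mult_right[OF integrable_time_sq_sections(1)[OF F], of T]])
      (use m time_integral_square_le[OF F] t in \<open>auto elim!: eventually_mono intro: order_trans[OF _ abs_ge_self]\<close>)
qed

lemma time_integral_L2_time:
  assumes F: "F \<in> L2_time T \<Omega>"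
  shows "(\<lambda>t. time_integral t F) \<in> L2_time T \<Omega>"
  unfolding L2_time_iff
proof
  show m[measurable]: "(\<lambda>z. time_integral (fst z) F (snd z)) \<in> borel_measurable (I \<Otimes>\<^sub>M M)"
    by (rule time_integral_measurable[OF L2_time_measurable[OF F]])
  let ?b = "\<lambda>x. T * (\<integral>s. (norm (F s x))\<^sup>2 \<partial>I)"
  have b: "integrable M ?b" using integrable_time_sq_sections(1)[OF F] by simp
  then have bm[measurable]: "?b \<in> borel_measurable M" by (rule borel_measurable_integrable)
  have bz[measurable]: "(\<lambda>z. ?b (snd z)) \<in> borel_measurable (I \<Otimes>\<^sub>M M)"
    by (rule measurable_compose[OF measurable_snd bm])
  have int: "integrable (I \<Otimes>\<^sub>M M) (\<lambda>z. ?b (snd z))"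
    by (rule IM.Fubini_integrable[OF bz]) (use b in auto)
  have AE: "AE z in I \<Otimes>\<^sub>M M. (norm (time_integral (fst z) F (snd z)))\<^sup>2 \<le> ?b (snd z)"
  proof (rule IM.AE_pair_measure)
    show "AE t in I. AE x in M. (norm (time_integral (fst (t, x)) F (snd (t, x))))\<^sup>2 \<le> ?b (snd (t, x))"
    proof (rule AE_I2)
      fix t assume "t \<in> space I"
      with time_integral_square_le[OF F]
      show "AE x in M. (norm (time_integral (fst (t, x)) F (snd (t, x))))\<^sup>2 \<le> ?b (snd (t, x))"
        by (elim eventually_mono) simp
    qed
    show "{z \<in> space (I \<Otimes>\<^sub>M M). (norm (time_integral (fst z) F (snd z)))\<^sup>2 \<le> ?b (snd z)} \<in> sets (I \<Otimes>\<^sub>M M)"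
      by (intro borel_measurable_le bz) (use m in measurable)
  qed
  show "integrable (I \<Otimes>\<^sub>M M) (\<lambda>z. (norm (time_integral (fst z) F (snd z)))\<^sup>2)"
  proof (rule Bochner_Integration.integrable_bound[OF int])
    show "AE z in I \<Otimes>\<^sub>M M. norm ((norm (time_integral (fst z) F (snd z)))\<^sup>2) \<le> norm (?b (snd z))"
      using AE by (rule eventually_mono) (auto intro: order_trans[OF _ abs_ge_self])
  qed measurable
qed

text \<open>The linear map is pulled out along each time section, with \<open>x\<close> as a mere
  parameter. It is applied to the inner product with \<open>u x\<close> and to the matrices
  \<open>D x\<close> and \<open>pos_sqrt (D x)\<close>.\<close>

lemma time_integral_bounded_linear:
  assumes F: "F \<in> L2_time T \<Omega>" and L: "\<And>x. bounded_linear (L x)"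
  shows "AE x in M. \<forall>t\<in>{0..T}. time_integral t (\<lambda>s x. L x (F s x)) x = L x (time_integral t F x)"
  using L2_time_integrable_sections[OF F]
proof eventually_elim
  case (elim x)
  then have "integrable (lebesgue_on {0..t}) (\<lambda>s. F s x)" if "t \<in> {0..T}" for t
    using that by (auto intro: integrable_lebesgue_on_initial)
  then show ?case unfolding time_integral_def by (auto intro: integral_bounded_linear[OF L])
qed

text \<open>The hypothesis holds for almost all \<open>x\<close> at almost all times, but
  integrating in time at a fixed point needs the quantifiers in the other order.\<close>

lemma time_integral_diff:
  fixes F G H :: "real \<Rightarrow> real^'n \<Rightarrow> 'b::euclidean_space"
  assumes F: "F \<in> L2_time T \<Omega>" and G: "G \<in> L2_time T \<Omega>" and H: "H \<in> L2_time T \<Omega>"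
    and eq: "AE t in I. AE x in M. H t x = F t x - G t x"
  shows "AE x in M. \<forall>t\<in>{0..T}. time_integral t H x = time_integral t F x - time_integral t G x"
proof -
  have "AE x in M. AE t in I. H t x = F t x - G t x"
  proof (rule IM.AE_commute[THEN iffD1, OF _ eq])
    show "{z \<in> space (I \<Otimes>\<^sub>M M). H (fst z) (snd z) = F (fst z) (snd z) - G (fst z) (snd z)} \<in> sets (I \<Otimes>\<^sub>M M)"
    proof -
      \<comment> \<open>Exchanging the quantifiers asks for a measurable set of equality; it is
        presented as the zero set of a measurable norm.\<close>
      have [measurable]: "(\<lambda>z. norm (H (fst z) (snd z) - (F (fst z) (snd z) - G (fst z) (snd z)))) \<in> borel_measurable (I \<Otimes>\<^sub>M M)"
        using L2_time_measurable[OF L2_time_diff[OF H L2_time_diff[OF F G]]] by (rule measurable_compose[OF _ borel_measurable_norm])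
      have "{z \<in> space (I \<Otimes>\<^sub>M M). norm (H (fst z) (snd z) - (F (fst z) (snd z) - G (fst z) (snd z))) = 0} \<in> sets (I \<Otimes>\<^sub>M M)"
        by measurable
      then show ?thesis by simp
    qed
  qed
  with L2_time_integrable_sections[OF F] L2_time_integrable_sections[OF G] L2_time_integrable_sections[OF H]
  show ?thesis
  proof eventually_elim
    case (elim x)
    show ?case
    proof
      fix t assume t: "t \<in> {0..T}"
      have int: "integrable (lebesgue_on {0..t}) (\<lambda>s. K s x)" if "integrable I (\<lambda>s. K s x)"
        for K :: "real \<Rightarrow> real^'n \<Rightarrow> 'b"
        using that t by (auto intro: integrable_lebesgue_on_initial)
      have "AE s in lebesgue_on {0..t}. H s x = F s x - G s x"
        using elim(4) t by (auto simp: AE_restrict_space_iff elim!: eventually_mono)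
      then have "(\<integral>s. H s x \<partial>lebesgue_on {0..t}) = (\<integral>s. F s x - G s x \<partial>lebesgue_on {0..t})"
        using int elim by (intro integral_cong_AE) (auto intro: borel_measurable_integrable)
      also have "\<dots> = (\<integral>s. F s x \<partial>lebesgue_on {0..t}) - (\<integral>s. G s x \<partial>lebesgue_on {0..t})"
        using int elim by (intro Bochner_Integration.integral_diff) auto
      finally show "time_integral t H x = time_integral t F x - time_integral t G x"
        by (simp add: time_integral_def)
    qed
  qed
qed

text \<open>\<open>quadratic_form_integral\<close> at each point with the matrix \<open>D x\<close>,
  followed by an exchange of the integrals over \<open>x\<close> and time.\<close>

lemma energy_identity:
  fixes F :: "real \<Rightarrow> real^'n \<Rightarrow> real^'n" and D :: "real^'n \<Rightarrow> real^'n^'n"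
  assumes F: "F \<in> L2_time T \<Omega>" and D: "D \<in> borel_measurable M"
    and bound: "\<And>x. x \<in> \<Omega> \<Longrightarrow> onorm ((*v) (D x)) \<le> B"
    and sym: "\<And>x. x \<in> \<Omega> \<Longrightarrow> transpose (D x) = D x"
  shows "integrable I (\<lambda>t. \<integral>x. time_integral t F x \<bullet> (D x *v F t x) \<partial>M)"
    and "t \<in> {0..T} \<Longrightarrow> (\<integral>x. time_integral t F x \<bullet> (D x *v time_integral t F x) \<partial>M)
      = 2 * (\<integral>s. (\<integral>x. time_integral s F x \<bullet> (D x *v F s x) \<partial>M) \<partial>lebesgue_on {0..t})"
proof -
  define Q where "Q t x = time_integral t F x \<bullet> (D x *v F t x)" for t x
  have V: "(\<lambda>t. time_integral t F) \<in> L2_time T \<Omega>" by (rule time_integral_L2_time[OF F])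
  have DF: "(\<lambda>t x. D x *v F t x) \<in> L2_time T \<Omega>" by (rule L2_time_matrix_mult[OF F D bound])
  have Qi: "integrable (I \<Otimes>\<^sub>M M) (case_prod Q)"
    unfolding Q_def by (rule L2_time_inner_integrable(1)[OF V DF])
  have Qm: "(\<lambda>z. Q (fst z) (snd z)) \<in> borel_measurable (I \<Otimes>\<^sub>M M)"
    using borel_measurable_integrable[OF Qi] by (simp add: case_prod_beta')
  show "integrable I (\<lambda>t. \<integral>x. time_integral t F x \<bullet> (D x *v F t x) \<partial>M)"
    by (rule L2_time_inner_integrable(2)[OF V DF])
  assume t: "t \<in> {0..T}"
  \<comment> \<open>The cut-off lets Fubini act on the fixed cylinder instead of one of height
    \<open>t\<close>.\<close>
  define Qt where "Qt s x = (if s \<le> t then Q s x else 0)" for s x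
  have tm: "(\<lambda>z. fst z) \<in> borel_measurable (I \<Otimes>\<^sub>M M)"
    by (rule measurable_compose[OF measurable_fst time_measurable])
  have "(\<lambda>z. Qt (fst z) (snd z)) \<in> borel_measurable (I \<Otimes>\<^sub>M M)"
    unfolding Qt_def using Qm tm by (intro measurable_If borel_measurable_le) auto
  then have Qti: "integrable (I \<Otimes>\<^sub>M M) (case_prod Qt)"
    by (intro Bochner_Integration.integrable_bound[OF Qi]) (auto simp: Qt_def case_prod_beta')
  have "AE x in M. time_integral t F x \<bullet> (D x *v time_integral t F x) = 2 * (\<integral>s. Qt s x \<partial>I)"
    using L2_time_integrable_sections[OF F] AE_space
  proof eventually_elim
    case (elim x)
    then have "integrable (lebesgue_on {0..t}) (\<lambda>s. F s x)"
      using t by (auto intro: integrable_lebesgue_on_initial)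
    from quadratic_form_integral[OF sym this, of x] elim t
    show ?case by (simp add: time_integral_def Qt_def Q_def integral_lebesgue_on_initial)
  qed
  then have "(\<integral>x. time_integral t F x \<bullet> (D x *v time_integral t F x) \<partial>M) = (\<integral>x. 2 * (\<integral>s. Qt s x \<partial>I) \<partial>M)"
  proof (intro integral_cong_AE)
    show "(\<lambda>x. time_integral t F x \<bullet> (D x *v time_integral t F x)) \<in> borel_measurable M"
      using L2_measurable[OF time_integral_L2[OF F t]] D
      by (intro borel_measurable_inner borel_measurable_matrix_vector_mult)
    show "(\<lambda>x. 2 * (\<integral>s. Qt s x \<partial>I)) \<in> borel_measurable M"
      using IM.integrable_snd[OF Qti] by simp
  qed
  also have "\<dots> = 2 * (\<integral>s. (\<integral>x. Qt s x \<partial>M) \<partial>I)"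
    using IM.Fubini_integral[OF Qti] by simp
  also have "(\<integral>s. (\<integral>x. Qt s x \<partial>M) \<partial>I) = (\<integral>s. (if s \<le> t then \<integral>x. Q s x \<partial>M else 0) \<partial>I)"
    by (intro Bochner_Integration.integral_cong) (auto simp: Qt_def)
  also have "\<dots> = (\<integral>s. (\<integral>x. Q s x \<partial>M) \<partial>lebesgue_on {0..t})"
    using t by (simp add: integral_lebesgue_on_initial)
  finally show "(\<integral>x. time_integral t F x \<bullet> (D x *v time_integral t F x) \<partial>M)
      = 2 * (\<integral>s. (\<integral>x. time_integral s F x \<bullet> (D x *v F s x) \<partial>M) \<partial>lebesgue_on {0..t})"
    by (simp add: Q_def)
qed

end

section \<open>Gronwall and Young inequalities\<close>

text \<open>Applied with \<open>a\<close> the weighted error norm, \<open>p\<close> twice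
  \<open>P\<close>, and \<open>y\<close> the energy. Since \<open>p\<close> has no sign and is only
  integrable, the argument runs on \<open>z\<close>, the primitive of \<open>a + p\<close>: it
  dominates \<open>y\<close> because \<open>a\<close> is nonnegative, and it is continuous, so its
  own primitive \<open>Z\<close> can be differentiated.\<close>

lemma gronwall_energy:
  fixes a p l y :: "real \<Rightarrow> real"
  assumes T: "T > 0" and c: "c \<ge> 0"
    and a: "integrable (lebesgue_on {0..T}) a" "\<And>t. 0 \<le> a t"
    and p: "integrable (lebesgue_on {0..T}) p"
    and l: "integrable (lebesgue_on {0..T}) l" "\<And>t. 0 \<le> l t"
    and y: "\<And>t. t \<in> {0..T} \<Longrightarrow> y t = (\<integral>s. p s \<partial>lebesgue_on {0..t})"
    and le: "AE t in lebesgue_on {0..T}. a t + p t \<le> c * y t + l t"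
  shows "(\<integral>s. a s \<partial>lebesgue_on {0..T}) + y T \<le> exp (c * T) * (\<integral>s. l s \<partial>lebesgue_on {0..T})"
proof -
  define z where "z t = integral {0..t} (\<lambda>s. a s + p s)" for t
  define \<Lambda> where "\<Lambda> = (\<integral>s. l s \<partial>lebesgue_on {0..T})"
  have HK: "(\<integral>s. f s \<partial>lebesgue_on {0..t}) = integral {0..t} f" "f integrable_on {0..t}"
    if "integrable (lebesgue_on {0..T}) f" "t \<in> {0..T}" for f :: "real \<Rightarrow> real" and t
    using integrable_lebesgue_on_initial[OF that(1), of t] that(2)
    by (auto intro: lebesgue_integral_eq_integral integrable_on_lebesgue_on)
  have ap: "integrable (lebesgue_on {0..T}) (\<lambda>s. a s + p s)" using a(1) p by simp
  have z_split: "z t = (\<integral>s. a s \<partial>lebesgue_on {0..t}) + y t" if "t \<in> {0..T}" for t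
    using that integrable_lebesgue_on_initial[OF a(1)] integrable_lebesgue_on_initial[OF p] y[OF that]
    by (simp add: z_def HK(1)[OF ap that, symmetric])
  then have y_le: "y t \<le> z t" if "t \<in> {0..T}" for t
    using that a(2) by simp
  have cont_z: "continuous_on {0..T} z"
    unfolding z_def using HK(2)[OF ap, of T] T by (intro indefinite_integral_continuous_1) auto
  then have z_int: "integrable (lebesgue_on {0..T}) z"
    by (intro continuous_imp_integrable_real)
  define Z where "Z t = integral {0..t} z" for t
  have z_le: "z t \<le> c * Z t + \<Lambda>" if t: "t \<in> {0..T}" for t
  proof -
    have int: "integrable (lebesgue_on {0..t}) f" if "integrable (lebesgue_on {0..T}) f" for f :: "real \<Rightarrow> real"
      using integrable_lebesgue_on_initial[OF that] t by simp
    have "AE s in lebesgue_on {0..t}. a s + p s \<le> c * z s + l s"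
    proof -
      have "AE s in lebesgue. s \<in> {0..t} \<longrightarrow> a s + p s \<le> c * y s + l s"
        using le t by (auto simp: AE_restrict_space_iff elim!: eventually_mono)
      moreover have "c * y s \<le> c * z s" if "s \<in> {0..t}" for s
        using y_le[of s] that t c by (intro mult_left_mono) auto
      ultimately show ?thesis
        by (auto simp: AE_restrict_space_iff elim!: eventually_mono) (smt (verit) atLeastAtMost_iff)
    qed
    then have "(\<integral>s. a s + p s \<partial>lebesgue_on {0..t}) \<le> (\<integral>s. c * z s + l s \<partial>lebesgue_on {0..t})"
      using int[OF ap] int[OF z_int] int[OF l(1)] by (intro integral_mono_AE) auto
    also have "\<dots> = c * Z t + (\<integral>s. l s \<partial>lebesgue_on {0..t})"
      using int[OF z_int] int[OF l(1)] HK(1)[OF z_int t] by (simp add: Z_def)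
    also have "(\<integral>s. l s \<partial>lebesgue_on {0..t}) = (\<integral>s. (if s \<le> t then l s else 0) \<partial>lebesgue_on {0..T})"
      using t by (simp add: integral_lebesgue_on_initial)
    also have "\<dots> \<le> \<Lambda>"
      unfolding \<Lambda>_def using l by (intro Bochner_Integration.integral_mono_AE') auto
    finally show ?thesis by (simp add: z_def HK(1)[OF ap t])
  qed
  \<comment> \<open>The integrating factor: \<open>z_le\<close> says that
    \<open>Z' = z \<le> c * Z + \<Lambda>\<close>, which makes \<open>\<Phi>\<close> decrease from
    its initial value \<open>\<Lambda>\<close>.\<close>
  define \<Phi> where "\<Phi> t = exp (- c * t) * (c * Z t + \<Lambda>)" for t
  have "\<Phi> T \<le> \<Phi> 0"
  proof (rule DERIV_nonpos_imp_decreasing_open[where a = 0 and b = T])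
    show "0 \<le> T" using T by simp
    have "continuous_on {0..T} Z"
      unfolding Z_def using HK(2)[OF z_int, of T] T by (intro indefinite_integral_continuous_1) auto
    then show "continuous_on {0..T} \<Phi>" unfolding \<Phi>_def by (intro continuous_intros)
    fix t assume t: "0 < t" "t < T"
    have "(Z has_real_derivative z t) (at t within {0..T})"
      unfolding Z_def using cont_z t by (intro integral_has_real_derivative) auto
    then have Z': "(Z has_real_derivative z t) (at t)"
      using t at_within_Icc_at[of 0 t T] by simp
    have "(\<Phi> has_real_derivative (- c * exp (- c * t)) * (c * Z t + \<Lambda>) + c * z t * exp (- c * t)) (at t)"
      unfolding \<Phi>_def by (auto intro!: derivative_eq_intros Z')
    moreover have "(- c * exp (- c * t)) * (c * Z t + \<Lambda>) + c * z t * exp (- c * t)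
        = (c * exp (- c * t)) * (z t - (c * Z t + \<Lambda>))" by (simp add: algebra_simps)
    moreover have "\<dots> \<le> 0" using z_le[of t] t c by (intro mult_nonneg_nonpos) auto
    ultimately show "\<exists>y. (\<Phi> has_real_derivative y) (at t) \<and> y \<le> 0" by metis
  qed
  then have "exp (- c * T) * (c * Z T + \<Lambda>) \<le> \<Lambda>" by (simp add: \<Phi>_def Z_def)
  then have "c * Z T + \<Lambda> \<le> exp (c * T) * \<Lambda>" by (simp add: exp_minus field_simps)
  with z_le[of T] z_split[of T] T show ?thesis by (simp add: \<Lambda>_def)
qed

text \<open>The weight \<open>w / 6\<close> is chosen for three such products, which together use up
  half of \<open>w * e\<^sup>2\<close>.\<close>

lemma young_weighted: "x * y \<le> w / 6 * x\<^sup>2 + 3 / (2 * w) * y\<^sup>2" if "w > 0" for x y w :: real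
proof -
  have "0 \<le> (w * x - 3 * y)\<^sup>2 / (6 * w)" using that by simp
  also have "\<dots> = w / 6 * x\<^sup>2 + 3 / (2 * w) * y\<^sup>2 - x * y"
    using that by (simp add: power2_diff power_mult_distrib field_simps power2_eq_square)
  finally show ?thesis by simp
qed

text \<open>Two products of this kind occur; together they cost a quarter of the energy
  density.\<close>

lemma young_eighth: "x * y \<le> 1 / 8 * x\<^sup>2 + 2 * y\<^sup>2" for x y :: real
  using zero_le_power2[of "x - 4 * y"] by (simp add: power2_diff power_mult_distrib)

text \<open>Read \<open>d\<close> as the isotherm difference, \<open>s\<close> as
  \<open>u \<bullet> V\<close>, \<open>g\<close> as the diffusion product of \<open>V\<close> with
  the gradient of \<open>\<eta>\<close>, \<open>N\<close> as the length of \<open>V\<close> under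
  the root of \<open>D\<close>, and \<open>G\<close> as the length of the gradient of
  \<open>\<eta>\<close>. The products \<open>e * \<eta>\<close>, \<open>d * \<eta>\<close> and
  \<open>s * e\<close> each take the share \<open>w / 6\<close> of \<open>e\<^sup>2\<close>, while
  \<open>s * \<eta>\<close> and \<open>g\<close> each take 1/8 of \<open>N\<^sup>2\<close>. The
  product \<open>d * e\<close> has a sign and is dropped.\<close>

lemma scalar_energy_bound:
  fixes e \<eta> d s g w b \<kappa> U M N S G :: real
  assumes w: "w > 0" and b: "b \<ge> 0" and d: "d * e \<ge> 0" "\<bar>d\<bar> \<le> \<kappa> * \<bar>e\<bar>" 
    and s: "\<bar>s\<bar> \<le> U * (M * N)" and g: "\<bar>g\<bar> \<le> N * (S * G)"
  shows "w / 2 * e\<^sup>2 \<le> w * e * (e - \<eta>) + b * d * (e - \<eta>) + s * (e - \<eta>) - g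
    + (1 / 4 + 3 / 2 * U\<^sup>2 * M\<^sup>2 / w) * N\<^sup>2
    + (3 / 2 * w + 3 / 2 * b\<^sup>2 * \<kappa>\<^sup>2 / w + 2 * U\<^sup>2 * M\<^sup>2) * \<eta>\<^sup>2 + 2 * S\<^sup>2 * G\<^sup>2"
proof -
  have "w * e * \<eta> \<le> \<bar>e\<bar> * (w * \<bar>\<eta>\<bar>)"
    using w abs_ge_self[of "e * \<eta>"] by (simp add: abs_mult mult_ac)
  also have "\<dots> \<le> w / 6 * e\<^sup>2 + 3 / (2 * w) * (w * \<bar>\<eta>\<bar>)\<^sup>2" using young_weighted[OF w, of "\<bar>e\<bar>"] by simp
  also have "3 / (2 * w) * (w * \<bar>\<eta>\<bar>)\<^sup>2 = 3 / 2 * w * \<eta>\<^sup>2" using w by (simp add: power2_eq_square field_simps)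
  finally have 1: "w * e * \<eta> \<le> w / 6 * e\<^sup>2 + 3 / 2 * w * \<eta>\<^sup>2" .
  have "b * d * \<eta> \<le> b * (\<bar>d\<bar> * \<bar>\<eta>\<bar>)"
    using mult_left_mono[OF abs_ge_self[of "d * \<eta>"] b] by (simp add: abs_mult mult_ac)
  also have "\<dots> \<le> b * ((\<kappa> * \<bar>e\<bar>) * \<bar>\<eta>\<bar>)" using b d(2) by (intro mult_left_mono mult_right_mono) auto
  also have "\<dots> = \<bar>e\<bar> * (b * \<kappa> * \<bar>\<eta>\<bar>)" by simp
  also have "\<dots> \<le> w / 6 * e\<^sup>2 + 3 / (2 * w) * (b * \<kappa> * \<bar>\<eta>\<bar>)\<^sup>2" using young_weighted[OF w, of "\<bar>e\<bar>"] by simp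
  also have "3 / (2 * w) * (b * \<kappa> * \<bar>\<eta>\<bar>)\<^sup>2 = 3 / 2 * b\<^sup>2 * \<kappa>\<^sup>2 / w * \<eta>\<^sup>2" using w by (simp add: power_mult_distrib field_simps)
  finally have 2: "b * d * \<eta> \<le> w / 6 * e\<^sup>2 + 3 / 2 * b\<^sup>2 * \<kappa>\<^sup>2 / w * \<eta>\<^sup>2" .
  have "- (s * e) \<le> \<bar>s\<bar> * \<bar>e\<bar>" by (metis abs_ge_minus_self abs_mult)
  also have "\<dots> \<le> (U * (M * N)) * \<bar>e\<bar>" using s by (intro mult_right_mono) auto
  also have "\<dots> = \<bar>e\<bar> * (U * (M * N))" by simp
  also have "\<dots> \<le> w / 6 * e\<^sup>2 + 3 / (2 * w) * (U * (M * N))\<^sup>2" using young_weighted[OF w, of "\<bar>e\<bar>"] by simp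
  also have "3 / (2 * w) * (U * (M * N))\<^sup>2 = 3 / 2 * U\<^sup>2 * M\<^sup>2 / w * N\<^sup>2" using w by (simp add: power_mult_distrib field_simps)
  finally have 3: "- (s * e) \<le> w / 6 * e\<^sup>2 + 3 / 2 * U\<^sup>2 * M\<^sup>2 / w * N\<^sup>2" .
  have "s * \<eta> \<le> \<bar>s\<bar> * \<bar>\<eta>\<bar>" by (metis abs_ge_self abs_mult)
  also have "\<dots> \<le> (U * (M * N)) * \<bar>\<eta>\<bar>" using s by (intro mult_right_mono) auto
  also have "\<dots> = N * (U * M * \<bar>\<eta>\<bar>)" by simp
  also have "\<dots> \<le> 1 / 8 * N\<^sup>2 + 2 * (U * M * \<bar>\<eta>\<bar>)\<^sup>2" by (rule young_eighth)
  finally have 4: "s * \<eta> \<le> 1 / 8 * N\<^sup>2 + 2 * U\<^sup>2 * M\<^sup>2 * \<eta>\<^sup>2" by (simp add: power_mult_distrib)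
  have "g \<le> N * (S * G)" using g by simp
  also have "\<dots> \<le> 1 / 8 * N\<^sup>2 + 2 * (S * G)\<^sup>2" by (rule young_eighth)
  finally have 5: "g \<le> 1 / 8 * N\<^sup>2 + 2 * S\<^sup>2 * G\<^sup>2" by (simp add: power_mult_distrib)
  have 6: "0 \<le> b * d * e" using b d(1) by (simp add: mult.assoc)
  have "w * e * (e - \<eta>) = w * e\<^sup>2 - w * e * \<eta>" "b * d * (e - \<eta>) = b * d * e - b * d * \<eta>"
    "s * (e - \<eta>) = s * e - s * \<eta>"
    "(1 / 4 + 3 / 2 * U\<^sup>2 * M\<^sup>2 / w) * N\<^sup>2 = 1 / 8 * N\<^sup>2 + 1 / 8 * N\<^sup>2 + 3 / 2 * U\<^sup>2 * M\<^sup>2 / w * N\<^sup>2"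
    "(3 / 2 * w + 3 / 2 * b\<^sup>2 * \<kappa>\<^sup>2 / w + 2 * U\<^sup>2 * M\<^sup>2) * \<eta>\<^sup>2
      = 3 / 2 * w * \<eta>\<^sup>2 + 3 / 2 * b\<^sup>2 * \<kappa>\<^sup>2 / w * \<eta>\<^sup>2 + 2 * U\<^sup>2 * M\<^sup>2 * \<eta>\<^sup>2"
    "w / 2 * e\<^sup>2 = w * e\<^sup>2 - (w / 6 * e\<^sup>2 + w / 6 * e\<^sup>2 + w / 6 * e\<^sup>2)"
    by (simp_all add: algebra_simps power2_eq_square)
  with 1 2 3 4 5 6 show ?thesis by linarith
qed

text \<open>All lengths are measured through the root of \<open>A\<close>:
  \<open>u \<bullet> v\<close> passes through its inverse, \<open>(A *v v) \<bullet> H\<close> is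
  split evenly between two roots, and \<open>v \<bullet> (A *v v)\<close> is the square of
  \<open>N\<close> in \<open>scalar_energy_bound\<close>. The term
  \<open>v \<bullet> (A *v G)\<close> stays on the left, as it becomes a time derivative.\<close>

lemma pointwise_energy_bound:
  fixes A :: "real^'n^'n" and u v G H :: "real^'n" and e \<eta> d w b \<kappa> U M S :: real
  assumes A: "sym_pos_def A" and w: "w > 0" and b: "b \<ge> 0" and d: "d * e \<ge> 0" "\<bar>d\<bar> \<le> \<kappa> * \<bar>e\<bar>"
    and U: "norm u \<le> U" and M: "onorm ((*v) (matrix_inv (pos_sqrt A))) \<le> M"
    and S: "onorm ((*v) (pos_sqrt A)) \<le> S"
  shows "w / 2 * e\<^sup>2 + v \<bullet> (A *v G)
    \<le> w * e * (e - \<eta>) + b * d * (e - \<eta>) + (u \<bullet> v) * (e - \<eta>) + (A *v v) \<bullet> (G - H)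
    + (1 / 4 + 3 / 2 * U\<^sup>2 * M\<^sup>2 / w) * (v \<bullet> (A *v v))
    + (3 / 2 * w + 3 / 2 * b\<^sup>2 * \<kappa>\<^sup>2 / w + 2 * U\<^sup>2 * M\<^sup>2) * \<eta>\<^sup>2 + 2 * S\<^sup>2 * (norm H)\<^sup>2"
proof -
  let ?N = "norm (pos_sqrt A *v v)"
  have sym: "transpose A = A" using A by (simp add: sym_pos_def_def)
  have "\<bar>u \<bullet> v\<bar> \<le> norm u * norm v" by (rule Cauchy_Schwarz_ineq2)
  also have "norm v = norm (matrix_inv (pos_sqrt A) *v (pos_sqrt A *v v))" by (simp add: matrix_inv_pos_sqrt[OF A])
  also have "norm u * \<dots> \<le> norm u * (M * ?N)"
    using onorm[of "(*v) (matrix_inv (pos_sqrt A))" "pos_sqrt A *v v"] mult_right_mono[OF M norm_ge_zero[of "pos_sqrt A *v v"]]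
    by (intro mult_left_mono) auto
  also have "\<dots> \<le> U * (M * ?N)"
    using order_trans[OF onorm_pos_le[OF matrix_vector_mul_bounded_linear] M]
    by (intro mult_right_mono[OF U]) auto
  finally have s: "\<bar>u \<bullet> v\<bar> \<le> U * (M * ?N)" .
  have AvH: "(A *v v) \<bullet> H = (pos_sqrt A *v v) \<bullet> (pos_sqrt A *v H)"
    using pos_sqrt_inner[OF A, of v H] symmetric_inner_commute[OF sym, of v H] by (simp add: inner_commute)
  have "\<bar>(A *v v) \<bullet> H\<bar> \<le> ?N * norm (pos_sqrt A *v H)" unfolding AvH by (rule Cauchy_Schwarz_ineq2)
  also have "\<dots> \<le> ?N * (S * norm H)"
    using onorm[of "(*v) (pos_sqrt A)" H] mult_right_mono[OF S norm_ge_zero[of H]]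
    by (intro mult_left_mono) auto
  finally have g: "\<bar>(A *v v) \<bullet> H\<bar> \<le> ?N * (S * norm H)" .
  have "(A *v v) \<bullet> (G - H) = v \<bullet> (A *v G) - (A *v v) \<bullet> H"
    using symmetric_inner_commute[OF sym, of v G] by (simp add: inner_diff_right inner_commute)
  with scalar_energy_bound[OF w b d s g, of \<eta>] show ?thesis by (simp add: norm_pos_sqrt[OF A])
qed

section \<open>The error estimate\<close>

context time_cylinder
begin

text \<open>\<open>space_grad\<close> is a choice among jointly measurable gradients, so one has to
  be exhibited: the partial derivatives are glued to a vector, and their finitely many null sets of
  times are united.\<close>

lemma space_grad_works:
  assumes "C \<in> L2_time_sobolev T \<Omega> 1"
  shows "space_grad T \<Omega> C \<in> L2_time T \<Omega>"
    and "AE t in I. \<forall>i. is_weak_deriv \<Omega> (mi_unit i) (C t) (\<lambda>x. space_grad T \<Omega> C t x $ i)"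
proof -
  have "mi_order (mi_unit i) \<le> 1" for i :: 'n using mi_order_le_1 by blast
  then have "\<exists>G\<in>L2_time T \<Omega>. AE t in I. is_weak_deriv \<Omega> (mi_unit i) (C t) (G t)" for i
    using assms by (simp add: L2_time_sobolev_def)
  then obtain G where G: "\<And>i. G i \<in> L2_time T \<Omega>"
    "\<And>i. AE t in I. is_weak_deriv \<Omega> (mi_unit i) (C t) (G i t)" by metis
  define H where "H t x = (\<chi> i. G i t x)" for t x
  have H_sum: "H t x = (\<Sum>i\<in>UNIV. G i t x *\<^sub>R axis i 1)" for t x
    by (auto simp: H_def vec_eq_iff axis_def if_distrib sum.delta' cong: if_cong)
  have norm_H: "(norm (H t x))\<^sup>2 = (\<Sum>i\<in>UNIV. (G i t x)\<^sup>2)" for t x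
    unfolding power2_norm_eq_inner inner_vec_def by (simp add: H_def power2_eq_square)
  have "(\<lambda>z. H (fst z) (snd z)) \<in> borel_measurable (I \<Otimes>\<^sub>M M)"
    unfolding H_sum using G(1) by (auto simp: L2_time_iff intro!: borel_measurable_sum borel_measurable_scaleR)
  then have "H \<in> L2_time T \<Omega>"
    using G(1) by (simp add: L2_time_iff norm_H)
  moreover have "AE t in I. \<forall>i. is_weak_deriv \<Omega> (mi_unit i) (C t) (\<lambda>x. H t x $ i)"
    using eventually_ball_finite[of UNIV "\<lambda>t i. is_weak_deriv \<Omega> (mi_unit i) (C t) (G i t)" "ae_filter I"] G(2)
    by (simp add: H_def)
  ultimately have "\<exists>G. G \<in> L2_time T \<Omega> \<and>
      (AE t in I. \<forall>i. is_weak_deriv \<Omega> (mi_unit i) (C t) (\<lambda>x. G t x $ i))" by blast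
  from someI_ex[OF this]
  show "space_grad T \<Omega> C \<in> L2_time T \<Omega>"
    and "AE t in I. \<forall>i. is_weak_deriv \<Omega> (mi_unit i) (C t) (\<lambda>x. space_grad T \<Omega> C t x $ i)"
    unfolding space_grad_def by auto
qed

lemma L2_time_sobolev_diff:
  assumes \<Omega>: "open \<Omega>" "bounded \<Omega>" and "B \<in> L2_time_sobolev T \<Omega> m" "C \<in> L2_time_sobolev T \<Omega> m"
  shows "(\<lambda>t x. B t x - C t x) \<in> L2_time_sobolev T \<Omega> m"
  unfolding L2_time_sobolev_def mem_Collect_eq
proof (intro conjI allI impI)
  show "(\<lambda>t x. B t x - C t x) \<in> L2_time T \<Omega>"
    using assms(3,4) by (intro L2_time_diff) (auto simp: L2_time_sobolev_def)
  fix \<alpha> :: "'n \<Rightarrow> nat" assume "mi_order \<alpha> \<le> m"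
  with assms(3,4) obtain F G where F: "F \<in> L2_time T \<Omega>" "AE t in I. is_weak_deriv \<Omega> \<alpha> (B t) (F t)"
    and G: "G \<in> L2_time T \<Omega>" "AE t in I. is_weak_deriv \<Omega> \<alpha> (C t) (G t)"
    unfolding L2_time_sobolev_def by blast
  from F(2) G(2) have "AE t in I. is_weak_deriv \<Omega> \<alpha> (\<lambda>x. B t x - C t x) (\<lambda>x. F t x - G t x)"
    by eventually_elim (rule is_weak_deriv_diff[OF \<Omega>])
  with L2_time_diff[OF F(1) G(1)]
  show "\<exists>H\<in>L2_time T \<Omega>. AE t in I. is_weak_deriv \<Omega> \<alpha> (\<lambda>x. B t x - C t x) (H t)"
    by (intro bexI[of _ "\<lambda>t x. F t x - G t x"]) auto
qed

lemma space_grad_diff: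
  assumes \<Omega>: "open \<Omega>" "bounded \<Omega>" and B: "B \<in> L2_time_sobolev T \<Omega> 1" and C: "C \<in> L2_time_sobolev T \<Omega> 1"
  shows "AE t in I. AE x in M. space_grad T \<Omega> (\<lambda>t x. B t x - C t x) t x = space_grad T \<Omega> B t x - space_grad T \<Omega> C t x"
  using space_grad_works(2)[OF B] space_grad_works(2)[OF C] space_grad_works(2)[OF L2_time_sobolev_diff[OF \<Omega> B C]]
proof eventually_elim
  case (elim t)
  have "is_weak_deriv \<Omega> (mi_unit i) (\<lambda>x. B t x - C t x) (\<lambda>x. (space_grad T \<Omega> B t x - space_grad T \<Omega> C t x) $ i)" for i
    using is_weak_deriv_diff[OF \<Omega> elim(1,2)[rule_format]] by simp
  with elim(3) show ?case by (intro is_weak_deriv_vec_unique[OF \<Omega>]) auto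
qed

end

text \<open>The isotherm appears as a monotone function with the Lipschitz constant
  \<open>\<kappa>\<close> of the final bound, and the discrete space as a part of H1 that contains
  differences, so that \<open>w - C\<^sub>h\<close> remains a test function.\<close>

locale semidiscrete_error = time_cylinder T \<Omega> for T :: real and \<Omega> :: "(real^'n) set" +
  fixes X :: "(real^'n \<Rightarrow> real) set" and u :: "real^'n \<Rightarrow> real^'n" and D :: "real^'n \<Rightarrow> real^'n^'n"
    and q :: "real \<Rightarrow> real" and f :: "real \<Rightarrow> real^'n \<Rightarrow> real" and g g\<^sub>h C\<^sub>0 :: "real^'n \<Rightarrow> real"
    and C C\<^sub>h :: "real \<Rightarrow> real^'n \<Rightarrow> real" and \<omega> \<rho>\<^sub>s \<beta> \<kappa> :: real
  assumes open_\<Omega>: "open \<Omega>" and bounded_\<Omega>: "bounded \<Omega>"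
    and porosity: "0 < \<omega>" "\<omega> \<le> 1" and density: "0 \<le> \<rho>\<^sub>s"
    and u_measurable: "u \<in> borel_measurable (lebesgue_on \<Omega>)" and u_bounded: "bounded (u ` \<Omega>)"
    and D_measurable: "D \<in> borel_measurable (lebesgue_on \<Omega>)"
    and D_pos: "\<And>x. x \<in> \<Omega> \<Longrightarrow> sym_pos_def (D x)"
    and D_bounded: "\<And>x. x \<in> \<Omega> \<Longrightarrow> onorm ((*v) (D x)) \<le> \<beta>"
    and inv_sqrt_bounded: "bdd_above ((\<lambda>x. onorm ((*v) (matrix_inv (pos_sqrt (D x))))) ` \<Omega>)"
    and q_continuous: "continuous_on UNIV q" and q_0: "q 0 = 0"
    and q_mono: "\<And>c d. 0 \<le> (q c - q d) * (c - d)"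
    and q_lipschitz: "\<And>c d. \<bar>q c - q d\<bar> \<le> \<kappa> * \<bar>c - d\<bar>"
    and X_sobolev: "X \<subseteq> sobolev_space \<Omega> 1"
    and X_diff: "\<And>v w. v \<in> X \<Longrightarrow> w \<in> X \<Longrightarrow> (\<lambda>x. v x - w x) \<in> X"
    and exact: "exact_solution \<Omega> T \<omega> \<rho>\<^sub>s q u D f C\<^sub>0 g C"
    and discrete: "semidiscrete_solution \<Omega> T \<omega> \<rho>\<^sub>s q u D f C\<^sub>0 X g\<^sub>h C\<^sub>h"
begin

abbreviation "\<Gamma> \<equiv> inflow_boundary \<Omega> u"
abbreviation "U \<equiv> sup_norm \<Omega> u"
abbreviation "S \<equiv> mat_sup_norm \<Omega> (\<lambda>x. pos_sqrt (D x))"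
abbreviation "S' \<equiv> mat_sup_norm \<Omega> (\<lambda>x. matrix_inv (pos_sqrt (D x)))"
abbreviation "b \<equiv> (1 - \<omega>) * \<rho>\<^sub>s"

definition "e = (\<lambda>t x. C t x - C\<^sub>h t x)"
definition "G = space_grad T \<Omega> e"
definition "V = (\<lambda>t. time_integral t G)"
text \<open>Half of the time derivative of \<open>energy\<close>, in the integrated sense of
  \<open>energy_identities\<close>.\<close>

definition "P = (\<lambda>t. \<integral>x. V t x \<bullet> (D x *v G t x) \<partial>M)"
definition "energy = (\<lambda>t. \<integral>x. V t x \<bullet> (D x *v V t x) \<partial>M)"

section \<open>Bounds on the coefficients and integrability of the error\<close>

lemma b_nonneg: "0 \<le> b" using porosity density by simp

lemma norm_u_le: "x \<in> \<Omega> \<Longrightarrow> norm (u x) \<le> U"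
  unfolding sup_norm_def using u_bounded by (intro cSUP_upper) (auto simp: bounded_iff bdd_above_def)

lemma inv_sqrt_le: "x \<in> \<Omega> \<Longrightarrow> onorm ((*v) (matrix_inv (pos_sqrt (D x)))) \<le> S'"
  unfolding mat_sup_norm_def using inv_sqrt_bounded by (intro cSUP_upper)

text \<open>A real supremum bounds its members only if the family is bounded above. For the roots
  this follows from the bound on \<open>D\<close>, because the squared length of the root applied to
  \<open>\<xi>\<close> is \<open>\<xi> \<bullet> (D x *v \<xi>)\<close>.\<close>

lemma sqrt_le:
  assumes "x \<in> \<Omega>" shows "onorm ((*v) (pos_sqrt (D x))) \<le> S"
proof -
  have "onorm ((*v) (pos_sqrt (D x))) \<le> sqrt \<beta>" if x: "x \<in> \<Omega>" for x
  proof (rule onorm_le)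
    fix \<xi>
    have "(norm (pos_sqrt (D x) *v \<xi>))\<^sup>2 = \<xi> \<bullet> (D x *v \<xi>)" by (rule norm_pos_sqrt[OF D_pos[OF x]])
    also have "\<dots> \<le> norm \<xi> * norm (D x *v \<xi>)" by (rule norm_cauchy_schwarz)
    also have "\<dots> \<le> norm \<xi> * (\<beta> * norm \<xi>)"
      using onorm[of "(*v) (D x)" \<xi>] mult_right_mono[OF D_bounded[OF x] norm_ge_zero[of \<xi>]]
      by (intro mult_left_mono) auto
    finally have "norm (pos_sqrt (D x) *v \<xi>) \<le> sqrt (\<beta> * (norm \<xi>)\<^sup>2)"
      by (intro real_le_rsqrt) (simp add: power2_eq_square mult_ac)
    then show "norm (pos_sqrt (D x) *v \<xi>) \<le> sqrt \<beta> * norm \<xi>" by (simp add: real_sqrt_mult)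
  qed
  then show ?thesis
    unfolding mat_sup_norm_def using assms by (intro cSUP_upper) (auto intro!: bdd_aboveI2[of _ _ "sqrt \<beta>"])
qed

lemma C_time_sobolev: "C \<in> L2_time_sobolev T \<Omega> 1" "C\<^sub>h \<in> L2_time_sobolev T \<Omega> 1"
  using exact discrete by (auto simp: exact_solution_def semidiscrete_solution_def)

lemma e_time_sobolev: "e \<in> L2_time_sobolev T \<Omega> 1"
  unfolding e_def by (rule L2_time_sobolev_diff[OF open_\<Omega> bounded_\<Omega> C_time_sobolev])

lemma e_L2_time: "e \<in> L2_time T \<Omega>" using e_time_sobolev by (simp add: L2_time_sobolev_def)

lemma G_L2_time: "G \<in> L2_time T \<Omega>" unfolding G_def by (rule space_grad_works(1)[OF e_time_sobolev])

lemma V_L2: "t \<in> {0..T} \<Longrightarrow> V t \<in> L2 \<Omega>" unfolding V_def by (rule time_integral_L2[OF G_L2_time])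

lemma C_sobolev:
  assumes "t \<in> {0..T}" shows "C t \<in> sobolev_space \<Omega> 1" "C\<^sub>h t \<in> sobolev_space \<Omega> 1"
  using exact discrete assms by (auto simp: exact_solution_def semidiscrete_solution_def has_trace_def)

lemma e_sobolev: "t \<in> {0..T} \<Longrightarrow> e t \<in> sobolev_space \<Omega> 1"
  unfolding e_def by (rule sobolev_1_diff[OF open_\<Omega> bounded_\<Omega> C_sobolev])

text \<open>\<open>q 0 = 0\<close> turns the Lipschitz bound into linear growth.\<close>

lemma q_L2:
  assumes "w \<in> L2 \<Omega>" shows "(\<lambda>x. q (w x)) \<in> L2 \<Omega>"
proof (rule L2_dominated[OF _ assms])
  show "(\<lambda>x. q (w x)) \<in> borel_measurable M"
    using L2_measurable[OF assms] borel_measurable_continuous_onI[OF q_continuous] by (rule measurable_compose)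
  show "AE x in M. norm (q (w x)) \<le> \<kappa> * norm (w x)"
    using q_lipschitz[of _ 0] by (simp add: q_0)
qed

lemma D_mult_L2: "F \<in> L2 \<Omega> \<Longrightarrow> (\<lambda>x. D x *v F x) \<in> L2 \<Omega>"
  by (rule L2_matrix_mult[OF _ D_measurable D_bounded])

lemma time_integral_grad_diff:
  "AE x in M. \<forall>t\<in>{0..T}. V t x = time_integral t (space_grad T \<Omega> C) x - time_integral t (space_grad T \<Omega> C\<^sub>h) x"
  unfolding V_def
proof (rule time_integral_diff)
  show "AE t in I. AE x in M. G t x = space_grad T \<Omega> C t x - space_grad T \<Omega> C\<^sub>h t x"
    unfolding G_def e_def by (rule space_grad_diff[OF open_\<Omega> bounded_\<Omega> C_time_sobolev])
qed (intro space_grad_works(1) C_time_sobolev G_L2_time)+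

text \<open>What remains under the space integral when the two variational problems are subtracted:
  the data cancel, and the time integrals of both fluxes are expressed through
  \<open>V\<close>.\<close>

definition "residual t v x = \<omega> * e t x * v x + b * (q (C t x) - q (C\<^sub>h t x)) * v x + (u x \<bullet> V t x) * v x
  + (D x *v V t x) \<bullet> wgrad \<Omega> v x"

lemma residual_parts_integrable:
  assumes t: "t \<in> {0..T}" and v: "v \<in> sobolev_space \<Omega> 1"
  shows "integrable M (\<lambda>x. \<omega> * e t x * v x)"
    "integrable M (\<lambda>x. b * (q (C t x) - q (C\<^sub>h t x)) * v x)"
    "integrable M (\<lambda>x. (u x \<bullet> V t x) * v x)"
    "integrable M (\<lambda>x. (D x *v V t x) \<bullet> wgrad \<Omega> v x)"
  using sobolev_1_L2[OF v] sobolev_1_L2[OF e_sobolev[OF t]] C_sobolev[OF t, THEN sobolev_1_L2] V_L2[OF t] wgrad_L2[OF v]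
  by (auto intro!: L2_mult_integrable L2_inner_integrable L2_scale L2_diff q_L2
      L2_inner[OF _ u_measurable norm_u_le] D_mult_L2)

text \<open>The discrete test space lies in the continuous one, so both problems accept
  \<open>v\<close>; their right-hand sides coincide because the discrete problem keeps
  \<open>C\<^sub>0\<close>.\<close>

lemma galerkin_orthogonality:
  assumes t: "t \<in> {0..T}" and v: "v \<in> zero_trace_subspace \<Omega> \<Gamma> X"
  shows "(\<integral>x. residual t v x \<partial>M) = 0"
proof -
  have vH: "v \<in> sobolev_space \<Omega> 1" using v X_sobolev by (auto simp: zero_trace_subspace_def)
  then have v': "v \<in> zero_trace_subspace \<Omega> \<Gamma> (sobolev_space \<Omega> 1)"
    using v by (simp add: zero_trace_subspace_def)
  note vL = sobolev_1_L2[OF vH]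
  let ?GC = "space_grad T \<Omega> C" and ?Gh = "space_grad T \<Omega> C\<^sub>h"
  have GC: "?GC \<in> L2_time T \<Omega>" "?Gh \<in> L2_time T \<Omega>" by (intro space_grad_works(1) C_time_sobolev)+
  have CL: "C t \<in> L2 \<Omega>" "C\<^sub>h t \<in> L2 \<Omega>" using C_sobolev[OF t] by (auto intro: sobolev_1_L2)
  have eL: "e t \<in> L2 \<Omega>" by (rule sobolev_1_L2[OF e_sobolev[OF t]])
  have 1: "l2_inner \<Omega> (\<lambda>x. \<omega> * C t x) v - l2_inner \<Omega> (\<lambda>x. \<omega> * C\<^sub>h t x) v
      = (\<integral>x. (\<omega> * e t x) \<bullet> v x \<partial>M)"
  proof (rule l2_inner_diff)
    show "AE x in M. \<omega> * e t x = \<omega> * C t x - \<omega> * C\<^sub>h t x" by (simp add: e_def algebra_simps)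
  qed (intro L2_scale CL eL vL)+
  have 2: "l2_inner \<Omega> (\<lambda>x. b * q (C t x)) v - l2_inner \<Omega> (\<lambda>x. b * q (C\<^sub>h t x)) v
      = (\<integral>x. (b * (q (C t x) - q (C\<^sub>h t x))) \<bullet> v x \<partial>M)"
    by (rule l2_inner_diff) (use CL vL in \<open>auto intro!: L2_scale L2_diff q_L2 simp: right_diff_distrib\<close>)
  have 3: "l2_inner \<Omega> (time_integral t (\<lambda>s x. u x \<bullet> ?GC s x)) v - l2_inner \<Omega> (time_integral t (\<lambda>s x. u x \<bullet> ?Gh s x)) v
      = (\<integral>x. (u x \<bullet> V t x) \<bullet> v x \<partial>M)"
  proof (rule l2_inner_diff)
    show "time_integral t (\<lambda>s x. u x \<bullet> ?GC s x) \<in> L2 \<Omega>" "time_integral t (\<lambda>s x. u x \<bullet> ?Gh s x) \<in> L2 \<Omega>"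
      by (intro time_integral_L2[OF _ t] L2_time_inner[OF _ u_measurable norm_u_le] GC; simp)+
    show "(\<lambda>x. u x \<bullet> V t x) \<in> L2 \<Omega>" by (rule L2_inner[OF V_L2[OF t] u_measurable norm_u_le])
    show "AE x in M. u x \<bullet> V t x = time_integral t (\<lambda>s x. u x \<bullet> ?GC s x) x - time_integral t (\<lambda>s x. u x \<bullet> ?Gh s x) x"
      using time_integral_bounded_linear[OF GC(1) bounded_linear_inner_right, of u]
        time_integral_bounded_linear[OF GC(2) bounded_linear_inner_right, of u] time_integral_grad_diff
      by eventually_elim (use t in \<open>simp add: inner_diff_right\<close>)
  qed (rule vL)
  have 4: "l2_inner \<Omega> (time_integral t (\<lambda>s x. D x *v ?GC s x)) (wgrad \<Omega> v)
        - l2_inner \<Omega> (time_integral t (\<lambda>s x. D x *v ?Gh s x)) (wgrad \<Omega> v)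
      = (\<integral>x. (D x *v V t x) \<bullet> wgrad \<Omega> v x \<partial>M)"
  proof (rule l2_inner_diff)
    show "time_integral t (\<lambda>s x. D x *v ?GC s x) \<in> L2 \<Omega>" "time_integral t (\<lambda>s x. D x *v ?Gh s x) \<in> L2 \<Omega>"
      by (intro time_integral_L2[OF _ t] L2_time_matrix_mult[OF _ D_measurable D_bounded] GC; simp)+
    show "(\<lambda>x. D x *v V t x) \<in> L2 \<Omega>" by (rule D_mult_L2[OF V_L2[OF t]])
    show "AE x in M. D x *v V t x = time_integral t (\<lambda>s x. D x *v ?GC s x) x - time_integral t (\<lambda>s x. D x *v ?Gh s x) x"
      using time_integral_bounded_linear[OF GC(1) matrix_vector_mul_bounded_linear, of D]
        time_integral_bounded_linear[OF GC(2) matrix_vector_mul_bounded_linear, of D] time_integral_grad_diff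
      by eventually_elim (use t in \<open>simp add: matrix_vector_mult_diff_distrib\<close>)
  qed (rule wgrad_L2[OF vH])
  have "(\<integral>x. residual t v x \<partial>M) = (\<integral>x. (\<omega> * e t x) \<bullet> v x \<partial>M)
      + (\<integral>x. (b * (q (C t x) - q (C\<^sub>h t x))) \<bullet> v x \<partial>M) + (\<integral>x. (u x \<bullet> V t x) \<bullet> v x \<partial>M)
      + (\<integral>x. (D x *v V t x) \<bullet> wgrad \<Omega> v x \<partial>M)"
    unfolding residual_def using residual_parts_integrable[OF t vH] by (simp add: mult.assoc)
  also have "\<dots> = 0"
  proof -
    have "variational_problem \<Omega> T \<omega> \<rho>\<^sub>s q u D f C\<^sub>0 (zero_trace_subspace \<Omega> \<Gamma> (sobolev_space \<Omega> 1)) C"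
      "variational_problem \<Omega> T \<omega> \<rho>\<^sub>s q u D f C\<^sub>0 (zero_trace_subspace \<Omega> \<Gamma> X) C\<^sub>h"
      using exact discrete by (auto simp only: exact_solution_def semidiscrete_solution_def)
    note this[unfolded variational_problem_def, rule_format, OF t]
    from this(1)[OF v'] this(2)[OF v] show ?thesis
      unfolding 1[symmetric] 2[symmetric] 3[symmetric] 4[symmetric] by linarith
  qed
  finally show ?thesis .
qed

text \<open>The exceptional times come from the gradient of \<open>e\<close> alone and hence precede
  the choice of \<open>w\<close>; this permits an infimum over \<open>w\<close> at almost every
  time.\<close>

lemma energy_estimate_at_time:
  "AE t in I. \<forall>w\<in>X. has_trace \<Omega> \<Gamma> w g\<^sub>h \<longrightarrow>
     \<omega> * (\<integral>x. (e t x)\<^sup>2 \<partial>M) + 2 * P t \<le> (1 / 2 + 3 * U\<^sup>2 * S'\<^sup>2 / \<omega>) * energy t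
       + (4 * S\<^sup>2 + 3 * \<omega> + 4 * U\<^sup>2 * S'\<^sup>2 + 3 * b\<^sup>2 * \<kappa>\<^sup>2 / \<omega>)
         * (sobolev_norm \<Omega> 1 (\<lambda>x. C t x - w x))\<^sup>2"
  using space_grad_works(2)[OF e_time_sobolev, folded G_def] L2_time_slice[OF G_L2_time] AE_space
proof eventually_elim
  case (elim t)
  have t: "t \<in> {0..T}" using elim(3) by simp
  show ?case
  proof (intro ballI impI)
    fix w assume w: "w \<in> X" "has_trace \<Omega> \<Gamma> w g\<^sub>h"
    \<comment> \<open>\<open>\<eta>\<close> is the approximation error and \<open>v\<close> the test
      function. Both \<open>w\<close> and \<open>C\<^sub>h t\<close> have trace
      \<open>g\<^sub>h\<close>, so \<open>v\<close> has trace 0.\<close>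
    define \<eta> where "\<eta> x = C t x - w x" for x
    define v where "v x = w x - C\<^sub>h t x" for x
    have v_x: "v x = e t x - \<eta> x" for x by (simp add: v_def e_def \<eta>_def)
    then have v_eq: "v = (\<lambda>x. e t x - \<eta> x)" by (auto simp: v_def e_def \<eta>_def)
    have \<eta>H: "\<eta> \<in> sobolev_space \<Omega> 1"
      unfolding \<eta>_def using w(1) X_sobolev C_sobolev[OF t] by (intro sobolev_1_diff[OF open_\<Omega> bounded_\<Omega>]) auto
    have v: "v \<in> zero_trace_subspace \<Omega> \<Gamma> X"
    proof -
      have "C\<^sub>h t \<in> X" "has_trace \<Omega> \<Gamma> (C\<^sub>h t) g\<^sub>h"
        using discrete t by (auto simp: semidiscrete_solution_def)
      with X_diff[OF w(1)] has_trace_diff[OF open_\<Omega> bounded_\<Omega> w(2)]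
      have "(\<lambda>x. w x - C\<^sub>h t x) \<in> X" "has_trace \<Omega> \<Gamma> (\<lambda>x. w x - C\<^sub>h t x) (\<lambda>x. g\<^sub>h x - g\<^sub>h x)" by blast+
      then show ?thesis by (simp add: zero_trace_subspace_def v_def[abs_def])
    qed
    then have vH: "v \<in> sobolev_space \<Omega> 1" using X_sobolev by (auto simp: zero_trace_subspace_def)
    have "is_weak_deriv \<Omega> (mi_unit i) v (\<lambda>x. (G t x - wgrad \<Omega> \<eta> x) $ i)" for i
      unfolding v_eq using is_weak_deriv_diff[OF open_\<Omega> bounded_\<Omega> elim(1)[rule_format] sobolev_1_wgrad[OF \<eta>H]]
      by simp
    \<comment> \<open>Here the separate choices of gradients for \<open>v\<close>, \<open>e\<close>
      and \<open>\<eta>\<close> are reconciled.\<close>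
    then have grad_v: "AE x in M. wgrad \<Omega> v x = G t x - wgrad \<Omega> \<eta> x"
      by (intro is_weak_deriv_vec_unique[OF open_\<Omega> bounded_\<Omega> sobolev_1_wgrad[OF vH]])
    \<comment> \<open>The coefficients of \<open>pointwise_energy_bound\<close>, before the
      inequality is doubled.\<close>
    define c\<^sub>1 where "c\<^sub>1 = 1 / 4 + 3 / 2 * U\<^sup>2 * S'\<^sup>2 / \<omega>"
    define c\<^sub>2 where "c\<^sub>2 = 3 / 2 * \<omega> + 3 / 2 * b\<^sup>2 * \<kappa>\<^sup>2 / \<omega> + 2 * U\<^sup>2 * S'\<^sup>2"
    define c\<^sub>3 where "c\<^sub>3 = 2 * S\<^sup>2"
    let ?lhs = "\<lambda>x. \<omega> / 2 * (e t x)\<^sup>2 + V t x \<bullet> (D x *v G t x)"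
    let ?rhs = "\<lambda>x. residual t v x + c\<^sub>1 * (V t x \<bullet> (D x *v V t x)) + c\<^sub>2 * (\<eta> x)\<^sup>2 + c\<^sub>3 * (norm (wgrad \<Omega> \<eta> x))\<^sup>2"
    have ints: "integrable M (\<lambda>x. (e t x)\<^sup>2)" "integrable M (\<lambda>x. V t x \<bullet> (D x *v G t x))"
      "integrable M (\<lambda>x. V t x \<bullet> (D x *v V t x))" "integrable M (\<lambda>x. (\<eta> x)\<^sup>2)"
      "integrable M (\<lambda>x. (norm (wgrad \<Omega> \<eta> x))\<^sup>2)" "integrable M (residual t v)"
      using sobolev_1_L2[OF e_sobolev[OF t]] sobolev_1_L2[OF \<eta>H] wgrad_L2[OF \<eta>H] elim(2) V_L2[OF t]
        residual_parts_integrable[OF t vH]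
      by (auto intro!: L2_inner_integrable D_mult_L2 simp: L2_iff[of "e t"] L2_iff[of \<eta>] L2_iff[of "wgrad \<Omega> \<eta>"]
          residual_def[abs_def])
    have "AE x in M. ?lhs x \<le> ?rhs x"
      using grad_v AE_space
    proof eventually_elim
      case (elim x)
      then have x: "x \<in> \<Omega>" by simp
      have d: "0 \<le> (q (C t x) - q (C\<^sub>h t x)) * e t x" "\<bar>q (C t x) - q (C\<^sub>h t x)\<bar> \<le> \<kappa> * \<bar>e t x\<bar>"
        unfolding e_def by (rule q_mono q_lipschitz)+
      show ?case
        using pointwise_energy_bound[OF D_pos[OF x] porosity(1) b_nonneg d norm_u_le[OF x] inv_sqrt_le[OF x] sqrt_le[OF x],
            of "V t x" "G t x" "\<eta> x" "wgrad \<Omega> \<eta> x"]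
        by (simp only: residual_def elim(1) v_x c\<^sub>1_def c\<^sub>2_def c\<^sub>3_def)
    qed
    then have "(\<integral>x. ?lhs x \<partial>M) \<le> (\<integral>x. ?rhs x \<partial>M)"
      using ints by (intro integral_mono_AE) auto
    moreover have "(\<integral>x. ?lhs x \<partial>M) = \<omega> / 2 * (\<integral>x. (e t x)\<^sup>2 \<partial>M) + P t"
      using ints by (simp add: P_def)
    moreover have "(\<integral>x. ?rhs x \<partial>M) = c\<^sub>1 * energy t + c\<^sub>2 * (\<integral>x. (\<eta> x)\<^sup>2 \<partial>M) + c\<^sub>3 * (\<integral>x. (norm (wgrad \<Omega> \<eta> x))\<^sup>2 \<partial>M)"
      using ints galerkin_orthogonality[OF t v] by (simp add: energy_def)
    ultimately have est: "\<omega> * (\<integral>x. (e t x)\<^sup>2 \<partial>M) + 2 * P t \<le> 2 * c\<^sub>1 * energy t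
        + (2 * c\<^sub>2 * (\<integral>x. (\<eta> x)\<^sup>2 \<partial>M) + 2 * c\<^sub>3 * (\<integral>x. (norm (wgrad \<Omega> \<eta> x))\<^sup>2 \<partial>M))" by simp
    have nonneg: "0 \<le> c\<^sub>2" "0 \<le> c\<^sub>3" using porosity by (auto simp: c\<^sub>2_def c\<^sub>3_def)
    \<comment> \<open>Both coefficients are enlarged to their sum, so that the full H1 norm of
      \<open>\<eta>\<close> can be factored out. This explains why the final constant adds the
      contributions of \<open>\<eta>\<close> and of its gradient.\<close>
    have "2 * c\<^sub>2 * (\<integral>x. (\<eta> x)\<^sup>2 \<partial>M) + 2 * c\<^sub>3 * (\<integral>x. (norm (wgrad \<Omega> \<eta> x))\<^sup>2 \<partial>M)
        \<le> (2 * c\<^sub>2 + 2 * c\<^sub>3) * (\<integral>x. (\<eta> x)\<^sup>2 \<partial>M) + (2 * c\<^sub>2 + 2 * c\<^sub>3) * (\<integral>x. (norm (wgrad \<Omega> \<eta> x))\<^sup>2 \<partial>M)"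
      using nonneg by (intro add_mono mult_right_mono) auto
    also have "\<dots> = (2 * c\<^sub>2 + 2 * c\<^sub>3) * (sobolev_norm \<Omega> 1 \<eta>)\<^sup>2"
      by (simp add: sobolev_norm_1_square[OF open_\<Omega> bounded_\<Omega> \<eta>H] distrib_left)
    finally have "\<omega> * (\<integral>x. (e t x)\<^sup>2 \<partial>M) + 2 * P t \<le> 2 * c\<^sub>1 * energy t + (2 * c\<^sub>2 + 2 * c\<^sub>3) * (sobolev_norm \<Omega> 1 \<eta>)\<^sup>2"
      using est by linarith
    moreover have "2 * c\<^sub>1 = 1 / 2 + 3 * U\<^sup>2 * S'\<^sup>2 / \<omega>"
      "2 * c\<^sub>2 + 2 * c\<^sub>3 = 4 * S\<^sup>2 + 3 * \<omega> + 4 * U\<^sup>2 * S'\<^sup>2 + 3 * b\<^sup>2 * \<kappa>\<^sup>2 / \<omega>"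
      by (simp_all add: c\<^sub>1_def c\<^sub>2_def c\<^sub>3_def)
    ultimately show "\<omega> * (\<integral>x. (e t x)\<^sup>2 \<partial>M) + 2 * P t \<le> (1 / 2 + 3 * U\<^sup>2 * S'\<^sup>2 / \<omega>) * energy t
       + (4 * S\<^sup>2 + 3 * \<omega> + 4 * U\<^sup>2 * S'\<^sup>2 + 3 * b\<^sup>2 * \<kappa>\<^sup>2 / \<omega>)
         * (sobolev_norm \<Omega> 1 (\<lambda>x. C t x - w x))\<^sup>2" by (simp add: \<eta>_def[abs_def])
  qed
qed

section \<open>Integrability in time and the norm of the accumulated flux\<close>

lemma e_sq_integrable: "integrable I (\<lambda>t. \<omega> * (\<integral>x. (e t x)\<^sup>2 \<partial>M))"
  using integrable_time_sq_sections(2)[OF e_L2_time] by simp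

lemma energy_identities:
  "integrable I P" "integrable I energy"
  "t \<in> {0..T} \<Longrightarrow> energy t = (\<integral>s. 2 * P s \<partial>lebesgue_on {0..t})"
proof -
  have sym: "x \<in> \<Omega> \<Longrightarrow> transpose (D x) = D x" for x using D_pos by (simp add: sym_pos_def_def)
  note identity = energy_identity[OF G_L2_time D_measurable D_bounded sym]
  show "integrable I P" unfolding P_def V_def by (rule identity(1))
  show "energy t = (\<integral>s. 2 * P s \<partial>lebesgue_on {0..t})" if "t \<in> {0..T}"
    unfolding energy_def P_def V_def using identity(2)[OF _ _ that] by simp
  have V: "V \<in> L2_time T \<Omega>" unfolding V_def by (rule time_integral_L2_time[OF G_L2_time])
  show "integrable I energy"
    unfolding energy_def
    by (rule L2_time_inner_integrable(2)[OF V L2_time_matrix_mult[OF V D_measurable D_bounded]])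
qed

text \<open>The root of \<open>D x\<close> is pulled out of the time integral at fixed
  \<open>x\<close> and squared away before anything is integrated in \<open>x\<close>, so
  measurability is only asked of \<open>D\<close>, not of its root.\<close>

lemma flux_norm_eq_energy:
  "l2_norm_sq \<Omega> (time_integral T (\<lambda>s x. pos_sqrt (D x) *v G s x)) = ennreal (energy T)"
proof -
  have T: "T \<in> {0..T}" using T_pos by simp
  have int: "integrable M (\<lambda>x. V T x \<bullet> (D x *v V T x))"
    by (intro L2_inner_integrable D_mult_L2 V_L2[OF T])
  have nonneg: "AE x in M. 0 \<le> V T x \<bullet> (D x *v V T x)"
  proof (rule AE_I2)
    fix x assume "x \<in> space M"
    then have "sym_pos_def (D x)" using D_pos by simp
    from norm_pos_sqrt[OF this, of "V T x"] show "0 \<le> V T x \<bullet> (D x *v V T x)"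
      by (metis zero_le_power2)
  qed
  have "l2_norm_sq \<Omega> (time_integral T (\<lambda>s x. pos_sqrt (D x) *v G s x))
      = (\<integral>\<^sup>+x. ennreal (V T x \<bullet> (D x *v V T x)) \<partial>M)"
    unfolding l2_norm_sq_def
  proof (rule nn_integral_cong_AE)
    show "AE x in M. ennreal ((norm (time_integral T (\<lambda>s x. pos_sqrt (D x) *v G s x) x))\<^sup>2)
        = ennreal (V T x \<bullet> (D x *v V T x))"
      using time_integral_bounded_linear[OF G_L2_time matrix_vector_mul_bounded_linear, of "\<lambda>x. pos_sqrt (D x)"] AE_space
    proof eventually_elim
      case (elim x)
      then have "time_integral T (\<lambda>s x. pos_sqrt (D x) *v G s x) x = pos_sqrt (D x) *v V T x"
        using T by (simp add: V_def)
      with elim(2) show ?case by (simp add: norm_pos_sqrt[OF D_pos])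
    qed
  qed
  also have "\<dots> = ennreal (energy T)"
    unfolding energy_def by (rule nn_integral_eq_integral[OF int nonneg])
  finally show ?thesis .
qed

text \<open>The estimate at a fixed time bounds \<open>l t / A\<close> by the squared H1 distance
  from \<open>C t\<close> to every admissible \<open>w\<close>, hence by the best one, and the
  constrained approximation property turns this into a bound of \<open>l t / B\<close> by the
  squared norm of order \<open>r\<close>. Only the resulting inequality is integrated in time, so no
  near-optimal \<open>w\<close> is ever selected.\<close>

theorem error_estimate:
  assumes h: "h > 0" and K: "K > 0"
    and approximation: "constrained_approximation_property \<Omega> \<Gamma> X g g\<^sub>h h K r"
  shows "ennreal \<omega> * (\<integral>\<^sup>+t. l2_norm_sq \<Omega> (e t) \<partial>I)
       + l2_norm_sq \<Omega> (time_integral T (\<lambda>s x. pos_sqrt (D x) *v G s x))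
     \<le> ennreal (exp ((1 / 2 + 3 * U\<^sup>2 * S'\<^sup>2 / \<omega>) * T)
         * ((4 * S\<^sup>2 + 3 * \<omega> + 4 * U\<^sup>2 * S'\<^sup>2 + 3 * b\<^sup>2 * \<kappa>\<^sup>2 / \<omega>) * K\<^sup>2 * h powr (2 * r - 2)))
       * (\<integral>\<^sup>+t. sobolev_norm_sq \<Omega> r (C t) \<partial>I)"
proof -
  define c where "c = 1 / 2 + 3 * U\<^sup>2 * S'\<^sup>2 / \<omega>"
  define A where "A = 4 * S\<^sup>2 + 3 * \<omega> + 4 * U\<^sup>2 * S'\<^sup>2 + 3 * b\<^sup>2 * \<kappa>\<^sup>2 / \<omega>"
  define B where "B = A * K\<^sup>2 * h powr (2 * r - 2)"
  define a where "a t = \<omega> * (\<integral>x. (e t x)\<^sup>2 \<partial>M)" for t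
  \<comment> \<open>\<open>t \<mapsto> \<parallel>C t\<parallel>\<^sub>r\<^sup>2\<close> is not known to be measurable; \<open>l / B\<close> is a measurable minorant.\<close>
  define l where "l t = max 0 (a t + 2 * P t - c * energy t)" for t
  have c: "c \<ge> 0" using porosity by (simp add: c_def)
  have A: "A > 0" using porosity unfolding A_def by (intro add_pos_nonneg add_nonneg_pos) auto
  have B: "B > 0" using A K h by (simp add: B_def)
  have a_int: "integrable I a" unfolding a_def by (rule e_sq_integrable)
  have a_nonneg: "0 \<le> a t" for t using porosity by (simp add: a_def)
  have l_nonneg: "0 \<le> l t" for t by (simp add: l_def)
  have l_int: "integrable I l"
    unfolding l_def using a_int energy_identities(1,2) by (intro integrable_max) auto
  have trace_C: "has_trace \<Omega> \<Gamma> (C t) g" if "t \<in> {0..T}" for t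
    using exact that by (simp add: exact_solution_def)
  have l_le: "AE t in I. ennreal (l t / B) \<le> sobolev_norm_sq \<Omega> r (C t)"
    using energy_estimate_at_time AE_space
  proof eventually_elim
    case (elim t)
    have t: "t \<in> {0..T}" using elim(2) by simp
    show ?case
    proof (cases "sobolev_norm_sq \<Omega> r (C t) < \<infinity>")
      case True
      define n where "n = sobolev_norm \<Omega> r (C t)"
      define W where "W = {w \<in> X. has_trace \<Omega> \<Gamma> w g\<^sub>h}"
      define m where "m = (INF w\<in>W. sobolev_norm \<Omega> 1 (\<lambda>x. C t x - w x))"
      \<comment> \<open>The discrete solution itself makes \<open>W\<close> nonempty, which a real
        infimum needs in order to inherit lower bounds.\<close>
      have "C\<^sub>h t \<in> W" using discrete t by (simp add: semidiscrete_solution_def W_def)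
      have "m \<le> K * h powr (r - 1) * n"
        using approximation True trace_C[OF t]
        by (simp add: constrained_approximation_property_def sobolev_space_def m_def W_def n_def)
      \<comment> \<open>The approximation property controls the norm and not its square, so the root
        is taken before the infimum.\<close>
      moreover have "sqrt (l t / A) \<le> m"
        unfolding m_def
      proof (rule cINF_greatest)
        show "W \<noteq> {}" using \<open>C\<^sub>h t \<in> W\<close> by blast
        fix w assume w: "w \<in> W"
        then have "a t + 2 * P t \<le> c * energy t + A * (sobolev_norm \<Omega> 1 (\<lambda>x. C t x - w x))\<^sup>2"
          using elim(1) by (simp add: W_def a_def c_def A_def)
        then have "l t \<le> A * (sobolev_norm \<Omega> 1 (\<lambda>x. C t x - w x))\<^sup>2"
          using A by (simp add: l_def)
        then have "l t / A \<le> (sobolev_norm \<Omega> 1 (\<lambda>x. C t x - w x))\<^sup>2"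
          using A by (simp add: field_simps)
        then show "sqrt (l t / A) \<le> sobolev_norm \<Omega> 1 (\<lambda>x. C t x - w x)"
          by (rule real_le_lsqrt[OF _ _, rotated]) (use A in \<open>auto simp: l_def sobolev_norm_def\<close>)
      qed
      ultimately have "sqrt (l t / A) \<le> K * h powr (r - 1) * n" by linarith
      moreover have "0 \<le> l t / A" using A by (simp add: l_def)
      ultimately have "l t / A \<le> (K * h powr (r - 1) * n)\<^sup>2"
        using sqrt_le_D by blast
      also have "\<dots> = K\<^sup>2 * h powr (2 * r - 2) * n\<^sup>2"
        by (simp add: power_mult_distrib power2_eq_square powr_add[symmetric] mult_ac)
      finally have "l t / B \<le> n\<^sup>2"
        using A K h by (simp add: B_def field_simps)
      then have "ennreal (l t / B) \<le> ennreal (n\<^sup>2)" by (rule ennreal_leI)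
      also have "\<dots> = sobolev_norm_sq \<Omega> r (C t)"
        using True by (simp add: n_def sobolev_norm_def)
      finally show ?thesis .
    qed (simp add: not_less top_unique)
  qed
  have "a t + 2 * P t \<le> c * energy t + l t" for t by (simp add: l_def)
  then have gronwall: "(\<integral>t. a t \<partial>I) + energy T \<le> exp (c * T) * (\<integral>t. l t \<partial>I)"
    using energy_identities(1,3)
    by (intro gronwall_energy[where p = "\<lambda>t. 2 * P t", OF T_pos c a_int a_nonneg _ l_int])
      (auto simp: l_def)
  have "(\<integral>\<^sup>+t. l2_norm_sq \<Omega> (e t) \<partial>I) = (\<integral>\<^sup>+t. ennreal (\<integral>x. (e t x)\<^sup>2 \<partial>M) \<partial>I)"
    by (intro nn_integral_cong) (simp add: l2_norm_sq_eq sobolev_1_L2 e_sobolev)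
  also have "\<dots> = ennreal (\<integral>t. (\<integral>x. (e t x)\<^sup>2 \<partial>M) \<partial>I)"
    using integrable_time_sq_sections(2)[OF e_L2_time] by (intro nn_integral_eq_integral) auto
  finally have "ennreal \<omega> * (\<integral>\<^sup>+t. l2_norm_sq \<Omega> (e t) \<partial>I) = ennreal (\<integral>t. a t \<partial>I)"
    using porosity by (simp add: a_def ennreal_mult)
  moreover have "0 \<le> energy T"
  proof -
    have "0 \<le> V T x \<bullet> (D x *v V T x)" if "x \<in> \<Omega>" for x
      using norm_pos_sqrt[OF D_pos[OF that], of "V T x"] by (metis zero_le_power2)
    then show ?thesis unfolding energy_def by (intro integral_nonneg_AE AE_I2) simp
  qed
  ultimately have "ennreal \<omega> * (\<integral>\<^sup>+t. l2_norm_sq \<Omega> (e t) \<partial>I)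
       + l2_norm_sq \<Omega> (time_integral T (\<lambda>s x. pos_sqrt (D x) *v G s x))
     = ennreal ((\<integral>t. a t \<partial>I) + energy T)"
    using a_nonneg by (simp add: flux_norm_eq_energy ennreal_plus)
  also have "\<dots> \<le> ennreal (exp (c * T) * (\<integral>t. l t \<partial>I))" by (rule ennreal_leI[OF gronwall])
  also have "(\<integral>t. l t \<partial>I) = B * (\<integral>t. l t / B \<partial>I)" using B by simp
  also have "ennreal (exp (c * T) * (B * (\<integral>t. l t / B \<partial>I))) = ennreal (exp (c * T) * B) * ennreal (\<integral>t. l t / B \<partial>I)"
    using B by (simp add: ennreal_mult'[symmetric] mult.assoc)
  also have "ennreal (\<integral>t. l t / B \<partial>I) = (\<integral>\<^sup>+t. ennreal (l t / B) \<partial>I)"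
    using l_int B l_nonneg by (intro nn_integral_eq_integral[symmetric]) auto
  \<comment> \<open>The nonnegative integral is monotone also towards a majorant whose measurability
    is unknown.\<close>
  also have "ennreal (exp (c * T) * B) * \<dots> \<le> ennreal (exp (c * T) * B) * (\<integral>\<^sup>+t. sobolev_norm_sq \<Omega> r (C t) \<partial>I)"
    by (intro mult_left_mono nn_integral_mono_AE l_le) simp
  finally show ?thesis by (simp only: c_def B_def A_def)
qed

end

section \<open>Consequences of the hypotheses on mesh, discrete space and isotherm\<close>

lemma regular_mesh_size_pos:
  fixes \<Omega> :: "(real^'n) set"
  assumes "regular_mesh \<Omega> \<T> \<theta> h" shows "h > 0"
proof -
  obtain S where S: "S \<in> \<T>" using assms by (auto simp: regular_mesh_def)
  then obtain x \<rho> where \<rho>: "\<rho> > 0" "cball x \<rho> \<subseteq> S" using assms unfolding regular_mesh_def by blast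
  have fin: "finite \<T>" using assms by (auto simp: regular_mesh_def triangulation_def)
  have "int CARD('n) simplex S" using assms S by (auto simp: regular_mesh_def)
  then have "bounded S" using polytope_imp_bounded simplex_imp_polytope by blast
  \<comment> \<open>Every cell contains a nondegenerate ball. Strict positivity of \<open>h\<close>
    matters because \<open>error_estimate\<close> divides by \<open>B\<close>.\<close>
  have "0 < diameter (cball x \<rho>)" using \<rho>(1) by simp
  also have "\<dots> \<le> diameter S" using \<rho>(2) \<open>bounded S\<close> by (rule diameter_subset)
  also have "\<dots> \<le> h" using assms fin S by (auto simp: regular_mesh_def)
  finally show ?thesis .
qed

lemma finite_element_space_diff:
  assumes "finite_element_space \<Omega> \<T> X" "v \<in> X" "w \<in> X"
  shows "(\<lambda>x. v x - w x) \<in> X"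
proof -
  obtain B where X: "X = {w. \<exists>c. w = (\<lambda>x. \<Sum>b\<in>B. c b * b x)}"
    using assms(1) by (auto simp: finite_element_space_def)
  then obtain c d where "v = (\<lambda>x. \<Sum>b\<in>B. c b * b x)" "w = (\<lambda>x. \<Sum>b\<in>B. d b * b x)"
    using assms(2,3) by auto
  then show ?thesis
    unfolding X by (intro CollectI exI[of _ "\<lambda>b. c b - d b"]) (simp add: left_diff_distrib sum_subtractf)
qed

text \<open>On the whole line \<open>deriv q\<close> is explicitly bounded only from above. The mean
  value theorem therefore controls increases, and strict monotonicity settles the absolute
  value.\<close>

lemma admissible_isotherm_lipschitz:
  assumes "admissible_isotherm q \<kappa>\<^sub>1 \<kappa>\<^sub>2"
  shows "\<bar>q c - q d\<bar> \<le> \<kappa>\<^sub>2 * \<bar>c - d\<bar>"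
proof (induction c d rule: linorder_wlog)
  case (le c d)
  show ?case
  proof (cases "c = d")
    case False
    with le have "c < d" by simp
    have "(q has_real_derivative deriv q x) (at x)" for x
      using assms by (simp add: admissible_isotherm_def DERIV_deriv_iff_real_differentiable)
    from MVT2[OF \<open>c < d\<close> this] obtain x where "q d - q c = (d - c) * deriv q x" by blast
    also have "\<dots> \<le> (d - c) * \<kappa>\<^sub>2"
      using assms \<open>c < d\<close> by (intro mult_left_mono) (auto simp: admissible_isotherm_def)
    finally have "q d - q c \<le> \<kappa>\<^sub>2 * (d - c)" by (simp add: mult.commute)
    moreover have "q c < q d" using assms \<open>c < d\<close> by (auto simp: admissible_isotherm_def strict_mono_def)
    ultimately show ?thesis using \<open>c < d\<close> by simp
  qed simp
qed (simp add: abs_minus_commute)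

theorem theorem5:
  fixes \<Omega> :: "(real^'n) set" and \<T> :: "(real^'n) set set"
    and X :: "(real^'n \<Rightarrow> real) set"
    and I\<^sub>h :: "(real^'n \<Rightarrow> real) \<Rightarrow> real^'n \<Rightarrow> real"
    and u :: "real^'n \<Rightarrow> real^'n" and D :: "real^'n \<Rightarrow> real^'n^'n"
    and q :: "real \<Rightarrow> real" and f :: "real \<Rightarrow> real^'n \<Rightarrow> real"
    and g C\<^sub>0 :: "real^'n \<Rightarrow> real"
    and C C\<^sub>h :: "real \<Rightarrow> real^'n \<Rightarrow> real"
    and T \<omega> \<rho>\<^sub>s \<beta>\<^sub>1 \<beta>\<^sub>2 \<kappa>\<^sub>1 \<kappa>\<^sub>2 \<theta> h K r :: real and k :: nat
  assumes dim: "CARD('n) \<in> {1, 2, 3}"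
    and domain: "polyhedral_domain \<Omega>"
    and time: "T > 0"
    and porosity: "0 < \<omega>" "\<omega> \<le> 1"
    and density: "0 \<le> \<rho>\<^sub>s"
    and velocity: "admissible_velocity \<Omega> u"
    and diffusion: "admissible_diffusion \<Omega> D \<beta>\<^sub>1 \<beta>\<^sub>2"
    and inv_sqrt_bounded:
      "bdd_above ((\<lambda>x. onorm ((*v) (matrix_inv (pos_sqrt (D x))))) ` \<Omega>)"
    and isotherm: "admissible_isotherm q \<kappa>\<^sub>1 \<kappa>\<^sub>2"
    and source: "f \<in> L2_time T \<Omega>"
    and initial: "C\<^sub>0 \<in> L2 \<Omega>"
    and solution_exists:
      "\<exists>c. c \<in> Linf_time_L2 T \<Omega> \<and> exact_solution \<Omega> T \<omega> \<rho>\<^sub>s q u D f C\<^sub>0 g c"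
    and solution_unique:
      "\<And>c c'. c \<in> Linf_time_L2 T \<Omega> \<Longrightarrow> exact_solution \<Omega> T \<omega> \<rho>\<^sub>s q u D f C\<^sub>0 g c \<Longrightarrow>
         c' \<in> Linf_time_L2 T \<Omega> \<Longrightarrow> exact_solution \<Omega> T \<omega> \<rho>\<^sub>s q u D f C\<^sub>0 g c' \<Longrightarrow>
         AE t in lebesgue_on {0..T}. AE x in lebesgue_on \<Omega>. c t x = c' t x"
    and mesh: "regular_mesh \<Omega> \<T> \<theta> h"
    and fe_space: "finite_element_space \<Omega> \<T> X"
    and interpolation: "boundary_interpolation (inflow_boundary \<Omega> u) X I\<^sub>h"
    and degree: "k \<ge> 1"
    and order: "1 \<le> r" "r \<le> real k + 1"
    and K_pos: "K > 0"
    and approximation: "approximation_property \<Omega> X h K r"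
    and constrained_approximation:
      "constrained_approximation_property \<Omega> (inflow_boundary \<Omega> u) X g (I\<^sub>h g) h K r"
    and exact: "exact_solution \<Omega> T \<omega> \<rho>\<^sub>s q u D f C\<^sub>0 g C"
    and regularity: "C \<in> H1_time_sobolev T \<Omega> (k + 1)"
    and discrete: "semidiscrete_solution \<Omega> T \<omega> \<rho>\<^sub>s q u D f C\<^sub>0 X (I\<^sub>h g) C\<^sub>h"
  shows
    "ennreal \<omega> * (\<integral>\<^sup>+t. l2_norm_sq \<Omega> (\<lambda>x. C t x - C\<^sub>h t x) \<partial>lebesgue_on {0..T})
       + l2_norm_sq \<Omega> (time_integral T
           (\<lambda>s x. pos_sqrt (D x) *v space_grad T \<Omega> (\<lambda>t y. C t y - C\<^sub>h t y) s x))
     \<le> ennreal (h powr (2 * r - 2))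
       * (\<integral>\<^sup>+t. sobolev_norm_sq \<Omega> r (C t) \<partial>lebesgue_on {0..T})
       * ennreal (exp (T + 3 * T * (sup_norm \<Omega> u)\<^sup>2
             * (mat_sup_norm \<Omega> (\<lambda>x. matrix_inv (pos_sqrt (D x))))\<^sup>2 / \<omega>))
       * ennreal (4 * (mat_sup_norm \<Omega> (\<lambda>x. pos_sqrt (D x)))\<^sup>2 + 3 * \<omega>
             + 4 * (sup_norm \<Omega> u)\<^sup>2 * (mat_sup_norm \<Omega> (\<lambda>x. matrix_inv (pos_sqrt (D x))))\<^sup>2
             + 3 * (1 - \<omega>)\<^sup>2 * \<rho>\<^sub>s\<^sup>2 * \<kappa>\<^sub>2\<^sup>2 / \<omega>)
       * ennreal (K\<^sup>2)"
proof -
  have \<Omega>: "open \<Omega>" "bounded \<Omega>" using domain by (auto simp: polyhedral_domain_def)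
  interpret semidiscrete_error T \<Omega> X u D q f g "I\<^sub>h g" C\<^sub>0 C C\<^sub>h \<omega> \<rho>\<^sub>s \<beta>\<^sub>1 \<kappa>\<^sub>2
  proof
    show "\<Omega> \<in> lmeasurable" using \<Omega> by (rule lmeasurable_open[rotated])
    show "u \<in> borel_measurable (lebesgue_on \<Omega>)" "bounded (u ` \<Omega>)"
      using velocity by (auto simp: admissible_velocity_def)
    show "D \<in> borel_measurable (lebesgue_on \<Omega>)"
      and "\<And>x. x \<in> \<Omega> \<Longrightarrow> sym_pos_def (D x)" "\<And>x. x \<in> \<Omega> \<Longrightarrow> onorm ((*v) (D x)) \<le> \<beta>\<^sub>1"
      using diffusion by (auto simp: admissible_diffusion_def)
    show "continuous_on UNIV q" "q 0 = 0"
      using isotherm by (auto simp: admissible_isotherm_def intro!: differentiable_imp_continuous_on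
          differentiable_at_imp_differentiable_on)
    show "0 \<le> (q c - q d) * (c - d)" for c d
      using isotherm strict_mono_less_eq[of q c d] strict_mono_less_eq[of q d c]
      by (auto simp: admissible_isotherm_def zero_le_mult_iff)
    show "X \<subseteq> sobolev_space \<Omega> 1" using fe_space by (auto simp: finite_element_space_def)
  qed (use time \<Omega> porosity density inv_sqrt_bounded exact discrete admissible_isotherm_lipschitz[OF isotherm]
      finite_element_space_diff[OF fe_space] in auto)
  let ?N = "\<integral>\<^sup>+t. sobolev_norm_sq \<Omega> r (C t) \<partial>lebesgue_on {0..T}"
  define E where "E = exp (T + 3 * T * U\<^sup>2 * S'\<^sup>2 / \<omega>)"
  define A where "A = 4 * S\<^sup>2 + 3 * \<omega> + 4 * U\<^sup>2 * S'\<^sup>2 + 3 * (1 - \<omega>)\<^sup>2 * \<rho>\<^sub>s\<^sup>2 * \<kappa>\<^sub>2\<^sup>2 / \<omega>"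
  have A: "A \<ge> 0" "A = 4 * S\<^sup>2 + 3 * \<omega> + 4 * U\<^sup>2 * S'\<^sup>2 + 3 * b\<^sup>2 * \<kappa>\<^sub>2\<^sup>2 / \<omega>"
    using porosity by (simp_all add: A_def power_mult_distrib mult.assoc)
  have "ennreal \<omega> * (\<integral>\<^sup>+t. l2_norm_sq \<Omega> (\<lambda>x. C t x - C\<^sub>h t x) \<partial>lebesgue_on {0..T})
       + l2_norm_sq \<Omega> (time_integral T
           (\<lambda>s x. pos_sqrt (D x) *v space_grad T \<Omega> (\<lambda>t y. C t y - C\<^sub>h t y) s x))
     \<le> ennreal (exp ((1 / 2 + 3 * U\<^sup>2 * S'\<^sup>2 / \<omega>) * T) * (A * K\<^sup>2 * h powr (2 * r - 2))) * ?N"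
    using error_estimate[OF regular_mesh_size_pos[OF mesh] K_pos constrained_approximation]
    unfolding A(2) G_def e_def .
  \<comment> \<open>The exponent obtained so far contains \<open>T / 2\<close>, from the two weights
    1/8; it is relaxed to the \<open>T\<close> of the claim.\<close>
  also have "\<dots> \<le> ennreal (E * (A * K\<^sup>2 * h powr (2 * r - 2))) * ?N"
    using T_pos A(1) unfolding E_def
    by (intro mult_right_mono ennreal_leI) (auto simp: field_simps)
  also have "ennreal (E * (A * K\<^sup>2 * h powr (2 * r - 2)))
      = ennreal E * (ennreal A * ennreal (K\<^sup>2) * ennreal (h powr (2 * r - 2)))"
    using A(1) by (simp add: E_def ennreal_mult)
  also have "\<dots> * ?N = ennreal (h powr (2 * r - 2)) * ?N * ennreal E * ennreal A * ennreal (K\<^sup>2)"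
    by (simp add: mult_ac)
  finally show ?thesis unfolding E_def A_def .
qed

end
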